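(* Let $\mathcal{O}=\mathcal{F}(V)/(R)$ be a binary quadratic operad over a field $\mathbb{K}$ with $V$ finite dimensional. Let $\mathcal{O}^2$ be the operad encoding two linearly compatible $\mathcal{O}$-algebras, let $\mathcal{L}ie^2$ be the operad encoding two linearly compatible Lie algebras, and let $\bullet$ denote the black product of binary quadratic operads. Then $$\mathcal{O}^2=\mathcal{O}\bullet\mathcal{L}ie^2 .$$
   Context: Operads are $\mathbb{K}$-linear symmetric operads ($\mathbb{S}$-modules are collections of right $\mathbb{S}_n$-modules, $n\ge1$). $\mathcal{F}(V)$ is the free operad on an $\mathbb{S}$-module $V$ (spanned by rooted trees with labelled leaves and internal vertices decorated by $V$) and $\mathcal{F}_{(2)}(V)$ is the part spanned by trees with two internal vertices. A quadratic operad $\mathcal{F}(V)/(R)$ is the quotient by the operadic ideal generated by $R\subset\mathcal{F}_{(2)}(V)$ ($R$ is identified with the $\mathbb{S}$-submodule it spans); it is binary if $V(n)=0$ for $n\ne2$, and then we write $V$ for $V(2)$ and $\mathcal{F}_{(2)}(V)=\mathcal{F}(V)(3)$. If $e_1,\dots,e_s$ is a basis of $V$, then $\mathcal{F}(V)(3)$ has basis $T^1_{i,j}=e_j(e_i(1,2),3)$, $T^2_{i,j}=e_j(e_i(2,3),1)$, $T^3_{i,j}=e_j(e_i(3,1),2)$, $1\le i,j\le s$. Let $R$ be spanned by $r_k=\sum_{l=1}^{3}\sum_{i,j}\gamma^{k,l}_{i,j}T^l_{i,j}$, $1\le k\le t$. Linear compatibility. Let $V_\circ,V_\bullet$ be two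 copies of $V$ with bases $e_i^\circ$, $e_i^\bullet$ corresponding to $e_i$. For $x,y\in\{\circ,\bullet\}$ let $T^{l}_{i,j}(x,y)$ be the tree $T^l_{i,j}$ with its inner vertex (carrying two leaves) decorated by $e^x_i$ and its root vertex by $e^y_j$. Let $R_\circ$, $R_\bullet$ be the copies of $R$ in $\mathcal{F}(V_\circ)$, $\mathcal{F}(V_\bullet)$, and $R_{\circ\bullet}=\{\sum_{l,i,j}\gamma^{k,l}_{i,j}(T^l_{i,j}(\circ,\bullet)+T^l_{i,j}(\bullet,\circ))\}_{1\le k\le t}$. Then $\mathcal{O}^2:=\mathcal{F}(V_\circ\oplus V_\bullet)/(R_\circ\cup R_\bullet\cup R_{\circ\bullet})$. $\mathcal{L}ie^2$ is this construction applied to the Lie operad: it is generated by $\operatorname{sgn}_2\oplus\operatorname{sgn}_2=\mathbb{K}\,w\oplus\mathbb{K}\,b$ (two skew-symmetric brackets), with relations the Jacobi identity for $w$, the Jacobi identity for $b$, and $b(w(1,2),3)+b(w(2,3),1)+b(w(3,1),2)+w(b(1,2),3)+w(b(2,3),1)+w(b(3,1),2)=0$. Here $\operatorname{sgn}_n$ is the sign representation. Black product. For binary quadratic operads $\mathcal{F}(V)/(R)$ and $\mathcal{F}(W)/(S)$ with $V,W$ finite dimensional with bases $(e_i)$, $(f_k)$, define $\Psi:\mathcal{F}(V)(3)\otimes\mathcal{F}(W)(3)\otimes\operatorname{sgn}_3\to\mathcal{F}(V\otimes W\otimes\operatorname{sgn}_2)(3)$ by sending $T^{l}_{i,j}\otimes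 T^{l'}_{k,m}$ to $0$ if $l\neq l'$ and, if $l=l'$, to the tree of the same shape and labelling $l$ with inner vertex decorated by $e_i\otimes f_k$ and root vertex decorated by $e_j\otimes f_m$. The black product is $\mathcal{F}(V)/(R)\bullet\mathcal{F}(W)/(S):=\mathcal{F}(V\otimes W\otimes\operatorname{sgn}_2)/(\Psi(R\otimes S))$. The equality is understood under the identification of generators $e_i^\circ\leftrightarrow e_i\otimes w$, $e_i^\bullet\leftrightarrow e_i\otimes b$ (using $\operatorname{sgn}_2\otimes\operatorname{sgn}_2\cong$ trivial representation). *)

theory Defs
  imports Complex_Main "HOL-Library.Poly_Mapping" "HOL-Combinatorics.Permutations"
begin

section \<open>Linear combinations\<close>

definition pscale :: "'k::field \<Rightarrow> ('x \<Rightarrow>\<^sub>0 'k) \<Rightarrow> ('x \<Rightarrow>\<^sub>0 'k)" where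
  "pscale c p = Poly_Mapping.map ((*) c) p"

definition monom :: "'x \<Rightarrow> ('x \<Rightarrow>\<^sub>0 'k::field)" where
  "monom x = Poly_Mapping.single x 1"

definition lin_ext :: "('x \<Rightarrow> ('y \<Rightarrow>\<^sub>0 'k)) \<Rightarrow> ('x \<Rightarrow>\<^sub>0 'k) \<Rightarrow> ('y \<Rightarrow>\<^sub>0 'k::field)" where
  "lin_ext f p = (\<Sum>x\<in>Poly_Mapping.keys p. pscale (Poly_Mapping.lookup p x) (f x))"


section \<open>Linear symmetric operads\<close>

text \<open>
  The component of arity \<open>n\<close> has carrier \<open>op_carrier P n\<close>; only arities \<open>n \<ge> 1\<close> matter.
  A permutation of \<open>{1..n}\<close> is a function with \<open>\<sigma> permutes {1..n}\<close>, and
  \<open>op_act P n x \<sigma>\<close> is the right action \<open>x \<cdot> \<sigma>\<close>.  For \<open>x\<close> of arity \<open>m\<close> and \<open>y\<close> of arity \<open>n\<close>,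
  \<open>op_comp P m n i x y\<close> is the partial composite of arity \<open>m + n - 1\<close> that plugs \<open>y\<close> into
  the \<open>i\<close>-th input of \<open>x\<close>, where \<open>1 \<le> i \<le> m\<close>.
\<close>

record ('k, 'a) operad =
  op_carrier :: "nat \<Rightarrow> 'a set"
  op_zero :: "nat \<Rightarrow> 'a"
  op_add :: "nat \<Rightarrow> 'a \<Rightarrow> 'a \<Rightarrow> 'a"
  op_scale :: "nat \<Rightarrow> 'k \<Rightarrow> 'a \<Rightarrow> 'a"
  op_act :: "nat \<Rightarrow> 'a \<Rightarrow> (nat \<Rightarrow> nat) \<Rightarrow> 'a"
  op_unit :: 'a
  op_comp :: "nat \<Rightarrow> nat \<Rightarrow> nat \<Rightarrow> 'a \<Rightarrow> 'a \<Rightarrow> 'a"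

text \<open>
  The permutations of \<open>{1..m + n - 1}\<close> occurring in the equivariance axioms
  \<open>x \<circ>\<^sub>i (y \<cdot> \<sigma>) = (x \<circ>\<^sub>i y) \<cdot> inner_perm n i \<sigma>\<close> and
  \<open>(x \<cdot> \<sigma>) \<circ>\<^sub>i y = (x \<circ>\<^bsub>\<sigma> i\<^esub> y) \<cdot> outer_perm m n i \<sigma>\<close>.
\<close>

definition inner_perm :: "nat \<Rightarrow> nat \<Rightarrow> (nat \<Rightarrow> nat) \<Rightarrow> nat \<Rightarrow> nat" where
  "inner_perm n i \<sigma> x = (if i \<le> x \<and> x < i + n then \<sigma> (x - i + 1) + i - 1 else x)"

definition outer_perm :: "nat \<Rightarrow> nat \<Rightarrow> nat \<Rightarrow> (nat \<Rightarrow> nat) \<Rightarrow> nat \<Rightarrow> nat" where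
  "outer_perm m n i \<sigma> x =
     (if x < 1 \<or> m + n - 1 < x then x
      else if i \<le> x \<and> x < i + n then x - i + \<sigma> i
      else let y = \<sigma> (if x < i then x else x + 1 - n)
           in if y < \<sigma> i then y else y + n - 1)"

locale is_operad =
  fixes P :: "('k::field, 'a) operad"
  assumes zero_closed: "\<And>n. 1 \<le> n \<Longrightarrow> op_zero P n \<in> op_carrier P n"
    and add_closed: "\<And>n x y. \<lbrakk>1 \<le> n; x \<in> op_carrier P n; y \<in> op_carrier P n\<rbrakk>
      \<Longrightarrow> op_add P n x y \<in> op_carrier P n"
    and scale_closed: "\<And>n c x. \<lbrakk>1 \<le> n; x \<in> op_carrier P n\<rbrakk> \<Longrightarrow> op_scale P n c x \<in> op_carrier P n"
    and add_assoc: "\<And>n x y z. \<lbrakk>1 \<le> n; x \<in> op_carrier P n; y \<in> op_carrier P n; z \<in> op_carrier P n\<rbrakk>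
      \<Longrightarrow> op_add P n (op_add P n x y) z = op_add P n x (op_add P n y z)"
    and add_commute: "\<And>n x y. \<lbrakk>1 \<le> n; x \<in> op_carrier P n; y \<in> op_carrier P n\<rbrakk>
      \<Longrightarrow> op_add P n x y = op_add P n y x"
    and add_zero: "\<And>n x. \<lbrakk>1 \<le> n; x \<in> op_carrier P n\<rbrakk> \<Longrightarrow> op_add P n x (op_zero P n) = x"
    and add_inverse: "\<And>n x. \<lbrakk>1 \<le> n; x \<in> op_carrier P n\<rbrakk>
      \<Longrightarrow> op_add P n x (op_scale P n (- 1) x) = op_zero P n"
    and scale_add: "\<And>n c x y. \<lbrakk>1 \<le> n; x \<in> op_carrier P n; y \<in> op_carrier P n\<rbrakk>
      \<Longrightarrow> op_scale P n c (op_add P n x y) = op_add P n (op_scale P n c x) (op_scale P n c y)"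
    and add_scale: "\<And>n c d x. \<lbrakk>1 \<le> n; x \<in> op_carrier P n\<rbrakk>
      \<Longrightarrow> op_scale P n (c + d) x = op_add P n (op_scale P n c x) (op_scale P n d x)"
    and scale_scale: "\<And>n c d x. \<lbrakk>1 \<le> n; x \<in> op_carrier P n\<rbrakk>
      \<Longrightarrow> op_scale P n c (op_scale P n d x) = op_scale P n (c * d) x"
    and scale_one: "\<And>n x. \<lbrakk>1 \<le> n; x \<in> op_carrier P n\<rbrakk> \<Longrightarrow> op_scale P n 1 x = x"
    and act_closed: "\<And>n x \<sigma>. \<lbrakk>1 \<le> n; x \<in> op_carrier P n; \<sigma> permutes {1..n}\<rbrakk>
      \<Longrightarrow> op_act P n x \<sigma> \<in> op_carrier P n"
    and act_add: "\<And>n x y \<sigma>. \<lbrakk>1 \<le> n; x \<in> op_carrier P n; y \<in> op_carrier P n; \<sigma> permutes {1..n}\<rbrakk>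
      \<Longrightarrow> op_act P n (op_add P n x y) \<sigma> = op_add P n (op_act P n x \<sigma>) (op_act P n y \<sigma>)"
    and act_scale: "\<And>n c x \<sigma>. \<lbrakk>1 \<le> n; x \<in> op_carrier P n; \<sigma> permutes {1..n}\<rbrakk>
      \<Longrightarrow> op_act P n (op_scale P n c x) \<sigma> = op_scale P n c (op_act P n x \<sigma>)"
    and act_id: "\<And>n x. \<lbrakk>1 \<le> n; x \<in> op_carrier P n\<rbrakk> \<Longrightarrow> op_act P n x id = x"
    and act_act: "\<And>n x \<sigma> \<tau>. \<lbrakk>1 \<le> n; x \<in> op_carrier P n; \<sigma> permutes {1..n}; \<tau> permutes {1..n}\<rbrakk>
      \<Longrightarrow> op_act P n (op_act P n x \<sigma>) \<tau> = op_act P n x (\<sigma> \<circ> \<tau>)"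
    and unit_closed: "op_unit P \<in> op_carrier P 1"
    and comp_closed: "\<And>m n i x y. \<lbrakk>1 \<le> i; i \<le> m; 1 \<le> n; x \<in> op_carrier P m; y \<in> op_carrier P n\<rbrakk>
      \<Longrightarrow> op_comp P m n i x y \<in> op_carrier P (m + n - 1)"
    and comp_add_left: "\<And>m n i x x' y.
      \<lbrakk>1 \<le> i; i \<le> m; 1 \<le> n; x \<in> op_carrier P m; x' \<in> op_carrier P m; y \<in> op_carrier P n\<rbrakk>
      \<Longrightarrow> op_comp P m n i (op_add P m x x') y
        = op_add P (m + n - 1) (op_comp P m n i x y) (op_comp P m n i x' y)"
    and comp_add_right: "\<And>m n i x y y'.
      \<lbrakk>1 \<le> i; i \<le> m; 1 \<le> n; x \<in> op_carrier P m; y \<in> op_carrier P n; y' \<in> op_carrier P n\<rbrakk>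
      \<Longrightarrow> op_comp P m n i x (op_add P n y y')
        = op_add P (m + n - 1) (op_comp P m n i x y) (op_comp P m n i x y')"
    and comp_scale_left: "\<And>m n i c x y.
      \<lbrakk>1 \<le> i; i \<le> m; 1 \<le> n; x \<in> op_carrier P m; y \<in> op_carrier P n\<rbrakk>
      \<Longrightarrow> op_comp P m n i (op_scale P m c x) y = op_scale P (m + n - 1) c (op_comp P m n i x y)"
    and comp_scale_right: "\<And>m n i c x y.
      \<lbrakk>1 \<le> i; i \<le> m; 1 \<le> n; x \<in> op_carrier P m; y \<in> op_carrier P n\<rbrakk>
      \<Longrightarrow> op_comp P m n i x (op_scale P n c y) = op_scale P (m + n - 1) c (op_comp P m n i x y)"
    and comp_unit_left: "\<And>n y. \<lbrakk>1 \<le> n; y \<in> op_carrier P n\<rbrakk> \<Longrightarrow> op_comp P 1 n 1 (op_unit P) y = y"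
    and comp_unit_right: "\<And>m i x. \<lbrakk>1 \<le> i; i \<le> m; x \<in> op_carrier P m\<rbrakk>
      \<Longrightarrow> op_comp P m 1 i x (op_unit P) = x"
    and comp_sequential: "\<And>l m n i j x y z.
      \<lbrakk>1 \<le> i; i \<le> l; 1 \<le> j; j \<le> m; 1 \<le> n;
       x \<in> op_carrier P l; y \<in> op_carrier P m; z \<in> op_carrier P n\<rbrakk>
      \<Longrightarrow> op_comp P (l + m - 1) n (i + j - 1) (op_comp P l m i x y) z
        = op_comp P l (m + n - 1) i x (op_comp P m n j y z)"
    and comp_parallel: "\<And>l m n i k x y z.
      \<lbrakk>1 \<le> i; i < k; k \<le> l; 1 \<le> m; 1 \<le> n;
       x \<in> op_carrier P l; y \<in> op_carrier P m; z \<in> op_carrier P n\<rbrakk>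
      \<Longrightarrow> op_comp P (l + m - 1) n (k + m - 1) (op_comp P l m i x y) z
        = op_comp P (l + n - 1) m i (op_comp P l n k x z) y"
    and comp_act_right: "\<And>m n i x y \<sigma>.
      \<lbrakk>1 \<le> i; i \<le> m; 1 \<le> n; x \<in> op_carrier P m; y \<in> op_carrier P n; \<sigma> permutes {1..n}\<rbrakk>
      \<Longrightarrow> op_comp P m n i x (op_act P n y \<sigma>)
        = op_act P (m + n - 1) (op_comp P m n i x y) (inner_perm n i \<sigma>)"
    and comp_act_left: "\<And>m n i x y \<sigma>.
      \<lbrakk>1 \<le> i; i \<le> m; 1 \<le> n; x \<in> op_carrier P m; y \<in> op_carrier P n; \<sigma> permutes {1..m}\<rbrakk>
      \<Longrightarrow> op_comp P m n i (op_act P m x \<sigma>) y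
        = op_act P (m + n - 1) (op_comp P m n (\<sigma> i) x y) (outer_perm m n i \<sigma>)"

definition operad_iso ::
    "(nat \<Rightarrow> 'a \<Rightarrow> 'b) \<Rightarrow> ('k::field, 'a) operad \<Rightarrow> ('k, 'b) operad \<Rightarrow> bool" where
  "operad_iso \<Phi> P Q \<longleftrightarrow>
     is_operad P \<and> is_operad Q \<and>
     (\<forall>n\<ge>1. bij_betw (\<Phi> n) (op_carrier P n) (op_carrier Q n)) \<and>
     (\<forall>n\<ge>1. \<forall>x\<in>op_carrier P n. \<forall>y\<in>op_carrier P n.
        \<Phi> n (op_add P n x y) = op_add Q n (\<Phi> n x) (\<Phi> n y)) \<and>
     (\<forall>n\<ge>1. \<forall>c. \<forall>x\<in>op_carrier P n. \<Phi> n (op_scale P n c x) = op_scale Q n c (\<Phi> n x)) \<and>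
     (\<forall>n\<ge>1. \<forall>x\<in>op_carrier P n. \<forall>\<sigma>. \<sigma> permutes {1..n} \<longrightarrow>
        \<Phi> n (op_act P n x \<sigma>) = op_act Q n (\<Phi> n x) \<sigma>) \<and>
     \<Phi> 1 (op_unit P) = op_unit Q \<and>
     (\<forall>m\<ge>1. \<forall>n\<ge>1. \<forall>i\<in>{1..m}. \<forall>x\<in>op_carrier P m. \<forall>y\<in>op_carrier P n.
        \<Phi> (m + n - 1) (op_comp P m n i x y) = op_comp Q m n i (\<Phi> m x) (\<Phi> n y))"

definition sub_S_module :: "('k::field, 'a) operad \<Rightarrow> (nat \<Rightarrow> 'a set) \<Rightarrow> bool" where
  "sub_S_module P I \<longleftrightarrow>
     (\<forall>n\<ge>1. I n \<subseteq> op_carrier P n \<and> op_zero P n \<in> I n \<and>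
        (\<forall>x\<in>I n. \<forall>y\<in>I n. op_add P n x y \<in> I n) \<and>
        (\<forall>c. \<forall>x\<in>I n. op_scale P n c x \<in> I n) \<and>
        (\<forall>x\<in>I n. \<forall>\<sigma>. \<sigma> permutes {1..n} \<longrightarrow> op_act P n x \<sigma> \<in> I n))"

definition operadic_ideal :: "('k::field, 'a) operad \<Rightarrow> (nat \<Rightarrow> 'a set) \<Rightarrow> bool" where
  "operadic_ideal P I \<longleftrightarrow> sub_S_module P I \<and>
     (\<forall>m\<ge>1. \<forall>n\<ge>1. \<forall>i\<in>{1..m}. \<forall>x y.
        x \<in> I m \<and> y \<in> op_carrier P n \<or> x \<in> op_carrier P m \<and> y \<in> I n \<longrightarrow>
        op_comp P m n i x y \<in> I (m + n - 1))"

definition S_module_span :: "('k::field, 'a) operad \<Rightarrow> (nat \<Rightarrow> 'a set) \<Rightarrow> nat \<Rightarrow> 'a set" where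
  "S_module_span P X = Inf {I. sub_S_module P I \<and> X \<le> I}"

definition generated_ideal :: "('k::field, 'a) operad \<Rightarrow> (nat \<Rightarrow> 'a set) \<Rightarrow> nat \<Rightarrow> 'a set" where
  "generated_ideal P X = Inf {I. operadic_ideal P I \<and> X \<le> I}"

definition in_arity :: "nat \<Rightarrow> 'a set \<Rightarrow> nat \<Rightarrow> 'a set" where
  "in_arity k X n = (if n = k then X else {})"

definition op_coset :: "('k::field, 'a) operad \<Rightarrow> (nat \<Rightarrow> 'a set) \<Rightarrow> nat \<Rightarrow> 'a \<Rightarrow> 'a set" where
  "op_coset P I n x = op_add P n x ` I n"

definition quotient_operad ::
    "('k::field, 'a) operad \<Rightarrow> (nat \<Rightarrow> 'a set) \<Rightarrow> ('k, 'a set) operad" where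
  "quotient_operad P I = \<lparr>
     op_carrier = (\<lambda>n. op_coset P I n ` op_carrier P n),
     op_zero = (\<lambda>n. op_coset P I n (op_zero P n)),
     op_add = (\<lambda>n A B. \<Union>x\<in>A. \<Union>y\<in>B. op_coset P I n (op_add P n x y)),
     op_scale = (\<lambda>n c A. \<Union>x\<in>A. op_coset P I n (op_scale P n c x)),
     op_act = (\<lambda>n A \<sigma>. \<Union>x\<in>A. op_coset P I n (op_act P n x \<sigma>)),
     op_unit = op_coset P I 1 (op_unit P),
     op_comp = (\<lambda>m n i A B. \<Union>x\<in>A. \<Union>y\<in>B. op_coset P I (m + n - 1) (op_comp P m n i x y)) \<rparr>"


section \<open>Free operads on \<open>S\<^sub>2\<close>-modules\<close>

text \<open>
  A binary \<open>S\<close>-module is a vector space \<open>V = V(2)\<close> with an involution, the right action of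
  the transposition.
\<close>

record ('k, 'v) S2_module =
  mod_carrier :: "'v set"
  mod_zero :: 'v
  mod_add :: "'v \<Rightarrow> 'v \<Rightarrow> 'v"
  mod_scale :: "'k \<Rightarrow> 'v \<Rightarrow> 'v"
  mod_swap :: "'v \<Rightarrow> 'v"

definition S2_module_of ::
    "('k::field \<Rightarrow> 'v::ab_group_add \<Rightarrow> 'v) \<Rightarrow> ('v \<Rightarrow> 'v) \<Rightarrow> ('k, 'v) S2_module" where
  "S2_module_of scale \<tau> = \<lparr>mod_carrier = UNIV, mod_zero = 0, mod_add = (+),
     mod_scale = scale, mod_swap = \<tau>\<rparr>"

text \<open>
  Planar binary trees with labelled leaves: \<open>Vertex v s t\<close> is the tree \<open>v(s, t)\<close>.
\<close>

datatype (vertices: 'v) btree = Leaf nat | Vertex 'v "'v btree" "'v btree"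

primrec leaves :: "'v btree \<Rightarrow> nat list" where
  "leaves (Leaf a) = [a]"
| "leaves (Vertex v s t) = leaves s @ leaves t"

primrec graft :: "(nat \<Rightarrow> 'v btree) \<Rightarrow> 'v btree \<Rightarrow> 'v btree" where
  "graft f (Leaf a) = f a"
| "graft f (Vertex v s t) = Vertex v (graft f s) (graft f t)"

definition relabel :: "(nat \<Rightarrow> nat) \<Rightarrow> 'v btree \<Rightarrow> 'v btree" where
  "relabel f = graft (\<lambda>a. Leaf (f a))"

definition tree_comp :: "nat \<Rightarrow> nat \<Rightarrow> 'v btree \<Rightarrow> 'v btree \<Rightarrow> 'v btree" where
  "tree_comp n i s t = graft (\<lambda>a. if a < i then Leaf a
     else if a = i then relabel (\<lambda>b. b + i - 1) t else Leaf (a + n - 1)) s"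

definition trees :: "('k, 'v) S2_module \<Rightarrow> nat \<Rightarrow> 'v btree set" where
  "trees V n = {t. vertices t \<subseteq> mod_carrier V \<and> distinct (leaves t) \<and> set (leaves t) = {1..n}}"

text \<open>
  Formal linear combinations of planar decorated trees.  The action is
  \<open>(x \<cdot> \<sigma>)(a\<^sub>1, \<dots>, a\<^sub>n) = x(a\<^bsub>\<sigma>\<inverse>(1)\<^esub>, \<dots>, a\<^bsub>\<sigma>\<inverse>(n)\<^esub>)\<close>.
\<close>

definition tree_operad :: "('k::field, 'v) S2_module \<Rightarrow> ('k, 'v btree \<Rightarrow>\<^sub>0 'k) operad" where
  "tree_operad V = \<lparr>
     op_carrier = (\<lambda>n. {p. Poly_Mapping.keys p \<subseteq> trees V n}),
     op_zero = (\<lambda>n. 0),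
     op_add = (\<lambda>n. (+)),
     op_scale = (\<lambda>n. pscale),
     op_act = (\<lambda>n p \<sigma>. lin_ext (\<lambda>t. monom (relabel (inv \<sigma>) t)) p),
     op_unit = monom (Leaf 1),
     op_comp = (\<lambda>m n i p q. lin_ext (\<lambda>s. lin_ext (\<lambda>t. monom (tree_comp n i s t)) q) p) \<rparr>"

text \<open>
  The free operad \<open>\<F>(V)\<close> is spanned by decorated trees, which are linear in the decoration
  of each vertex and satisfy \<open>(v \<cdot> \<tau>)(1, 2) = v(2, 1)\<close> at each vertex; in particular the
  planar structure of the trees is immaterial.
\<close>

definition corolla :: "'v \<Rightarrow> ('v btree \<Rightarrow>\<^sub>0 'k::field)" where
  "corolla v = monom (Vertex v (Leaf 1) (Leaf 2))"

definition corolla_relations :: "('k::field, 'v) S2_module \<Rightarrow> ('v btree \<Rightarrow>\<^sub>0 'k) set" where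
  "corolla_relations V =
     {corolla (mod_add V u v) - (corolla u + corolla v) |u v.
        u \<in> mod_carrier V \<and> v \<in> mod_carrier V} \<union>
     {corolla (mod_scale V c v) - pscale c (corolla v) |c v. v \<in> mod_carrier V} \<union>
     {corolla (mod_swap V v) - monom (Vertex v (Leaf 2) (Leaf 1)) |v. v \<in> mod_carrier V}"

definition tree_ideal :: "('k::field, 'v) S2_module \<Rightarrow> nat \<Rightarrow> ('v btree \<Rightarrow>\<^sub>0 'k) set" where
  "tree_ideal V = generated_ideal (tree_operad V) (in_arity 2 (corolla_relations V))"

type_synonym ('k, 'v) free_element = "('v btree \<Rightarrow>\<^sub>0 'k) set"

definition free_operad :: "('k::field, 'v) S2_module \<Rightarrow> ('k, ('k, 'v) free_element) operad" where
  "free_operad V = quotient_operad (tree_operad V) (tree_ideal V)"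

definition free_class ::
    "('k::field, 'v) S2_module \<Rightarrow> nat \<Rightarrow> ('v btree \<Rightarrow>\<^sub>0 'k) \<Rightarrow> ('k, 'v) free_element" where
  "free_class V n p = op_coset (tree_operad V) (tree_ideal V) n p"


section \<open>Binary quadratic operads\<close>

text \<open>
  A presentation \<open>\<F>(V)/(R)\<close> together with a basis \<open>e\<^sub>1, \<dots>, e\<^sub>s\<close> of \<open>V\<close>; here
  \<open>R \<subseteq> \<F>(V)(3)\<close> need not be a submodule.
\<close>

record (overloaded) ('k, 'v) quadratic_data =
  gens :: "('k, 'v) S2_module"
  gen_dim :: nat
  gen_basis :: "nat \<Rightarrow> 'v"
  relations :: "('k, 'v) free_element set"

definition quadratic_operad ::
    "('k::field, 'v) quadratic_data \<Rightarrow> ('k, ('k, 'v) free_element set) operad" where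
  "quadratic_operad D = quotient_operad (free_operad (gens D))
     (generated_ideal (free_operad (gens D)) (in_arity 3 (relations D)))"

definition generator ::
    "('k::field, 'v) quadratic_data \<Rightarrow> 'v \<Rightarrow> ('k, 'v) free_element set" where
  "generator D v = op_coset (free_operad (gens D))
     (generated_ideal (free_operad (gens D)) (in_arity 3 (relations D))) 2
     (free_class (gens D) 2 (corolla v))"

text \<open>\<open>tree3 l x y\<close> has inner vertex \<open>x\<close> and root vertex \<open>y\<close>.\<close>

definition tree3 :: "nat \<Rightarrow> 'v \<Rightarrow> 'v \<Rightarrow> 'v btree" where
  "tree3 l x y =
     (if l = 1 then Vertex y (Vertex x (Leaf 1) (Leaf 2)) (Leaf 3)
      else if l = 2 then Vertex y (Vertex x (Leaf 2) (Leaf 3)) (Leaf 1)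
      else Vertex y (Vertex x (Leaf 3) (Leaf 1)) (Leaf 2))"

definition tree_comb :: "nat \<Rightarrow> (nat \<Rightarrow> 'v) \<Rightarrow> (nat \<Rightarrow> 'v) \<Rightarrow> (nat \<Rightarrow> nat \<Rightarrow> nat \<Rightarrow> 'k) \<Rightarrow>
    ('v btree \<Rightarrow>\<^sub>0 'k::field)" where
  "tree_comb s e f \<gamma> =
     (\<Sum>l=1..3. \<Sum>i=1..s. \<Sum>j=1..s. pscale (\<gamma> l i j) (monom (tree3 l (e i) (f j))))"

text \<open>
  The coefficients of an element of \<open>\<F>(V)(3)\<close> in the basis \<open>tree3 l (e i) (e j)\<close>; they are unique
  in the range \<open>1 \<le> l \<le> 3\<close>, \<open>1 \<le> i, j \<le> s\<close>, and only these are ever used.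
\<close>

definition coeffs :: "('k::field, 'v) quadratic_data \<Rightarrow> ('k, 'v) free_element \<Rightarrow>
    nat \<Rightarrow> nat \<Rightarrow> nat \<Rightarrow> 'k" where
  "coeffs D r = (SOME \<gamma>. r = free_class (gens D) 3
     (tree_comb (gen_dim D) (gen_basis D) (gen_basis D) \<gamma>))"


section \<open>Linear compatibility\<close>

definition sum_S2_module ::
    "('k, 'v) S2_module \<Rightarrow> ('k, 'w) S2_module \<Rightarrow> ('k, 'v \<times> 'w) S2_module" where
  "sum_S2_module V W = \<lparr>
     mod_carrier = mod_carrier V \<times> mod_carrier W,
     mod_zero = (mod_zero V, mod_zero W),
     mod_add = (\<lambda>(v, w) (v', w'). (mod_add V v v', mod_add W w w')),
     mod_scale = (\<lambda>c (v, w). (mod_scale V c v, mod_scale W c w)),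
     mod_swap = (\<lambda>(v, w). (mod_swap V v, mod_swap W w)) \<rparr>"

definition white :: "('k, 'v) quadratic_data \<Rightarrow> nat \<Rightarrow> 'v \<times> 'v" where
  "white D i = (gen_basis D i, mod_zero (gens D))"

definition black :: "('k, 'v) quadratic_data \<Rightarrow> nat \<Rightarrow> 'v \<times> 'v" where
  "black D i = (mod_zero (gens D), gen_basis D i)"

definition compatible_relations ::
    "('k::field, 'v) quadratic_data \<Rightarrow> ('k, 'v \<times> 'v) free_element set" where
  "compatible_relations D =
     (let cl = free_class (sum_S2_module (gens D) (gens D)) 3; s = gen_dim D in
        {cl (tree_comb s (white D) (white D) (coeffs D r)) |r. r \<in> relations D} \<union>
        {cl (tree_comb s (black D) (black D) (coeffs D r)) |r. r \<in> relations D} \<union>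
        {cl (tree_comb s (white D) (black D) (coeffs D r)
           + tree_comb s (black D) (white D) (coeffs D r)) |r. r \<in> relations D})"

text \<open>The presentation of \<open>\<O>\<^sup>2\<close>.\<close>

definition linear_square ::
    "('k::field, 'v) quadratic_data \<Rightarrow> ('k, 'v \<times> 'v) quadratic_data" where
  "linear_square D = \<lparr>
     gens = sum_S2_module (gens D) (gens D),
     gen_dim = 2 * gen_dim D,
     gen_basis = (\<lambda>i. if i \<le> gen_dim D then white D i else black D (i - gen_dim D)),
     relations = compatible_relations D \<rparr>"

definition Lie :: "('k::field, 'k) quadratic_data" where
  "Lie = \<lparr>
     gens = S2_module_of (*) uminus,
     gen_dim = 1,
     gen_basis = (\<lambda>_. 1),
     relations = {free_class (S2_module_of (*) uminus) 3
       (monom (tree3 1 1 1) + monom (tree3 2 1 1) + monom (tree3 3 1 1))} \<rparr>"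

definition Lie2 :: "('k::field, 'k \<times> 'k) quadratic_data" where
  "Lie2 = linear_square Lie"


section \<open>Black product\<close>

definition bilinear_relations ::
    "('k::field, 'v) S2_module \<Rightarrow> ('k, 'w) S2_module \<Rightarrow> ('v \<times> 'w \<Rightarrow>\<^sub>0 'k) set" where
  "bilinear_relations V W =
     {monom (mod_add V u v, w) - (monom (u, w) + monom (v, w)) |u v w.
        u \<in> mod_carrier V \<and> v \<in> mod_carrier V \<and> w \<in> mod_carrier W} \<union>
     {monom (v, mod_add W w z) - (monom (v, w) + monom (v, z)) |v w z.
        v \<in> mod_carrier V \<and> w \<in> mod_carrier W \<and> z \<in> mod_carrier W} \<union>
     {monom (mod_scale V c v, w) - pscale c (monom (v, w)) |c v w.
        v \<in> mod_carrier V \<and> w \<in> mod_carrier W} \<union>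
     {monom (v, mod_scale W c w) - pscale c (monom (v, w)) |c v w.
        v \<in> mod_carrier V \<and> w \<in> mod_carrier W}"

definition tensor_class ::
    "('k::field, 'v) S2_module \<Rightarrow> ('k, 'w) S2_module \<Rightarrow> ('v \<times> 'w \<Rightarrow>\<^sub>0 'k) \<Rightarrow> ('v \<times> 'w \<Rightarrow>\<^sub>0 'k) set" where
  "tensor_class V W p = (+) p ` module.span pscale (bilinear_relations V W)"

definition tensor ::
    "('k::field, 'v) S2_module \<Rightarrow> ('k, 'w) S2_module \<Rightarrow> 'v \<Rightarrow> 'w \<Rightarrow> ('v \<times> 'w \<Rightarrow>\<^sub>0 'k) set" where
  "tensor V W v w = tensor_class V W (monom (v, w))"

text \<open>
  \<open>V \<otimes> W \<otimes> sgn\<^sub>2\<close>, realised on the vector space \<open>V \<otimes> W\<close>; the factor \<open>sgn\<^sub>2\<close> is the minus sign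
  in the action of the transposition.
\<close>

definition tensor_sgn ::
    "('k::field, 'v) S2_module \<Rightarrow> ('k, 'w) S2_module \<Rightarrow> ('k, ('v \<times> 'w \<Rightarrow>\<^sub>0 'k) set) S2_module" where
  "tensor_sgn V W = \<lparr>
     mod_carrier = tensor_class V W ` {p. Poly_Mapping.keys p \<subseteq> mod_carrier V \<times> mod_carrier W},
     mod_zero = tensor_class V W 0,
     mod_add = (\<lambda>A B. \<Union>p\<in>A. \<Union>q\<in>B. tensor_class V W (p + q)),
     mod_scale = (\<lambda>c A. \<Union>p\<in>A. tensor_class V W (pscale c p)),
     mod_swap = (\<lambda>A. \<Union>p\<in>A. tensor_class V W
       (lin_ext (\<lambda>(v, w). - monom (mod_swap V v, mod_swap W w)) p)) \<rparr>"

text \<open>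
  \<open>Psi\<close> as a bilinear map on \<open>\<F>(V)(3) \<times> \<F>(W)(3)\<close>; the factor \<open>sgn\<^sub>3\<close> only concerns
  the action of the symmetric group on its source.
\<close>

definition Psi :: "('k::field, 'v) quadratic_data \<Rightarrow> ('k, 'w) quadratic_data \<Rightarrow>
    ('k, 'v) free_element \<Rightarrow> ('k, 'w) free_element \<Rightarrow> ('k, ('v \<times> 'w \<Rightarrow>\<^sub>0 'k) set) free_element" where
  "Psi D E x y =
     (let e = gen_basis D; s = gen_dim D; f = gen_basis E; s' = gen_dim E;
          tn = tensor (gens D) (gens E) in
      free_class (tensor_sgn (gens D) (gens E)) 3
        (\<Sum>l=1..3. \<Sum>i=1..s. \<Sum>j=1..s. \<Sum>k=1..s'. \<Sum>m=1..s'.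
           pscale (coeffs D x l i j * coeffs E y l k m)
             (monom (tree3 l (tn (e i) (f k)) (tn (e j) (f m))))))"

text \<open>
  The relations are the image under \<open>Psi\<close> of the pure tensors, which spans \<open>\<Psi>(R \<otimes> S)\<close>; here
  \<open>R\<close> and \<open>S\<close> stand for the submodules spanned by the given relations.  The chosen basis of the
  generators of the product plays no role for the operad.
\<close>

definition black_product_relations :: "('k::field, 'v) quadratic_data \<Rightarrow> ('k, 'w) quadratic_data \<Rightarrow>
    ('k, ('v \<times> 'w \<Rightarrow>\<^sub>0 'k) set) free_element set" where
  "black_product_relations D E =
     {Psi D E x y |x y.
        x \<in> S_module_span (free_operad (gens D)) (in_arity 3 (relations D)) 3 \<and>
        y \<in> S_module_span (free_operad (gens E)) (in_arity 3 (relations E)) 3}"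

definition black_product :: "('k::field, 'v) quadratic_data \<Rightarrow> ('k, 'w) quadratic_data \<Rightarrow>
    ('k, ('v \<times> 'w \<Rightarrow>\<^sub>0 'k) set) quadratic_data" where
  "black_product D E = \<lparr>
     gens = tensor_sgn (gens D) (gens E),
     gen_dim = gen_dim D * gen_dim E,
     gen_basis = (\<lambda>a. tensor (gens D) (gens E)
       (gen_basis D ((a - 1) div gen_dim E + 1)) (gen_basis E ((a - 1) mod gen_dim E + 1))),
     relations = black_product_relations D E \<rparr>"


section \<open>The constructions above yield operads\<close>

lemma lookup_pscale [simp]: "Poly_Mapping.lookup (pscale c p) x = c * Poly_Mapping.lookup p x"
  by (simp add: pscale_def Poly_Mapping.map.rep_eq when_def)

lemma vector_space_pscale: "vector_space pscale"
  by unfold_locales (auto intro!: poly_mapping_eqI simp: lookup_add algebra_simps)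

interpretation pv: vector_space pscale by (rule vector_space_pscale)

lemma keys_pscale: "Poly_Mapping.keys (pscale c p) \<subseteq> Poly_Mapping.keys p"
  by (auto simp: in_keys_iff)

lemma lin_ext_sup:
  assumes "finite A" "Poly_Mapping.keys p \<subseteq> A"
  shows "lin_ext f p = (\<Sum>x\<in>A. pscale (Poly_Mapping.lookup p x) (f x))"
  unfolding lin_ext_def
  by (rule sum.mono_neutral_left) (use assms in \<open>auto simp: in_keys_iff\<close>)

lemma lin_ext_add: "lin_ext f (p + q) = lin_ext f p + lin_ext f q"
proof -
  let ?A = "Poly_Mapping.keys p \<union> Poly_Mapping.keys q"
  have "Poly_Mapping.keys (p + q) \<subseteq> ?A" by (rule Poly_Mapping.keys_add)
  then show ?thesis
    by (simp add: lin_ext_sup[where A="?A"] lookup_add pv.scale_left_distrib sum.distrib)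
qed

lemma lin_ext_scale: "lin_ext f (pscale c p) = pscale c (lin_ext f p)"
  by (simp add: lin_ext_sup[OF _ keys_pscale] pv.scale_sum_right) (simp add: lin_ext_def pv.scale_sum_right)

lemma lin_ext_monom [simp]: "lin_ext f (monom x) = f x"
  by (simp add: lin_ext_def monom_def)

lemma lin_ext_fun_add: "lin_ext (\<lambda>x. f x + g x) p = lin_ext f p + lin_ext g p"
  by (simp add: lin_ext_def pv.scale_right_distrib sum.distrib)

lemma lin_ext_fun_scale: "lin_ext (\<lambda>x. pscale c (f x)) p = pscale c (lin_ext f p)"
  by (simp add: lin_ext_def pv.scale_sum_right mult.commute)

lemma keys_lin_ext:
  "(\<And>x. x \<in> Poly_Mapping.keys p \<Longrightarrow> Poly_Mapping.keys (f x) \<subseteq> A) \<Longrightarrow> Poly_Mapping.keys (lin_ext f p) \<subseteq> A"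
  unfolding lin_ext_def
  by (rule order_trans[OF Poly_Mapping.keys_sum]) (use keys_pscale in fastforce)

lemma lin_ext_cong: "(\<And>x. x \<in> Poly_Mapping.keys p \<Longrightarrow> f x = g x) \<Longrightarrow> lin_ext f p = lin_ext g p"
  by (simp add: lin_ext_def)

lemma lin_ext_sum: "lin_ext f (sum g A) = (\<Sum>a\<in>A. lin_ext f (g a))"
  by (induction A rule: infinite_finite_induct) (auto simp: lin_ext_add, simp_all add: lin_ext_def)

lemma lin_ext_lin_ext: "lin_ext g (lin_ext f p) = lin_ext (\<lambda>x. lin_ext g (f x)) p"
  by (simp add: lin_ext_def[of f] lin_ext_def[of "\<lambda>x. lin_ext g (f x)"] lin_ext_sum lin_ext_scale)

lemma lin_ext_id: "lin_ext monom p = p"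
  by (rule poly_mapping_eqI)
    (simp add: lin_ext_def lookup_sum monom_def lookup_single when_def if_distrib[where f="times _"] in_keys_iff cong: if_cong)

lemma lin_ext_swap: "lin_ext (\<lambda>x. lin_ext (\<lambda>y. f x y) q) p = lin_ext (\<lambda>y. lin_ext (\<lambda>x. f x y) p) q"
  unfolding lin_ext_def pv.scale_sum_right
  by (subst sum.swap) (simp add: mult.commute)

lemma keys_monom [simp]: "Poly_Mapping.keys (monom x) = {x}"
  by (simp add: monom_def)

lemma graft_cong: "(\<And>a. a \<in> set (leaves t) \<Longrightarrow> f a = g a) \<Longrightarrow> graft f t = graft g t"
  by (induction t) auto

lemma graft_graft: "graft g (graft f t) = graft (\<lambda>a. graft g (f a)) t"
  by (induction t) auto

lemma graft_Leaf [simp]: "graft Leaf t = t"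
  by (induction t) auto

lemma graft_id: "(\<And>a. a \<in> set (leaves t) \<Longrightarrow> f a = Leaf a) \<Longrightarrow> graft f t = t"
  using graft_cong[of t f Leaf] by simp

lemma leaves_graft: "leaves (graft f t) = concat (map (\<lambda>a. leaves (f a)) (leaves t))"
  by (induction t) auto

lemma vertices_graft: "vertices (graft f t) = vertices t \<union> (\<Union>a\<in>set (leaves t). vertices (f a))"
  by (induction t) auto

lemma leaves_relabel: "leaves (relabel f t) = map f (leaves t)"
  by (simp add: relabel_def leaves_graft concat_map_singleton)

lemma vertices_relabel [simp]: "vertices (relabel f t) = vertices t"
  by (simp add: relabel_def vertices_graft)

lemma distinct_concat_map:
  assumes "distinct xs" "\<And>a. a \<in> set xs \<Longrightarrow> distinct (f a)"
    "\<And>a b. a \<in> set xs \<Longrightarrow> b \<in> set xs \<Longrightarrow> a \<noteq> b \<Longrightarrow> set (f a) \<inter> set (f b) = {}"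
  shows "distinct (concat (map f xs))"
  using assms by (induction xs) fastforce+

lemma relabel_trees:
  assumes "t \<in> trees V n" "\<sigma> permutes {1..n}"
  shows "relabel (inv \<sigma>) t \<in> trees V n"
  using assms permutes_inv[OF assms(2)] permutes_inj[of "inv \<sigma>"] permutes_image[of "inv \<sigma>"]
  by (auto simp: trees_def leaves_relabel distinct_map intro: inj_on_subset)

lemma tree_comp_trees:
  assumes s: "s \<in> trees V m" and t: "t \<in> trees V n" and i: "1 \<le> i" "i \<le> m" "1 \<le> n"
  shows "tree_comp n i s t \<in> trees V (m + n - 1)"
proof -
  let ?f = "\<lambda>a. if a < i then Leaf a
     else if a = i then relabel (\<lambda>b. b + i - 1) t else Leaf (a + n - 1)"
  have lf: "set (leaves (?f a)) = (if a < i then {a} else if a = i then {i..i+n-1} else {a+n-1})" for a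
  proof -
    have "(\<lambda>b. b + i - 1) ` {1..n} = {i..i+n-1}"
    proof (rule set_eqI, rule iffI)
      fix x assume "x \<in> {i..i+n-1}"
      then show "x \<in> (\<lambda>b. b + i - 1) ` {1..n}"
        using i by (intro image_eqI[of _ _ "x + 1 - i"]) auto
    qed (use i in auto)
    then show ?thesis using t by (auto simp: leaves_relabel trees_def)
  qed
  have d: "distinct (leaves (?f a))" for a
    using t i by (auto simp: leaves_relabel trees_def distinct_map inj_on_def)
  have "distinct (leaves (graft ?f s))"
    unfolding leaves_graft
    by (rule distinct_concat_map) (use s d in \<open>auto simp: trees_def lf split: if_splits\<close>)
  moreover have "set (leaves (graft ?f s)) = {1..m+n-1}"
  proof -
    have "set (leaves (graft ?f s)) = (\<Union>a\<in>{1..m}. set (leaves (?f a)))"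
      using s by (simp add: leaves_graft trees_def)
    also have "\<dots> = {1..m+n-1}"
    proof (rule set_eqI, rule iffI)
      fix x assume "x \<in> {1..m+n-1}"
      then show "x \<in> (\<Union>a\<in>{1..m}. set (leaves (?f a)))"
        using i unfolding lf
        by (intro UN_I[of "if x < i then x else if x < i + n then i else x + 1 - n"]) auto
    qed (use i in \<open>auto simp: lf split: if_splits\<close>)
    finally show ?thesis .
  qed
  moreover have "vertices (graft ?f s) \<subseteq> mod_carrier V"
    using s t by (auto simp: vertices_graft trees_def split: if_splits)
  ultimately show ?thesis by (simp add: trees_def tree_comp_def)
qed

lemma tree_comp_Leaf: "tree_comp n i (Leaf a) t =
   (if a < i then Leaf a else if a = i then relabel (\<lambda>b. b + i - 1) t else Leaf (a + n - 1))"
  by (simp add: tree_comp_def)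

lemma tree_comp_graft: "tree_comp n i (graft f s) t = graft (\<lambda>a. tree_comp n i (f a) t) s"
  by (simp add: tree_comp_def graft_graft)

lemma relabel_eq: "relabel f t = graft (\<lambda>a. Leaf (f a)) t"
  by (simp add: relabel_def)

lemma relabel_id: "(\<And>a. a \<in> set (leaves t) \<Longrightarrow> f a = a) \<Longrightarrow> relabel f t = t"
  by (auto simp: relabel_def intro: graft_id)

lemma relabel_graft: "relabel g (graft f t) = graft (\<lambda>a. relabel g (f a)) t"
  by (simp add: relabel_def graft_graft)

lemma tree_comp_relabel_inert:
  assumes "\<And>a. a \<in> set (leaves t) \<Longrightarrow> f a \<noteq> k"
  shows "tree_comp n k (relabel f t) u = relabel (\<lambda>a. if f a < k then f a else f a + n - 1) t"
  unfolding relabel_def[of f] tree_comp_graft unfolding relabel_def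
  by (rule graft_cong) (use assms in \<open>auto simp: tree_comp_Leaf\<close>)

lemma tree_seq:
  assumes "s \<in> trees V l" "t \<in> trees V m" "u \<in> trees V n" "1 \<le> i" "i \<le> l" "1 \<le> j" "j \<le> m" "1 \<le> n"
  shows "tree_comp n (i + j - 1) (tree_comp m i s t) u = tree_comp (m + n - 1) i s (tree_comp n j t u)"
proof -
  have "tree_comp n (i + j - 1) (relabel (\<lambda>b. b + i - 1) t) u = relabel (\<lambda>b. b + i - 1) (tree_comp n j t u)"
    unfolding tree_comp_def[of n j] relabel_graft
    unfolding relabel_eq[of _ t] tree_comp_graft
  proof (rule graft_cong)
    fix a assume "a \<in> set (leaves t)"
    then have a: "1 \<le> a" "a \<le> m" using assms by (auto simp: trees_def)
    consider "a < j" | "a = j" | "j < a" by linarith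
    then show "tree_comp n (i + j - 1) (Leaf (a + i - 1)) u =
       relabel (\<lambda>b. b + i - 1) (if a < j then Leaf a else if a = j then relabel (\<lambda>b. b + j - 1) u else Leaf (a + n - 1))"
    proof cases
      case 2
      have "relabel (\<lambda>b. b + (i + j - 1) - 1) u = relabel ((\<lambda>b. b + i - 1) \<circ> (\<lambda>b. b + j - 1)) u"
        unfolding relabel_def by (rule graft_cong) (use assms in \<open>auto simp: trees_def\<close>)
      then show ?thesis using 2 assms a by (simp add: tree_comp_Leaf relabel_def graft_graft add.commute)
    qed (use assms a in \<open>auto simp: tree_comp_Leaf relabel_def\<close>)
  qed
  note * = this
  show ?thesis
    unfolding tree_comp_def[of m i] tree_comp_graft tree_comp_def[of "m + n - 1"]
  proof (rule graft_cong)
    fix a assume "a \<in> set (leaves s)"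
    then have a: "1 \<le> a" "a \<le> l" using assms by (auto simp: trees_def)
    show "tree_comp n (i + j - 1)
          (if a < i then Leaf a else if a = i then relabel (\<lambda>b. b + i - 1) t else Leaf (a + m - 1)) u =
         (if a < i then Leaf a else if a = i then relabel (\<lambda>b. b + i - 1) (tree_comp n j t u)
          else Leaf (a + (m + n - 1) - 1))"
    proof -
      consider "a < i" | "a = i" | "i < a" by linarith
      then show ?thesis
      proof cases
        case 2 then show ?thesis using * by simp
      qed (use a assms in \<open>auto simp: tree_comp_Leaf\<close>)
    qed
  qed
qed

lemma tree_par:
  assumes "s \<in> trees V l" "t \<in> trees V m" "u \<in> trees V n" "1 \<le> i" "i < k" "k \<le> l" "1 \<le> m" "1 \<le> n"
  shows "tree_comp n (k + m - 1) (tree_comp m i s t) u = tree_comp m i (tree_comp n k s u) t"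
  unfolding tree_comp_def[of m i s] tree_comp_graft tree_comp_def[of n k]
proof (rule graft_cong)
  fix a assume "a \<in> set (leaves s)"
  then have a: "1 \<le> a" "a \<le> l" using assms by (auto simp: trees_def)
  have 1: "tree_comp n (k + m - 1) (relabel (\<lambda>b. b + i - 1) t) u = relabel (\<lambda>b. b + i - 1) t"
    by (subst tree_comp_relabel_inert) (use assms in \<open>auto simp: trees_def relabel_def intro!: graft_cong\<close>)
  have 2: "tree_comp m i (relabel (\<lambda>b. b + k - 1) u) t = relabel (\<lambda>b. b + (k + m - 1) - 1) u"
    by (subst tree_comp_relabel_inert) (use assms in \<open>auto simp: trees_def relabel_def intro!: graft_cong\<close>)
  consider "a < i" | "a = i" | "i < a" "a < k" | "a = k" | "k < a" by linarith
  then show "tree_comp n (k + m - 1) (if a < i then Leaf a else if a = i then relabel (\<lambda>b. b + i - 1) t else Leaf (a + m - 1)) u =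
         tree_comp m i (if a < k then Leaf a else if a = k then relabel (\<lambda>b. b + k - 1) u else Leaf (a + n - 1)) t"
  proof cases
    case 2 then show ?thesis using 1 assms by (simp add: tree_comp_Leaf)
  next
    case 4 then show ?thesis using 2 assms by (simp add: tree_comp_Leaf)
  qed (use assms a in \<open>auto simp: tree_comp_Leaf\<close>)
qed

lemma relabel_relabel: "relabel g (relabel f t) = relabel (g \<circ> f) t"
  by (simp add: relabel_def graft_graft)

lemma relabel_cong: "(\<And>a. a \<in> set (leaves t) \<Longrightarrow> f a = g a) \<Longrightarrow> relabel f t = relabel g t"
  by (auto simp: relabel_def intro: graft_cong)

lemma bij_imp_perm':
  "bij p \<Longrightarrow> (\<And>x. x \<notin> S \<Longrightarrow> p x = x) \<Longrightarrow> p permutes S"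
  by (simp add: permutes_def bij_iff)

lemma inner_perm_inverse:
  assumes "\<sigma> permutes {1..n}" "1 \<le> i"
  shows "inner_perm n i (inv \<sigma>) (inner_perm n i \<sigma> x) = x"
proof (cases "i \<le> x \<and> x < i + n")
  case True
  then have "x - i + 1 \<in> {1..n}" by auto
  then have "\<sigma> (x - i + 1) \<in> {1..n}" using permutes_in_image[OF assms(1)] by simp
  moreover have "inv \<sigma> (\<sigma> (x - i + 1)) = x - i + 1"
    using assms by (simp add: permutes_inverses)
  ultimately show ?thesis using True assms by (auto simp: inner_perm_def)
qed (auto simp: inner_perm_def)


lemma inner_perm_inverse':
  assumes "\<sigma> permutes {1..n}" "1 \<le> i"
  shows "inner_perm n i \<sigma> (inner_perm n i (inv \<sigma>) x) = x"
  using inner_perm_inverse[OF permutes_inv[OF assms(1)] assms(2), of x]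
  unfolding permutes_inv_inv[OF assms(1)] .

lemma inner_perm_permutes:
  assumes "\<sigma> permutes {1..n}" "1 \<le> i" "i \<le> m"
  shows "inner_perm n i \<sigma> permutes {1..m + n - 1}"
proof (rule bij_imp_perm')
  show "bij (inner_perm n i \<sigma>)"
    by (rule o_bij[of "inner_perm n i (inv \<sigma>)"])
      (simp_all only: fun_eq_iff o_apply id_apply inner_perm_inverse[OF assms(1,2)] inner_perm_inverse'[OF assms(1,2)], simp_all)
qed (use assms in \<open>auto simp: inner_perm_def\<close>)

lemma inv_inner_perm:
  assumes "\<sigma> permutes {1..n}" "1 \<le> i"
  shows "inv (inner_perm n i \<sigma>) = inner_perm n i (inv \<sigma>)"
  by (rule inv_unique_comp)
     (simp_all only: fun_eq_iff o_apply id_apply inner_perm_inverse[OF assms(1,2)] inner_perm_inverse'[OF assms(1,2)], simp_all)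

lemma outer_perm_inverse:
  assumes s: "\<sigma> permutes {1..m}" and i: "1 \<le> i" "i \<le> m" "1 \<le> n"
  shows "outer_perm m n (\<sigma> i) (inv \<sigma>) (outer_perm m n i \<sigma> x) = x"
proof -
  have ii: "inv \<sigma> (\<sigma> y) = y" for y using s by (simp add: permutes_inverses)
  have inn: "y \<in> {1..m} \<Longrightarrow> \<sigma> y \<in> {1..m}" for y using permutes_in_image[OF s] by simp
  have inj: "\<sigma> y = \<sigma> i \<longleftrightarrow> y = i" for y using permutes_inj[OF s] by (auto dest: injD)
  consider "x < 1 \<or> m + n - 1 < x" | "1 \<le> x" "x < i" | "i \<le> x" "x < i + n" | "i + n \<le> x" "x \<le> m + n - 1"
    by linarith
  then show ?thesis
  proof cases
    case 1 then show ?thesis by (auto simp: outer_perm_def)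
  next
    case 3 then show ?thesis using inn[of i] i ii[of i] by (auto simp: outer_perm_def)
  next
    case 2
    then have "\<sigma> x \<in> {1..m}" using inn[of x] i by auto
    moreover have "\<sigma> x \<noteq> \<sigma> i" using 2 inj by auto
    ultimately show ?thesis using 2 i ii[of x] ii[of i] inn[of i]
      by (auto simp: outer_perm_def Let_def)
  next
    case 4
    define z where "z = x + 1 - n"
    have x: "x = z + n - 1" and z: "i < z" "z \<in> {1..m}" using 4 i by (auto simp: z_def)
    have y: "\<sigma> z \<in> {1..m}" using inn z by blast
    have si: "\<sigma> i \<in> {1..m}" using inn[of i] i by simp
    have ne: "\<sigma> z \<noteq> \<sigma> i" using z inj[of z] by auto
    have o: "outer_perm m n i \<sigma> x = (if \<sigma> z < \<sigma> i then \<sigma> z else \<sigma> z + n - 1)"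
      using 4 i z by (simp add: outer_perm_def Let_def z_def)
    show ?thesis
    proof (cases "\<sigma> z < \<sigma> i")
      case True
      then show ?thesis unfolding o using x z y si i ii[of z] ii[of i] by (auto simp: outer_perm_def Let_def)
    next
      case False
      then have "\<sigma> i < \<sigma> z" using ne by simp
      moreover have "Suc (\<sigma> z + n - Suc 0) - n = \<sigma> z" using i by simp
      ultimately show ?thesis unfolding o using x z y si i ii[of z] ii[of i]
        by (auto simp: outer_perm_def Let_def)
    qed
  qed
qed

lemma outer_perm_inverse':
  assumes s: "\<sigma> permutes {1..m}" and i: "1 \<le> i" "i \<le> m" "1 \<le> n"
  shows "outer_perm m n i \<sigma> (outer_perm m n (\<sigma> i) (inv \<sigma>) x) = x"
proof -
  have e: "inv \<sigma> (\<sigma> i) = i" using permutes_inverses(2)[OF s] .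
  have "\<sigma> i \<in> {1..m}" using permutes_in_image[OF s, of i] i by simp
  then show ?thesis using outer_perm_inverse[OF permutes_inv[OF s], of "\<sigma> i" n x] i(3)
    unfolding permutes_inv_inv[OF s] e by simp
qed

lemma outer_perm_permutes:
  assumes s: "\<sigma> permutes {1..m}" and i: "1 \<le> i" "i \<le> m" "1 \<le> n"
  shows "outer_perm m n i \<sigma> permutes {1..m + n - 1}"
proof (rule bij_imp_perm')
  show "bij (outer_perm m n i \<sigma>)"
    by (rule o_bij[of "outer_perm m n (\<sigma> i) (inv \<sigma>)"])
     (simp_all only: fun_eq_iff o_apply id_apply outer_perm_inverse[OF assms] outer_perm_inverse'[OF assms], simp_all)
qed (use assms in \<open>auto simp: outer_perm_def\<close>)

lemma inv_outer_perm:
  assumes s: "\<sigma> permutes {1..m}" and i: "1 \<le> i" "i \<le> m" "1 \<le> n"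
  shows "inv (outer_perm m n i \<sigma>) = outer_perm m n (\<sigma> i) (inv \<sigma>)"
  by (rule inv_unique_comp)
     (simp_all only: fun_eq_iff o_apply id_apply outer_perm_inverse[OF assms] outer_perm_inverse'[OF assms], simp_all)

lemma tree_comp_act_right:
  assumes "s \<in> trees V m" "t \<in> trees V n" "1 \<le> i" "i \<le> m" "1 \<le> n" "\<sigma> permutes {1..n}"
  shows "tree_comp n i s (relabel (inv \<sigma>) t) = relabel (inv (inner_perm n i \<sigma>)) (tree_comp n i s t)"
proof -
  have "inv \<sigma> permutes {1..n}" using assms by (simp add: permutes_inv)
  then have *: "a \<in> {1..n} \<Longrightarrow> inv \<sigma> a \<in> {1..n}" for a using permutes_in_image by fastforce
  have 1: "relabel (\<lambda>b. b + i - 1) (relabel (inv \<sigma>) t) =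
     relabel (inner_perm n i (inv \<sigma>)) (relabel (\<lambda>b. b + i - 1) t)"
    unfolding relabel_relabel
    by (rule relabel_cong) (use assms * in \<open>auto simp: trees_def inner_perm_def\<close>)
  show ?thesis
    unfolding inv_inner_perm[OF assms(6,3)] tree_comp_def relabel_graft
  proof (rule graft_cong)
    fix a assume "a \<in> set (leaves s)"
    then have a: "1 \<le> a" "a \<le> m" using assms by (auto simp: trees_def)
    consider "a < i" | "a = i" | "i < a" by linarith
    then show "(if a < i then Leaf a else if a = i then relabel (\<lambda>b. b + i - 1) (relabel (inv \<sigma>) t) else Leaf (a + n - 1)) =
         relabel (inner_perm n i (inv \<sigma>)) (if a < i then Leaf a else if a = i then relabel (\<lambda>b. b + i - 1) t else Leaf (a + n - 1))"
    proof cases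
      case 2 then show ?thesis using 1 by simp
    qed (use a assms in \<open>auto simp: relabel_def inner_perm_def\<close>)
  qed
qed

lemma tree_comp_act_left:
  assumes "s \<in> trees V m" "t \<in> trees V n" "1 \<le> i" "i \<le> m" "1 \<le> n" "\<sigma> permutes {1..m}"
  shows "tree_comp n i (relabel (inv \<sigma>) s) t = relabel (inv (outer_perm m n i \<sigma>)) (tree_comp n (\<sigma> i) s t)"
proof -
  have "inv \<sigma> permutes {1..m}" using assms by (simp add: permutes_inv)
  then have *: "a \<in> {1..m} \<Longrightarrow> inv \<sigma> a \<in> {1..m}" for a using permutes_in_image by fastforce
  have ii: "inv \<sigma> (\<sigma> y) = y" "\<sigma> (inv \<sigma> y) = y" for y using assms by (simp_all add: permutes_inverses)
  have si: "\<sigma> i \<in> {1..m}" using permutes_in_image[OF assms(6), of i] assms by simp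
  have eq: "inv \<sigma> y = i \<longleftrightarrow> y = \<sigma> i" for y by (metis ii)
  have 1: "relabel (\<lambda>b. b + i - 1) t =
     relabel (outer_perm m n (\<sigma> i) (inv \<sigma>)) (relabel (\<lambda>b. b + \<sigma> i - 1) t)"
    unfolding relabel_relabel
    by (rule relabel_cong) (use assms si in \<open>auto simp: trees_def outer_perm_def ii\<close>)
  show ?thesis
    unfolding inv_outer_perm[OF assms(6,3,4,5)] relabel_eq[of _ s] tree_comp_graft tree_comp_def[of n "\<sigma> i"] relabel_graft
  proof (rule graft_cong)
    fix a assume "a \<in> set (leaves s)"
    then have a: "1 \<le> a" "a \<le> m" using assms by (auto simp: trees_def)
    then have ia: "1 \<le> inv \<sigma> a" "inv \<sigma> a \<le> m" using * by auto
    consider "a < \<sigma> i" | "a = \<sigma> i" | "\<sigma> i < a" by linarith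
    then show "tree_comp n i (Leaf (inv \<sigma> a)) t =
         relabel (outer_perm m n (\<sigma> i) (inv \<sigma>))
          (if a < \<sigma> i then Leaf a else if a = \<sigma> i then relabel (\<lambda>b. b + \<sigma> i - 1) t else Leaf (a + n - 1))"
    proof cases
      case 2 then show ?thesis using 1 by (simp add: tree_comp_Leaf ii)
    next
      case 1
      then have "inv \<sigma> a \<noteq> i" using eq by auto
      then show ?thesis using 1 a ia si assms by (auto simp: tree_comp_Leaf relabel_def outer_perm_def Let_def ii)
    next
      case 3
      then have "inv \<sigma> a \<noteq> i" using eq by auto
      then show ?thesis using 3 a ia si assms by (auto simp: tree_comp_Leaf relabel_def outer_perm_def Let_def ii)
    qed
  qed
qed

lemma tree_operad_carrier: "op_carrier (tree_operad V) n = {p. Poly_Mapping.keys p \<subseteq> trees V n}"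
  by (simp add: tree_operad_def)
lemma tree_operad_ops: "op_zero (tree_operad V) n = 0" "op_add (tree_operad V) n = (+)" "op_scale (tree_operad V) n = pscale"
  "op_act (tree_operad V) n p \<sigma> = lin_ext (\<lambda>t. monom (relabel (inv \<sigma>) t)) p"
  "op_unit (tree_operad V) = monom (Leaf 1)"
  "op_comp (tree_operad V) m n i p q = lin_ext (\<lambda>s. lin_ext (\<lambda>t. monom (tree_comp n i s t)) q) p"
  by (simp_all add: tree_operad_def)

lemma is_operad_tree_operad: "is_operad (tree_operad V)"
proof (unfold_locales, unfold tree_operad_ops tree_operad_carrier mem_Collect_eq)
  show "Poly_Mapping.keys 0 \<subseteq> trees V n" if "1 \<le> n" for n by simp
  show "Poly_Mapping.keys (x + y) \<subseteq> trees V n"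
    if "Poly_Mapping.keys x \<subseteq> trees V n" "Poly_Mapping.keys y \<subseteq> trees V n" for n and x y :: "'b btree \<Rightarrow>\<^sub>0 'a"
    using that Poly_Mapping.keys_add[of x y] by blast
  show "Poly_Mapping.keys (pscale c x) \<subseteq> trees V n" if "Poly_Mapping.keys x \<subseteq> trees V n" for n c and x :: "'b btree \<Rightarrow>\<^sub>0 'a"
    using that keys_pscale[of c x] by blast
  show "Poly_Mapping.keys (lin_ext (\<lambda>t. monom (relabel (inv \<sigma>) t)) x :: 'b btree \<Rightarrow>\<^sub>0 'a) \<subseteq> trees V n"
    if "Poly_Mapping.keys x \<subseteq> trees V n" "\<sigma> permutes {1..n}" for n \<sigma> and x :: "'b btree \<Rightarrow>\<^sub>0 'a"
    by (rule keys_lin_ext) (use that relabel_trees[of _ V n \<sigma>] in auto)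
  show "lin_ext (\<lambda>t. monom (relabel (inv \<tau>) t)) (lin_ext (\<lambda>t. monom (relabel (inv \<sigma>) t)) x) =
     lin_ext (\<lambda>t. monom (relabel (inv (\<sigma> \<circ> \<tau>)) t)) x"
    if "\<sigma> permutes {1..n}" "\<tau> permutes {1..n}" for n \<sigma> \<tau> and x :: "'b btree \<Rightarrow>\<^sub>0 'a"
    unfolding lin_ext_lin_ext lin_ext_monom relabel_relabel
    using that by (simp add: o_inv_distrib permutes_bij)
  show "lin_ext (\<lambda>t. monom (relabel (inv id) t)) x = x" for x :: "'b btree \<Rightarrow>\<^sub>0 'a"
    by (simp add: relabel_def lin_ext_id)
  show "Poly_Mapping.keys (monom (Leaf 1) :: 'b btree \<Rightarrow>\<^sub>0 'a) \<subseteq> trees V 1"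
    by (simp add: trees_def)
  show "Poly_Mapping.keys (lin_ext (\<lambda>s. lin_ext (\<lambda>t. monom (tree_comp n i s t)) y) x) \<subseteq> trees V (m + n - 1)"
    if "1 \<le> i" "i \<le> m" "1 \<le> n" "Poly_Mapping.keys x \<subseteq> trees V m" "Poly_Mapping.keys y \<subseteq> trees V n"
    for m n i and x y :: "'b btree \<Rightarrow>\<^sub>0 'a"
    by (intro keys_lin_ext) (use that tree_comp_trees[of _ V m _ n i] in auto)
  show "lin_ext (\<lambda>s. lin_ext (\<lambda>t. monom (tree_comp n 1 s t)) y) (monom (Leaf 1)) = y"
    for n and y :: "'b btree \<Rightarrow>\<^sub>0 'a"
    by (simp add: tree_comp_Leaf relabel_def lin_ext_id)
  show "lin_ext (\<lambda>s. lin_ext (\<lambda>t. monom (tree_comp 1 i s t)) (monom (Leaf 1))) x = x" if "1 \<le> i" for i and x :: "'b btree \<Rightarrow>\<^sub>0 'a"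
  proof -
    have "tree_comp 1 i s (Leaf 1) = s" for s :: "'b btree"
      unfolding tree_comp_def by (rule graft_id) (auto simp: relabel_def)
    then show ?thesis by (simp add: lin_ext_id)
  qed
  show "lin_ext (\<lambda>s. lin_ext (\<lambda>t. monom (tree_comp n (i + j - 1) s t)) z)
         (lin_ext (\<lambda>s. lin_ext (\<lambda>t. monom (tree_comp m i s t)) y) x) =
      lin_ext (\<lambda>s. lin_ext (\<lambda>t. monom (tree_comp (m + n - 1) i s t))
           (lin_ext (\<lambda>s. lin_ext (\<lambda>t. monom (tree_comp n j s t)) z) y)) x"
    if "1 \<le> i" "i \<le> l" "1 \<le> j" "j \<le> m" "1 \<le> n" "Poly_Mapping.keys x \<subseteq> trees V l"
      "Poly_Mapping.keys y \<subseteq> trees V m" "Poly_Mapping.keys z \<subseteq> trees V n"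
    for l m n i j and x y z :: "'b btree \<Rightarrow>\<^sub>0 'a"
    unfolding lin_ext_lin_ext lin_ext_monom
    apply (intro lin_ext_cong arg_cong[where f=monom])
    using that by (meson subsetD tree_seq)
  show "lin_ext (\<lambda>s. lin_ext (\<lambda>t. monom (tree_comp n (k + m - 1) s t)) z)
         (lin_ext (\<lambda>s. lin_ext (\<lambda>t. monom (tree_comp m i s t)) y) x) =
      lin_ext (\<lambda>s. lin_ext (\<lambda>t. monom (tree_comp m i s t)) y)
         (lin_ext (\<lambda>s. lin_ext (\<lambda>t. monom (tree_comp n k s t)) z) x)"
    if "1 \<le> i" "i < k" "k \<le> l" "1 \<le> m" "1 \<le> n" "Poly_Mapping.keys x \<subseteq> trees V l"
      "Poly_Mapping.keys y \<subseteq> trees V m" "Poly_Mapping.keys z \<subseteq> trees V n"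
    for l m n i k and x y z :: "'b btree \<Rightarrow>\<^sub>0 'a"
    unfolding lin_ext_lin_ext lin_ext_monom
    apply (rule lin_ext_cong)
    apply (subst lin_ext_swap)
    apply (intro lin_ext_cong arg_cong[where f=monom])
    using that by (meson subsetD tree_par)
  show "lin_ext (\<lambda>s. lin_ext (\<lambda>t. monom (tree_comp n i s t)) (lin_ext (\<lambda>t. monom (relabel (inv \<sigma>) t)) y)) x =
     lin_ext (\<lambda>t. monom (relabel (inv (inner_perm n i \<sigma>)) t)) (lin_ext (\<lambda>s. lin_ext (\<lambda>t. monom (tree_comp n i s t)) y) x)"
    if "1 \<le> i" "i \<le> m" "1 \<le> n" "Poly_Mapping.keys x \<subseteq> trees V m" "Poly_Mapping.keys y \<subseteq> trees V n" "\<sigma> permutes {1..n}"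
    for m n i \<sigma> and x y :: "'b btree \<Rightarrow>\<^sub>0 'a"
    unfolding lin_ext_lin_ext lin_ext_monom
    apply (intro lin_ext_cong arg_cong[where f=monom])
    using that by (meson subsetD tree_comp_act_right)
  show "lin_ext (\<lambda>s. lin_ext (\<lambda>t. monom (tree_comp n i s t)) y) (lin_ext (\<lambda>t. monom (relabel (inv \<sigma>) t)) x) =
     lin_ext (\<lambda>t. monom (relabel (inv (outer_perm m n i \<sigma>)) t)) (lin_ext (\<lambda>s. lin_ext (\<lambda>t. monom (tree_comp n (\<sigma> i) s t)) y) x)"
    if "1 \<le> i" "i \<le> m" "1 \<le> n" "Poly_Mapping.keys x \<subseteq> trees V m" "Poly_Mapping.keys y \<subseteq> trees V n" "\<sigma> permutes {1..m}"
    for m n i \<sigma> and x y :: "'b btree \<Rightarrow>\<^sub>0 'a"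
    unfolding lin_ext_lin_ext lin_ext_monom
    apply (intro lin_ext_cong arg_cong[where f=monom])
    using that by (meson subsetD tree_comp_act_left)
  show "x + pscale (- 1) x = 0" for x :: "'b btree \<Rightarrow>\<^sub>0 'a"
    by (metis add.right_inverse pv.scale_minus_left pv.scale_one)
qed (simp_all only: lin_ext_add lin_ext_scale lin_ext_fun_add lin_ext_fun_scale
   pv.scale_right_distrib pv.scale_left_distrib pv.scale_scale pv.scale_one add.assoc add_0_right,
   simp_all only: add.commute)

lemma operadic_idealD:
  assumes "operadic_ideal P I"
  shows "1 \<le> n \<Longrightarrow> x \<in> I n \<Longrightarrow> x \<in> op_carrier P n"
  and "1 \<le> n \<Longrightarrow> op_zero P n \<in> I n"
  and "1 \<le> n \<Longrightarrow> x \<in> I n \<Longrightarrow> y \<in> I n \<Longrightarrow> op_add P n x y \<in> I n"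
  and "1 \<le> n \<Longrightarrow> x \<in> I n \<Longrightarrow> op_scale P n c x \<in> I n"
  and "1 \<le> n \<Longrightarrow> x \<in> I n \<Longrightarrow> \<sigma> permutes {1..n} \<Longrightarrow> op_act P n x \<sigma> \<in> I n"
  and "1 \<le> i \<Longrightarrow> i \<le> m \<Longrightarrow> 1 \<le> n \<Longrightarrow> x \<in> I m \<Longrightarrow> y \<in> op_carrier P n \<Longrightarrow>
    op_comp P m n i x y \<in> I (m + n - 1)"
  and "1 \<le> i \<Longrightarrow> i \<le> m \<Longrightarrow> 1 \<le> n \<Longrightarrow> x \<in> op_carrier P m \<Longrightarrow> y \<in> I n \<Longrightarrow>
    op_comp P m n i x y \<in> I (m + n - 1)"
  using assms unfolding operadic_ideal_def sub_S_module_def by (auto simp: Ball_def)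

lemma operadic_ideal_generated:
  assumes P: "is_operad P" and X: "\<And>n. 1 \<le> n \<Longrightarrow> X n \<subseteq> op_carrier P n"
  shows "operadic_ideal P (generated_ideal P X)"
proof -
  interpret is_operad P by fact
  let ?J = "\<lambda>n. if 1 \<le> n then op_carrier P n else UNIV"
  have "operadic_ideal P ?J"
    by (auto simp: operadic_ideal_def sub_S_module_def zero_closed add_closed scale_closed act_closed intro!: comp_closed[simplified])
  moreover have "X \<le> ?J" using X by (auto simp: le_fun_def)
  ultimately have g: "generated_ideal P X n \<subseteq> ?J n" for n
    unfolding generated_ideal_def Inf_apply by auto
  have 1: "generated_ideal P X n \<subseteq> op_carrier P n" if "1 \<le> n" for n
    using g[of n] that by simp
  let ?I = "generated_ideal P X"
  have intro: "x \<in> ?I n" if "\<And>I. operadic_ideal P I \<Longrightarrow> X \<le> I \<Longrightarrow> x \<in> I n" for x n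
    using that by (auto simp: generated_ideal_def)
  have elim: "x \<in> I n" if "x \<in> ?I n" "operadic_ideal P I" "X \<le> I" for x n I
    using that by (auto simp: generated_ideal_def)
  have "op_zero P n \<in> ?I n" if "1 \<le> n" for n
    by (rule intro) (rule operadic_idealD(2)[OF _ that])
  moreover have "op_add P n x y \<in> ?I n" if "1 \<le> n" "x \<in> ?I n" "y \<in> ?I n" for n x y
    by (rule intro) (rule operadic_idealD(3)[OF _ that(1) elim[OF that(2)] elim[OF that(3)]])
  moreover have "op_scale P n c x \<in> ?I n" if "1 \<le> n" "x \<in> ?I n" for n c x
    by (rule intro) (rule operadic_idealD(4)[OF _ that(1) elim[OF that(2)]])
  moreover have "op_act P n x \<sigma> \<in> ?I n" if "1 \<le> n" "x \<in> ?I n" "\<sigma> permutes {1..n}" for n \<sigma> x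
    by (rule intro) (rule operadic_idealD(5)[OF _ that(1) elim[OF that(2)] that(3)])
  moreover have "op_comp P m n i x y \<in> ?I (m + n - 1)"
    if "1 \<le> i" "i \<le> m" "1 \<le> n" "x \<in> ?I m" "y \<in> op_carrier P n" for m n i x y
    by (rule intro) (rule operadic_idealD(6)[OF _ that(1-3) elim[OF that(4)] that(5)])
  moreover have "op_comp P m n i x y \<in> ?I (m + n - 1)"
    if "1 \<le> i" "i \<le> m" "1 \<le> n" "x \<in> op_carrier P m" "y \<in> ?I n" for m n i x y
    by (rule intro) (rule operadic_idealD(7)[OF _ that(1-4) elim[OF that(5)]])
  ultimately show ?thesis
    unfolding operadic_ideal_def sub_S_module_def using 1[THEN subsetD] by (auto simp only: atLeastAtMost_iff Ball_def)
qed

locale quotient_by_ideal = is_operad P for P :: "('k::field, 'a) operad" +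
  fixes I :: "nat \<Rightarrow> 'a set"
  assumes ideal: "operadic_ideal P I"
begin

lemmas I_sub = operadic_idealD(1)[OF ideal] and I_zero = operadic_idealD(2)[OF ideal]
  and I_add = operadic_idealD(3)[OF ideal] and I_scale = operadic_idealD(4)[OF ideal]
  and I_act = operadic_idealD(5)[OF ideal] and I_comp_left = operadic_idealD(6)[OF ideal]
  and I_comp_right = operadic_idealD(7)[OF ideal]

abbreviation coset where "coset \<equiv> op_coset P I"

lemma add_left_commute:
  assumes "1 \<le> n" "x \<in> op_carrier P n" "y \<in> op_carrier P n" "z \<in> op_carrier P n"
  shows "op_add P n x (op_add P n y z) = op_add P n y (op_add P n x z)"
  using assms add_assoc add_commute by metis

lemma coset_absorb:
  assumes n: "1 \<le> n" and x: "x \<in> op_carrier P n" and a: "a \<in> I n"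
  shows "coset n (op_add P n x a) = coset n x"
proof -
  have a': "a \<in> op_carrier P n" using I_sub n a by blast
  show ?thesis
  proof
    show "coset n (op_add P n x a) \<subseteq> coset n x"
      using n x a a' I_sub I_add by (auto simp: op_coset_def add_assoc)
    show "coset n x \<subseteq> coset n (op_add P n x a)"
    proof
      fix y assume "y \<in> coset n x"
      then obtain b where b: "b \<in> I n" "y = op_add P n x b" by (auto simp: op_coset_def)
      let ?a = "op_scale P n (- 1) a"
      have c: "?a \<in> I n" "?a \<in> op_carrier P n" "b \<in> op_carrier P n"
        using n a b I_scale I_sub by blast+
      have "op_add P n a (op_add P n ?a b) = op_add P n (op_add P n a ?a) b"
        using n a' c by (simp add: add_assoc)
      also have "\<dots> = op_add P n b (op_zero P n)"
        using n a' c by (simp add: add_inverse add_commute zero_closed)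
      also have "\<dots> = b" using n c by (simp add: add_zero)
      finally have "y = op_add P n (op_add P n x a) (op_add P n ?a b)"
        using n x a' c b add_closed by (simp add: add_assoc)
      then show "y \<in> coset n (op_add P n x a)"
        using I_add n b c by (auto simp: op_coset_def)
    qed
  qed
qed

lemma coset_elem: "y \<in> coset n x \<longleftrightarrow> (\<exists>a\<in>I n. y = op_add P n x a)"
  by (auto simp: op_coset_def)

lemma coset_self: "1 \<le> n \<Longrightarrow> x \<in> op_carrier P n \<Longrightarrow> x \<in> coset n x"
  unfolding coset_elem using I_zero add_zero by metis

abbreviation Q where "Q \<equiv> quotient_operad P I"

lemma UN_const: "x \<in> A \<Longrightarrow> (\<And>y. y \<in> A \<Longrightarrow> f y = c) \<Longrightarrow> (\<Union>y\<in>A. f y) = c"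
  by auto

lemma q_carrier: "op_carrier Q n = coset n ` op_carrier P n" by (simp add: quotient_operad_def)
lemma q_zero: "op_zero Q n = coset n (op_zero P n)" by (simp add: quotient_operad_def)
lemma q_unit: "op_unit Q = coset 1 (op_unit P)" by (simp add: quotient_operad_def)

lemma q_add:
  assumes n: "1 \<le> n" and x: "x \<in> op_carrier P n" and y: "y \<in> op_carrier P n"
  shows "op_add Q n (coset n x) (coset n y) = coset n (op_add P n x y)"
proof -
  have "coset n (op_add P n (op_add P n x a) (op_add P n y b)) = coset n (op_add P n x y)"
    if "a \<in> I n" "b \<in> I n" for a b
  proof -
    have c: "a \<in> op_carrier P n" "b \<in> op_carrier P n" using that I_sub n by auto
    have "op_add P n (op_add P n x a) (op_add P n y b) = op_add P n (op_add P n x y) (op_add P n a b)"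
      using n x y c by (simp add: add_assoc add_left_commute add_closed)
    then show ?thesis using coset_absorb I_add n that x y add_closed by simp
  qed
  then show ?thesis unfolding quotient_operad_def operad.simps
    by (intro UN_const[OF coset_self[OF n x]] UN_const[OF coset_self[OF n y]]) (auto simp: coset_elem)
qed

lemma q_scale:
  assumes n: "1 \<le> n" and x: "x \<in> op_carrier P n"
  shows "op_scale Q n c (coset n x) = coset n (op_scale P n c x)"
  unfolding quotient_operad_def operad.simps
  by (intro UN_const[OF coset_self[OF n x]])
     (use n x in \<open>auto simp: coset_elem scale_add I_sub coset_absorb scale_closed I_scale\<close>)

lemma q_act:
  assumes n: "1 \<le> n" and x: "x \<in> op_carrier P n" and s: "\<sigma> permutes {1..n}"
  shows "op_act Q n (coset n x) \<sigma> = coset n (op_act P n x \<sigma>)"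
  unfolding quotient_operad_def operad.simps
  by (intro UN_const[OF coset_self[OF n x]])
     (use n x s in \<open>auto simp: coset_elem act_add I_sub coset_absorb act_closed I_act\<close>)

lemma q_comp:
  assumes i: "1 \<le> i" "i \<le> m" "1 \<le> n" and x: "x \<in> op_carrier P m" and y: "y \<in> op_carrier P n"
  shows "op_comp Q m n i (coset m x) (coset n y) = coset (m + n - 1) (op_comp P m n i x y)"
proof -
  have m: "1 \<le> m" and mn: "1 \<le> m + n - 1" using i by auto
  have "coset (m + n - 1) (op_comp P m n i (op_add P m x a) (op_add P n y b)) = coset (m + n - 1) (op_comp P m n i x y)"
    if "a \<in> I m" "b \<in> I n" for a b
  proof -
    have c: "a \<in> op_carrier P m" "b \<in> op_carrier P n" using that I_sub m i by auto
    have "op_comp P m n i (op_add P m x a) (op_add P n y b) =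
      op_add P (m + n - 1) (op_add P (m + n - 1) (op_comp P m n i x y) (op_comp P m n i x b)) (op_comp P m n i a (op_add P n y b))"
      using i m x y c comp_add_left[of i m n x a "op_add P n y b"] comp_add_right[of i m n x y b] by (simp add: add_closed)
    then show ?thesis using i mn x y c that
      by (simp add: coset_absorb I_comp_left I_comp_right add_closed comp_closed del: One_nat_def)
  qed
  then show ?thesis unfolding quotient_operad_def operad.simps
    by (intro UN_const[OF coset_self[OF m x]] UN_const[OF coset_self[OF i(3) y]]) (auto simp: coset_elem)
qed

lemmas q_ops = q_add q_scale q_act q_comp

lemma is_operad_quotient: "is_operad Q"
proof (unfold_locales, unfold q_carrier q_zero q_unit, goal_cases)
  case (25 l m n i j x' y' z')
  then obtain x y z where e: "x \<in> op_carrier P l" "y \<in> op_carrier P m" "z \<in> op_carrier P n"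
    and c: "x' = coset l x" "y' = coset m y" "z' = coset n z" by blast
  have a: "i + j - 1 \<le> l + m - 1" "1 \<le> i + j - 1" "1 \<le> m + n - 1" "1 \<le> m"
    and b: "l + m - 1 + n - 1 = l + (m + n - 1) - 1" using 25 by linarith+
  show ?case unfolding c
      q_comp[OF 25(1,2) a(4) e(1,2)] q_comp[OF 25(3-5) e(2,3)]
      q_comp[OF a(2,1) 25(5) comp_closed[OF 25(1,2) a(4) e(1,2)] e(3)]
      q_comp[OF 25(1,2) a(3) e(1) comp_closed[OF 25(3-5) e(2,3)]]
      b comp_sequential[OF 25(1-5) e] ..
next
  case (26 l m n i k x' y' z')
  then obtain x y z where e: "x \<in> op_carrier P l" "y \<in> op_carrier P m" "z \<in> op_carrier P n"
    and c: "x' = coset l x" "y' = coset m y" "z' = coset n z" by blast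
  have a: "1 \<le> k + m - 1" "k + m - 1 \<le> l + m - 1" "i \<le> l + n - 1" "i \<le> l" "1 \<le> k"
    and b: "l + m - 1 + n - 1 = l + n - 1 + m - 1" using 26 by linarith+
  show ?case unfolding c
      q_comp[OF 26(1) a(4) 26(4) e(1,2)] q_comp[OF a(5) 26(3) 26(5) e(1,3)]
      q_comp[OF a(1,2) 26(5) comp_closed[OF 26(1) a(4) 26(4) e(1,2)] e(3)]
      q_comp[OF 26(1) a(3) 26(4) comp_closed[OF a(5) 26(3) 26(5) e(1,3)] e(2)]
      b comp_parallel[OF 26(1-5) e] ..
next
  case (27 m n i x' y' \<sigma>)
  then obtain x y where e: "x \<in> op_carrier P m" "y \<in> op_carrier P n"
    and c: "x' = coset m x" "y' = coset n y" by blast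
  have a: "1 \<le> m + n - 1" using 27 by linarith
  show ?case unfolding c q_comp[OF 27(1-3) e] q_act[OF 27(3) e(2) 27(6)]
      q_comp[OF 27(1-3) e(1) act_closed[OF 27(3) e(2) 27(6)]]
      q_act[OF a comp_closed[OF 27(1-3) e] inner_perm_permutes[OF 27(6,1,2)]]
      comp_act_right[OF 27(1-3) e 27(6)] ..
next
  case (28 m n i x' y' \<sigma>)
  then obtain x y where e: "x \<in> op_carrier P m" "y \<in> op_carrier P n"
    and c: "x' = coset m x" "y' = coset n y" by blast
  have a: "1 \<le> m + n - 1" "1 \<le> m" using 28 by linarith+
  have b: "1 \<le> \<sigma> i" "\<sigma> i \<le> m" using permutes_in_image[OF 28(6), of i] 28 by auto
  show ?case unfolding c q_comp[OF b 28(3) e] q_act[OF a(2) e(1) 28(6)]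
      q_comp[OF 28(1-3) act_closed[OF a(2) e(1) 28(6)] e(2)]
      q_act[OF a(1) comp_closed[OF b 28(3) e] outer_perm_permutes[OF 28(6,1-3)]]
      comp_act_left[OF 28(1-3) e 28(6)] ..
next
  case 16 then show ?case by (auto simp: q_ops act_act act_closed permutes_compose)
next
  case 2 then show ?case by (auto simp: q_ops add_closed)
next
  case 5 then show ?case by (auto simp: q_ops add_commute)
next
  case (24 m i x)
  then show ?case using q_comp[of i m 1] unit_closed comp_unit_right by auto
next
  case (23 n y)
  then show ?case using q_comp[of 1 1 n] unit_closed comp_unit_left by auto
next
  case 1 then show ?case by (auto simp: q_ops zero_closed simp del: One_nat_def)
next
  case 3 then show ?case by (auto simp: q_ops scale_closed simp del: One_nat_def)
next
  case 4 then show ?case by (auto simp: q_ops add_assoc add_closed simp del: One_nat_def)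
next
  case 6 then show ?case by (auto simp: q_ops add_zero zero_closed simp del: One_nat_def)
next
  case 7 then show ?case by (auto simp: q_ops add_inverse scale_closed simp del: One_nat_def)
next
  case 8 then show ?case by (auto simp: q_ops scale_add scale_closed add_closed simp del: One_nat_def)
next
  case 9 then show ?case by (auto simp: q_ops add_scale scale_closed simp del: One_nat_def)
next
  case 10 then show ?case by (auto simp: q_ops scale_scale scale_closed simp del: One_nat_def)
next
  case 11 then show ?case by (auto simp: q_ops scale_one simp del: One_nat_def)
next
  case 12 then show ?case by (auto simp: q_ops act_closed simp del: One_nat_def)
next
  case 13 then show ?case by (auto simp: q_ops act_add add_closed act_closed simp del: One_nat_def)
next
  case 14 then show ?case by (auto simp: q_ops act_scale scale_closed act_closed simp del: One_nat_def)
next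
  case 15 then show ?case by (auto simp: q_ops act_id permutes_id simp del: One_nat_def)
next
  case 17 then show ?case by (auto simp: q_ops unit_closed simp del: One_nat_def)
next
  case (18 m n i)
  then have "1 \<le> m + n - 1" "1 \<le> m" by linarith+
  then show ?case using 18 by (auto simp: q_ops comp_closed simp del: One_nat_def)
next
  case (19 m n i)
  then have "1 \<le> m + n - 1" "1 \<le> m" by linarith+
  then show ?case using 19 by (auto simp: q_ops comp_add_left add_closed comp_closed simp del: One_nat_def)
next
  case (20 m n i)
  then have "1 \<le> m + n - 1" "1 \<le> m" by linarith+
  then show ?case using 20 by (auto simp: q_ops comp_add_right add_closed comp_closed simp del: One_nat_def)
next
  case (21 m n i)
  then have "1 \<le> m + n - 1" "1 \<le> m" by linarith+
  then show ?case using 21 by (auto simp: q_ops comp_scale_left scale_closed comp_closed simp del: One_nat_def)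
next
  case (22 m n i)
  then have "1 \<le> m + n - 1" "1 \<le> m" by linarith+
  then show ?case using 22 by (auto simp: q_ops comp_scale_right scale_closed comp_closed simp del: One_nat_def)
qed

end

lemma is_operad_quotient_generated:
  assumes "is_operad P" "\<And>n. 1 \<le> n \<Longrightarrow> X n \<subseteq> op_carrier P n"
  shows "is_operad (quotient_operad P (generated_ideal P X))"
  using assms operadic_ideal_generated[OF assms]
  by (intro quotient_by_ideal.is_operad_quotient quotient_by_ideal.intro quotient_by_ideal_axioms.intro)

lemma is_operad_free_operad:
  assumes add: "\<And>u v. u \<in> mod_carrier V \<Longrightarrow> v \<in> mod_carrier V \<Longrightarrow> mod_add V u v \<in> mod_carrier V"
    and scale: "\<And>c v. v \<in> mod_carrier V \<Longrightarrow> mod_scale V c v \<in> mod_carrier V"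
    and swap: "\<And>v. v \<in> mod_carrier V \<Longrightarrow> mod_swap V v \<in> mod_carrier V"
  shows "is_operad (free_operad V)"
  unfolding free_operad_def tree_ideal_def
proof (rule is_operad_quotient_generated[OF is_operad_tree_operad])
  have c: "corolla v \<in> op_carrier (tree_operad V) 2" "monom (Vertex v (Leaf 2) (Leaf 1)) \<in> op_carrier (tree_operad V) 2"
    if "v \<in> mod_carrier V" for v
    using that by (auto simp: tree_operad_carrier corolla_def trees_def)
  interpret is_operad "tree_operad V" by (rule is_operad_tree_operad)
  have "x + y \<in> op_carrier (tree_operad V) 2" "x - y \<in> op_carrier (tree_operad V) 2"
    if "x \<in> op_carrier (tree_operad V) 2" "y \<in> op_carrier (tree_operad V) 2" for x y
    using that Poly_Mapping.keys_add[of x y] keys_diff[of x y] by (auto simp: tree_operad_carrier)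
  moreover have "pscale a x \<in> op_carrier (tree_operad V) 2" if "x \<in> op_carrier (tree_operad V) 2" for a x
    using that keys_pscale[of a x] by (auto simp: tree_operad_carrier)
  ultimately show "in_arity 2 (corolla_relations V) n \<subseteq> op_carrier (tree_operad V) n" for n
    using c add scale swap by (auto simp: in_arity_def corolla_relations_def)
qed

lemma is_operad_quadratic_operad:
  assumes "is_operad (free_operad (gens D))" "relations D \<subseteq> op_carrier (free_operad (gens D)) 3"
  shows "is_operad (quadratic_operad D)"
  unfolding quadratic_operad_def
  by (rule is_operad_quotient_generated[OF assms(1)]) (use assms(2) in \<open>auto simp: in_arity_def\<close>)

end

theory Submission
  imports Defs
begin

text \<open>
  The map \<open>(v, w) \<mapsto> v \<otimes> (1, 0) + w \<otimes> (0, 1)\<close> identifies \<open>V \<oplus> V\<close> with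
  \<open>V \<otimes> (sgn\<^sub>2 \<oplus> sgn\<^sub>2) \<otimes> sgn\<^sub>2\<close> equivariantly, hence the free operads on them; it remains
  to match the ideals of relations.  Each Jacobi-type relation of the two compatible brackets is an
  eigenvector of the symmetric group, so the module they span consists of the combinations whose coefficients
  do not depend on the shape of the tree and are symmetric in the two colours.  Therefore \<open>\<Psi>\<close>
  replaces a relation \<open>x\<close> by combinations of \<open>x\<^sub>\<circ>\<close>, \<open>x\<^sub>\<bullet>\<close> and the mixed
  relation \<open>x\<^sub>\<circ>\<^sub>\<bullet>\<close>.  The latter equals \<open>\<delta>(x) - x\<^sub>\<circ> - x\<^sub>\<bullet>\<close> for the
  operad map \<open>\<delta>\<close> induced by the diagonal \<open>V \<rightarrow> V \<oplus> V\<close>; so all three depend equivariantly on \<open>x\<close>, and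
  it makes no difference whether \<open>x\<close> runs over the given relations or the module spanned by them.
\<close>


section \<open>Homomorphisms of operads and their quotients\<close>

text \<open>Two nested quotients and one choice operator shape the proof. \<open>free_operad\<close>
  is a quotient of formal combinations of planar trees and \<open>quadratic_operad\<close> a
  quotient of that, so every map is built on trees and then descended, and ideals are compared
  through preimages and images, without normal forms for trees. The coefficients in
  \<open>compatible_relations\<close> and \<open>Psi\<close> come from \<open>coeffs\<close>, a
  choice among all families that represent a class. For an element of \<O> the chosen family matters
  only through the class it represents: the white, black and diagonal copies are images of that
  class under operad maps. For \<open>Lie2\<close> the actual values enter \<open>Psi\<close>, so
  there uniqueness is proved, by letting trees act on a small skew algebra that separates them.
  Polarising along the diagonal replaces a computation of how S_3 acts on the coefficient families
  of relations of \<O>.\<close>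

locale operad_hom = P: is_operad P + Q: is_operad Q
  for P :: "('k::field, 'a) operad" and Q :: "('k, 'b) operad" +
  fixes f :: "nat \<Rightarrow> 'a \<Rightarrow> 'b"
  assumes hom_closed: "\<And>n x. \<lbrakk>1 \<le> n; x \<in> op_carrier P n\<rbrakk> \<Longrightarrow> f n x \<in> op_carrier Q n"
    and hom_add: "\<And>n x y. \<lbrakk>1 \<le> n; x \<in> op_carrier P n; y \<in> op_carrier P n\<rbrakk>
      \<Longrightarrow> f n (op_add P n x y) = op_add Q n (f n x) (f n y)"
    and hom_scale: "\<And>n c x. \<lbrakk>1 \<le> n; x \<in> op_carrier P n\<rbrakk>
      \<Longrightarrow> f n (op_scale P n c x) = op_scale Q n c (f n x)"
    and hom_act: "\<And>n x \<sigma>. \<lbrakk>1 \<le> n; x \<in> op_carrier P n; \<sigma> permutes {1..n}\<rbrakk>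
      \<Longrightarrow> f n (op_act P n x \<sigma>) = op_act Q n (f n x) \<sigma>"
    and hom_unit: "f 1 (op_unit P) = op_unit Q"
    and hom_comp: "\<And>m n i x y. \<lbrakk>1 \<le> i; i \<le> m; 1 \<le> n; x \<in> op_carrier P m; y \<in> op_carrier P n\<rbrakk>
      \<Longrightarrow> f (m + n - 1) (op_comp P m n i x y) = op_comp Q m n i (f m x) (f n y)"

lemma operad_iso_iff_hom:
  "operad_iso f P Q \<longleftrightarrow>
     operad_hom P Q f \<and> (\<forall>n\<ge>1. bij_betw (f n) (op_carrier P n) (op_carrier Q n))"
  unfolding operad_iso_def operad_hom_def operad_hom_axioms_def
  by (auto simp: Ball_def bij_betw_apply simp del: One_nat_def)

lemma generated_ideal_least:
  assumes "operadic_ideal P I" "\<And>n. X n \<subseteq> I n" "x \<in> generated_ideal P X n"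
  shows "x \<in> I n"
  using assms by (auto simp: generated_ideal_def le_fun_def)

lemma generated_ideal_superset: "x \<in> X n \<Longrightarrow> x \<in> generated_ideal P X n"
  by (auto simp: generated_ideal_def le_fun_def)

lemma S_module_span_least:
  assumes "sub_S_module P I" "\<And>n. X n \<subseteq> I n" "x \<in> S_module_span P X n"
  shows "x \<in> I n"
  using assms by (auto simp: S_module_span_def le_fun_def)

lemma S_module_span_superset: "x \<in> X n \<Longrightarrow> x \<in> S_module_span P X n"
  by (auto simp: S_module_span_def le_fun_def)

context operad_hom
begin

text \<open>Zero is x + (-1) x, so additivity and homogeneity already determine its image.\<close>

lemma hom_zero: "1 \<le> n \<Longrightarrow> f n (op_zero P n) = op_zero Q n"
  by (metis P.zero_closed P.scale_closed P.add_inverse hom_closed hom_add hom_scale Q.add_inverse)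

text \<open>Turns minimality of generated ideals and spans into a transport principle: what holds
  for generators under a homomorphism extends to everything they generate.\<close>

lemma operadic_ideal_vimage:
  assumes "operadic_ideal Q J"
  shows "operadic_ideal P (\<lambda>n. {x \<in> op_carrier P n. f n x \<in> J n})"
proof -
  note J = operadic_idealD[OF assms]
  have a: "1 \<le> m \<Longrightarrow> 1 \<le> n \<Longrightarrow> 1 \<le> m + n - 1" for m n :: nat by linarith
  show ?thesis
    unfolding operadic_ideal_def sub_S_module_def
    by (auto simp: hom_zero hom_add hom_scale hom_act hom_comp hom_closed P.zero_closed P.add_closed
        P.scale_closed P.act_closed P.comp_closed J simp del: One_nat_def)
qed

lemma hom_generated_ideal:
  assumes "operadic_ideal Q J" "\<And>n. X n \<subseteq> op_carrier P n" "\<And>n x. x \<in> X n \<Longrightarrow> f n x \<in> J n"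
    "x \<in> generated_ideal P X n"
  shows "f n x \<in> J n"
  using generated_ideal_least[OF operadic_ideal_vimage[OF assms(1)] _ assms(4)] assms(2,3) by blast

end

text \<open>The union over representatives mirrors \<open>quotient_operad\<close> and avoids
  choosing one: once f sends I into J, all members of the union are the same coset.\<close>

definition quotient_map ::
    "('k::field, 'b) operad \<Rightarrow> (nat \<Rightarrow> 'b set) \<Rightarrow> (nat \<Rightarrow> 'a \<Rightarrow> 'b) \<Rightarrow> nat \<Rightarrow> 'a set \<Rightarrow> 'b set" where
  "quotient_map Q J f n A = (\<Union>x\<in>A. op_coset Q J n (f n x))"

locale quotient_hom = operad_hom P Q f + PI: quotient_by_ideal P I + QJ: quotient_by_ideal Q J
  for P :: "('k::field, 'a) operad" and I and Q :: "('k, 'b) operad" and J and f +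
  assumes f_ideal: "\<And>n x. 1 \<le> n \<Longrightarrow> x \<in> I n \<Longrightarrow> f n x \<in> J n"
begin

lemma quotient_map_coset:
  assumes "1 \<le> n" "x \<in> op_carrier P n"
  shows "quotient_map Q J f n (op_coset P I n x) = op_coset Q J n (f n x)"
  unfolding quotient_map_def
  by (rule PI.UN_const[OF PI.coset_self[OF assms]])
    (use assms in \<open>auto simp: PI.coset_elem hom_add PI.I_sub f_ideal hom_closed QJ.coset_absorb\<close>)

lemma operad_hom_quotient:
  "operad_hom (quotient_operad P I) (quotient_operad Q J) (quotient_map Q J f)"
proof -
  interpret P': is_operad "quotient_operad P I" by (rule PI.is_operad_quotient)
  interpret Q': is_operad "quotient_operad Q J" by (rule QJ.is_operad_quotient)
  show ?thesis
  proof (unfold_locales, unfold PI.q_carrier QJ.q_carrier PI.q_unit QJ.q_unit, goal_cases)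
    case (6 m n i x y)
    then have "1 \<le> m" "1 \<le> m + n - 1" by linarith+
    with 6 show ?case
      by (auto simp: PI.q_ops QJ.q_ops quotient_map_coset hom_closed hom_comp P.comp_closed
          simp del: One_nat_def)
  qed (auto simp: PI.q_ops QJ.q_ops quotient_map_coset hom_closed hom_add hom_scale hom_act hom_unit
      P.add_closed P.scale_closed P.act_closed P.unit_closed simp del: One_nat_def)
qed

text \<open>By \<open>refl\<close> the ideal I is the whole preimage of J, which is injectivity of
  the induced map; surjectivity passes down from f.\<close>

lemma operad_iso_quotient:
  assumes surj: "\<And>n. 1 \<le> n \<Longrightarrow> op_carrier Q n \<subseteq> f n ` op_carrier P n"
    and refl: "\<And>n x. 1 \<le> n \<Longrightarrow> x \<in> op_carrier P n \<Longrightarrow> f n x \<in> J n \<Longrightarrow> x \<in> I n"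
  shows "operad_iso (quotient_map Q J f) (quotient_operad P I) (quotient_operad Q J)"
  unfolding operad_iso_iff_hom
proof (intro conjI allI impI operad_hom_quotient bij_betw_imageI)
  fix n :: nat assume n: "1 \<le> n"
  show "quotient_map Q J f n ` op_carrier (quotient_operad P I) n = op_carrier (quotient_operad Q J) n"
    using n surj[OF n] by (force simp: PI.q_carrier QJ.q_carrier quotient_map_coset hom_closed)
  show "inj_on (quotient_map Q J f n) (op_carrier (quotient_operad P I) n)"
  proof (rule inj_onI)
    fix A B
    assume "A \<in> op_carrier (quotient_operad P I) n" "B \<in> op_carrier (quotient_operad P I) n"
      and AB: "quotient_map Q J f n A = quotient_map Q J f n B"
    then obtain x y where x: "x \<in> op_carrier P n" "A = op_coset P I n x"
      and y: "y \<in> op_carrier P n" "B = op_coset P I n y"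
      by (auto simp: PI.q_carrier)
    let ?y = "op_scale P n (- 1) y"
    let ?d = "op_add P n x ?y"
    have y': "?y \<in> op_carrier P n" using y n by (simp add: P.scale_closed)
    have e: "op_coset Q J n (f n x) = op_coset Q J n (f n y)"
      using AB x y n by (simp add: quotient_map_coset)
    then have "f n x \<in> op_coset Q J n (f n y)"
      using QJ.coset_self[OF n hom_closed[OF n x(1)]] by simp
    then obtain j where j: "j \<in> J n" "f n x = op_add Q n (f n y) j"
      unfolding QJ.coset_elem by blast
    have jc: "j \<in> op_carrier Q n" using j n QJ.I_sub by blast
    have fy: "f n y \<in> op_carrier Q n" "f n ?y \<in> op_carrier Q n"
      using y y' n by (simp_all add: hom_closed)
    \<comment> \<open>The difference x - y is sent to j, an element of J, so \<open>refl\<close>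
      puts it into I.\<close>
    have "f n ?d = op_add Q n (op_add Q n (f n y) j) (f n ?y)"
      using x y' n j by (simp add: hom_add)
    also have "\<dots> = op_add Q n j (op_add Q n (f n y) (f n ?y))"
      using n fy jc by (metis Q.add_assoc Q.add_commute)
    also have "op_add Q n (f n y) (f n ?y) = op_zero Q n"
      using y n fy by (simp add: hom_scale Q.add_inverse)
    also have "op_add Q n j (op_zero Q n) = j" using n jc by (simp add: Q.add_zero)
    finally have d: "?d \<in> I n"
      using refl[OF n, of ?d] x y' n j by (simp add: P.add_closed)
    have "op_add P n y ?d = op_add P n x (op_add P n y ?y)"
      using n x y y' by (simp add: PI.add_left_commute)
    also have "\<dots> = x" using n x y by (simp add: P.add_inverse P.add_zero)
    finally have "op_coset P I n y = op_coset P I n x"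
      using PI.coset_absorb[OF n y(1) d] by simp
    then show "A = B" using x y by simp
  qed
qed

end

section \<open>Free operads are functorial\<close>

lemma leaves_map_btree [simp]: "leaves (map_btree h t) = leaves t"
  by (induction t) auto

lemma map_btree_graft: "map_btree h (graft f t) = graft (\<lambda>a. map_btree h (f a)) (map_btree h t)"
  by (induction t) auto

lemma map_btree_relabel: "map_btree h (relabel f t) = relabel f (map_btree h t)"
  by (simp add: relabel_def map_btree_graft)

lemma map_btree_tree_comp:
  "map_btree h (tree_comp n i s t) = tree_comp n i (map_btree h s) (map_btree h t)"
  unfolding tree_comp_def map_btree_graft
  by (rule graft_cong) (simp add: map_btree_relabel)

lemma trees_map_btree:
  "(\<And>v. v \<in> mod_carrier V \<Longrightarrow> h v \<in> mod_carrier W) \<Longrightarrow> t \<in> trees V n \<Longrightarrow> map_btree h t \<in> trees W n"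
  by (auto simp: trees_def btree.set_map)

definition tree_map :: "('v \<Rightarrow> 'w) \<Rightarrow> ('v btree \<Rightarrow>\<^sub>0 'k::field) \<Rightarrow> ('w btree \<Rightarrow>\<^sub>0 'k)" where
  "tree_map h = lin_ext (\<lambda>t. monom (map_btree h t))"

lemma tree_map_linear:
  "tree_map h (p + q) = tree_map h p + tree_map h q"
  "tree_map h (pscale c p) = pscale c (tree_map h p)"
  "tree_map h (sum g A) = (\<Sum>a\<in>A. tree_map h (g a))"
  "tree_map h (monom t) = monom (map_btree h t)"
  by (simp_all add: tree_map_def lin_ext_add lin_ext_scale lin_ext_sum)

lemma lin_ext_diff: "lin_ext f (p - q) = lin_ext f p - lin_ext f q"
  using lin_ext_add[of f "p - q" q] by (simp add: algebra_simps)

lemma tree_map_diff: "tree_map h (p - q) = tree_map h p - tree_map h q"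
  by (simp add: tree_map_def lin_ext_diff)

lemma tree_map_tree_map: "tree_map g (tree_map h p) = tree_map (g \<circ> h) p"
  by (simp add: tree_map_def lin_ext_lin_ext btree.map_comp)

lemma tree_map_id: "(\<And>t v. t \<in> Poly_Mapping.keys p \<Longrightarrow> v \<in> vertices t \<Longrightarrow> h v = v) \<Longrightarrow> tree_map h p = p"
proof -
  assume *: "\<And>t v. t \<in> Poly_Mapping.keys p \<Longrightarrow> v \<in> vertices t \<Longrightarrow> h v = v"
  have "lin_ext (\<lambda>t. monom (map_btree h t)) p = lin_ext monom p"
    by (rule lin_ext_cong) (use * in \<open>auto intro!: arg_cong[where f=monom] simp: btree.map_ident_strong\<close>)
  then show ?thesis by (simp add: tree_map_def lin_ext_id)
qed

text \<open>Serves both constructions by translates of a subspace: classes in the free operad and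
  tensor classes.\<close>

lemma coset_eq_iff:
  fixes p q :: "'x \<Rightarrow>\<^sub>0 'k::field"
  assumes S: "pv.subspace S"
  shows "(+) p ` S = (+) q ` S \<longleftrightarrow> p - q \<in> S"
proof -
  have *: "(+) p ` S \<subseteq> (+) q ` S" if "p - q \<in> S" for p q :: "'x \<Rightarrow>\<^sub>0 'k"
  proof
    fix x assume "x \<in> (+) p ` S"
    then obtain a where "a \<in> S" "x = q + ((p - q) + a)" by auto
    then show "x \<in> (+) q ` S" using pv.subspace_add[OF S that] by blast
  qed
  show ?thesis
  proof
    assume "(+) p ` S = (+) q ` S"
    moreover have "p + 0 \<in> (+) p ` S" by (intro imageI pv.subspace_0[OF S])
    ultimately show "p - q \<in> S" by auto
  next
    assume "p - q \<in> S"
    then show "(+) p ` S = (+) q ` S" using *[of p q] *[of q p] pv.subspace_neg[OF S] by fastforce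
  qed
qed

lemma corolla_relationsE:
  assumes "p \<in> corolla_relations V"
  obtains (add) u v where "u \<in> mod_carrier V" "v \<in> mod_carrier V"
      "p = monom (Vertex (mod_add V u v) (Leaf 1) (Leaf 2))
        - (monom (Vertex u (Leaf 1) (Leaf 2)) + monom (Vertex v (Leaf 1) (Leaf 2)))"
    | (scale) c v where "v \<in> mod_carrier V"
      "p = monom (Vertex (mod_scale V c v) (Leaf 1) (Leaf 2)) - pscale c (monom (Vertex v (Leaf 1) (Leaf 2)))"
    | (swap) v where "v \<in> mod_carrier V"
      "p = monom (Vertex (mod_swap V v) (Leaf 1) (Leaf 2)) - monom (Vertex v (Leaf 2) (Leaf 1))"
  using assms unfolding corolla_relations_def corolla_def by blast

lemma corolla_relationsI:
  "u \<in> mod_carrier V \<Longrightarrow> v \<in> mod_carrier V \<Longrightarrow>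
    monom (Vertex (mod_add V u v) (Leaf 1) (Leaf 2))
      - (monom (Vertex u (Leaf 1) (Leaf 2)) + monom (Vertex v (Leaf 1) (Leaf 2))) \<in> corolla_relations V"
  "v \<in> mod_carrier V \<Longrightarrow>
    monom (Vertex (mod_scale V c v) (Leaf 1) (Leaf 2)) - pscale c (monom (Vertex v (Leaf 1) (Leaf 2)))
      \<in> corolla_relations V"
  "v \<in> mod_carrier V \<Longrightarrow>
    monom (Vertex (mod_swap V v) (Leaf 1) (Leaf 2)) - monom (Vertex v (Leaf 2) (Leaf 1))
      \<in> corolla_relations V"
  unfolding corolla_relations_def corolla_def by blast+

text \<open>Closure is what places the corolla relations in arity 2 of the tree operad; linearity in
  the decorations is then imposed by the ideal. Working with a carrier set admits
  \<open>tensor_sgn\<close>, whose elements are cosets.\<close>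

locale closed_S2_module =
  fixes V :: "('k::field, 'v) S2_module"
  assumes add_in: "\<And>u v. u \<in> mod_carrier V \<Longrightarrow> v \<in> mod_carrier V \<Longrightarrow> mod_add V u v \<in> mod_carrier V"
    and scale_in: "\<And>c v. v \<in> mod_carrier V \<Longrightarrow> mod_scale V c v \<in> mod_carrier V"
    and swap_in: "\<And>v. v \<in> mod_carrier V \<Longrightarrow> mod_swap V v \<in> mod_carrier V"
begin

lemma corolla_relations_carrier:
  "in_arity 2 (corolla_relations V) n \<subseteq> op_carrier (tree_operad V) n"
proof -
  have "monom (Vertex v (Leaf 1) (Leaf 2)) \<in> op_carrier (tree_operad V) 2"
    "monom (Vertex v (Leaf 2) (Leaf 1)) \<in> op_carrier (tree_operad V) 2" if "v \<in> mod_carrier V" for v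
    using that by (auto simp: tree_operad_carrier trees_def)
  moreover have "x + y \<in> op_carrier (tree_operad V) 2" "x - y \<in> op_carrier (tree_operad V) 2"
    if "x \<in> op_carrier (tree_operad V) 2" "y \<in> op_carrier (tree_operad V) 2" for x y
    using that Poly_Mapping.keys_add[of x y] keys_diff[of x y] by (auto simp: tree_operad_carrier)
  moreover have "pscale a x \<in> op_carrier (tree_operad V) 2" if "x \<in> op_carrier (tree_operad V) 2" for a x
    using that keys_pscale[of a x] by (auto simp: tree_operad_carrier)
  ultimately show ?thesis
    by (auto simp: in_arity_def corolla_relations_def corolla_def add_in scale_in swap_in)
qed

sublocale trees: quotient_by_ideal "tree_operad V" "tree_ideal V"
  unfolding tree_ideal_def
  by (intro quotient_by_ideal.intro quotient_by_ideal_axioms.intro is_operad_tree_operad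
      operadic_ideal_generated corolla_relations_carrier)

sublocale free: is_operad "free_operad V"
  unfolding free_operad_def by (rule trees.is_operad_quotient)

lemma subspace_tree_ideal: "1 \<le> n \<Longrightarrow> pv.subspace (tree_ideal V n)"
  using trees.I_zero trees.I_add trees.I_scale
  by (auto simp: pv.subspace_def tree_operad_ops)

lemma free_class_eq_iff:
  "1 \<le> n \<Longrightarrow> free_class V n p = free_class V n q \<longleftrightarrow> p - q \<in> tree_ideal V n"
  unfolding free_class_def op_coset_def tree_operad_ops
  by (rule coset_eq_iff) (rule subspace_tree_ideal)

lemma free_carrier:
  "op_carrier (free_operad V) n = free_class V n ` {p. Poly_Mapping.keys p \<subseteq> trees V n}"
  by (simp add: free_operad_def trees.q_carrier free_class_def tree_operad_carrier image_def)

lemma free_ops: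
  assumes "1 \<le> n" "Poly_Mapping.keys p \<subseteq> trees V n"
  shows "Poly_Mapping.keys q \<subseteq> trees V n \<Longrightarrow>
      op_add (free_operad V) n (free_class V n p) (free_class V n q) = free_class V n (p + q)"
    and "op_scale (free_operad V) n c (free_class V n p) = free_class V n (pscale c p)"
    and "\<sigma> permutes {1..n} \<Longrightarrow> op_act (free_operad V) n (free_class V n p) \<sigma>
      = free_class V n (lin_ext (\<lambda>t. monom (relabel (inv \<sigma>) t)) p)"
  using assms trees.q_add[of n p q] trees.q_scale[of n p c] trees.q_act[of n p \<sigma>]
  by (simp_all add: free_operad_def free_class_def tree_operad_carrier tree_operad_ops)

end

locale S2_hom = V: closed_S2_module V + W: closed_S2_module W
  for V :: "('k::field, 'v) S2_module" and W :: "('k, 'w) S2_module" +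
  fixes h :: "'v \<Rightarrow> 'w"
  assumes h_in: "\<And>v. v \<in> mod_carrier V \<Longrightarrow> h v \<in> mod_carrier W"
    and h_add: "\<And>u v. u \<in> mod_carrier V \<Longrightarrow> v \<in> mod_carrier V \<Longrightarrow> h (mod_add V u v) = mod_add W (h u) (h v)"
    and h_scale: "\<And>c v. v \<in> mod_carrier V \<Longrightarrow> h (mod_scale V c v) = mod_scale W c (h v)"
    and h_swap: "\<And>v. v \<in> mod_carrier V \<Longrightarrow> h (mod_swap V v) = mod_swap W (h v)"
begin

lemma keys_tree_map: "Poly_Mapping.keys p \<subseteq> trees V n \<Longrightarrow> Poly_Mapping.keys (tree_map h p) \<subseteq> trees W n"
  unfolding tree_map_def
  by (rule keys_lin_ext) (auto intro!: trees_map_btree h_in)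

sublocale trees: operad_hom "tree_operad V" "tree_operad W" "\<lambda>n. tree_map h"
proof (unfold_locales, unfold tree_operad_ops tree_operad_carrier mem_Collect_eq)
  show "tree_map h (lin_ext (\<lambda>s. lin_ext (\<lambda>t. monom (tree_comp n i s t)) q) p) =
      lin_ext (\<lambda>s. lin_ext (\<lambda>t. monom (tree_comp n i s t)) (tree_map h q)) (tree_map h p)"
    for n i and p q :: "'v btree \<Rightarrow>\<^sub>0 'k"
    by (simp add: tree_map_def lin_ext_lin_ext map_btree_tree_comp)
  show "tree_map h (lin_ext (\<lambda>t. monom (relabel (inv \<sigma>) t)) p) =
      lin_ext (\<lambda>t. monom (relabel (inv \<sigma>) t)) (tree_map h p)"
    for \<sigma> and p :: "'v btree \<Rightarrow>\<^sub>0 'k"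
    by (simp add: tree_map_def lin_ext_lin_ext map_btree_relabel)
qed (simp_all add: keys_tree_map tree_map_linear)

text \<open>Only generators have to be inspected, and an equivariant linear map carries each of the
  three kinds of corolla relation to one of the same kind.\<close>

lemma tree_map_tree_ideal:
  assumes "p \<in> tree_ideal V n"
  shows "tree_map h p \<in> tree_ideal W n"
proof -
  have "tree_map h p \<in> tree_ideal W n" if "p \<in> in_arity 2 (corolla_relations V) n" for n p
  proof -
    have 2: "n = 2" and p: "p \<in> corolla_relations V" using that by (auto simp: in_arity_def split: if_splits)
    have "tree_map h p \<in> corolla_relations W"
      using p
      by (cases rule: corolla_relationsE)
        (auto simp: tree_map_linear tree_map_diff h_add h_scale h_swap h_in
          simp del: One_nat_def intro!: corolla_relationsI)
    then show ?thesis
      unfolding tree_ideal_def by (intro generated_ideal_superset) (simp add: in_arity_def 2)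
  qed
  from trees.hom_generated_ideal[OF W.trees.ideal V.corolla_relations_carrier this] assms
  show ?thesis unfolding tree_ideal_def by blast
qed

sublocale trees: quotient_hom "tree_operad V" "tree_ideal V" "tree_operad W" "tree_ideal W" "\<lambda>n. tree_map h"
  by unfold_locales (rule tree_map_tree_ideal)

abbreviation "free_map \<equiv> quotient_map (tree_operad W) (tree_ideal W) (\<lambda>n. tree_map h)"

sublocale free: operad_hom "free_operad V" "free_operad W" free_map
  unfolding free_operad_def by (rule trees.operad_hom_quotient)

lemma free_map_class:
  "1 \<le> n \<Longrightarrow> Poly_Mapping.keys p \<subseteq> trees V n \<Longrightarrow> free_map n (free_class V n p) = free_class W n (tree_map h p)"
  unfolding free_class_def
  by (rule trees.quotient_map_coset) (simp_all add: tree_operad_carrier)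

end

text \<open>The inverse g carries the tree ideal of W back into that of V; this is the reflection of
  ideals demanded by \<open>operad_iso_quotient\<close>.\<close>

lemma free_iso_of_S2_iso:
  assumes "S2_hom V W h" "S2_hom W V g"
    and gh: "\<And>v. v \<in> mod_carrier V \<Longrightarrow> g (h v) = v"
    and hg: "\<And>w. w \<in> mod_carrier W \<Longrightarrow> h (g w) = w"
  shows "operad_iso (quotient_map (tree_operad W) (tree_ideal W) (\<lambda>n. tree_map h)) (free_operad V) (free_operad W)"
proof -
  interpret h: S2_hom V W h by fact
  interpret g: S2_hom W V g by fact
  have 1: "tree_map g (tree_map h p) = p" if "Poly_Mapping.keys p \<subseteq> trees V n" for n and p :: "'b btree \<Rightarrow>\<^sub>0 'a"
    unfolding tree_map_tree_map by (rule tree_map_id) (use that gh in \<open>auto simp: trees_def\<close>)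
  have 2: "tree_map h (tree_map g p) = p" if "Poly_Mapping.keys p \<subseteq> trees W n" for n and p :: "'c btree \<Rightarrow>\<^sub>0 'a"
    unfolding tree_map_tree_map by (rule tree_map_id) (use that hg in \<open>auto simp: trees_def\<close>)
  show ?thesis
    unfolding free_operad_def
  proof (rule h.trees.operad_iso_quotient)
    show "op_carrier (tree_operad W) n \<subseteq> tree_map h ` op_carrier (tree_operad V) n" for n
      using 2 g.keys_tree_map by (force simp: tree_operad_carrier)
    show "p \<in> tree_ideal V n"
      if "p \<in> op_carrier (tree_operad V) n" "tree_map h p \<in> tree_ideal W n" for n p
      using g.tree_map_tree_ideal[OF that(2)] 1[of p n] that by (simp add: tree_operad_carrier)
  qed
qed

section \<open>The ternary part of a free operad\<close>

lemma pscale_simps [simp]: "pscale c 0 = 0" "pscale 0 p = 0" "pscale 1 p = p"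
  by simp_all

text \<open>A left comb with arbitrary labels: \<open>tree3\<close> has only the three cyclic
  labellings, a list that relabelling and inner swaps leave.\<close>

definition comb3 :: "nat \<Rightarrow> nat \<Rightarrow> nat \<Rightarrow> 'v \<Rightarrow> 'v \<Rightarrow> 'v btree" where
  "comb3 a b c u v = Vertex v (Vertex u (Leaf a) (Leaf b)) (Leaf c)"

lemma tree3_eq_comb3: "tree3 l u v = (if l = 1 then comb3 1 2 3 u v else if l = 2 then comb3 2 3 1 u v else comb3 3 1 2 u v)"
  by (simp add: tree3_def comb3_def)

lemma map_btree_tree3 [simp]: "map_btree h (tree3 l u v) = tree3 l (h u) (h v)"
  by (simp add: tree3_def)

lemma tree3_trees: "u \<in> mod_carrier V \<Longrightarrow> v \<in> mod_carrier V \<Longrightarrow> tree3 l u v \<in> trees V 3"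
  by (auto simp: tree3_def trees_def)

lemma obtain_perm3:
  assumes "distinct [a, b, c]" "{a, b, c} = {1..3}"
  obtains \<pi> where "\<pi> permutes {1..3::nat}" "\<pi> 1 = a" "\<pi> 2 = b" "\<pi> 3 = c"
proof -
  define \<pi> where "\<pi> x = (if x = 1 then a else if x = 2 then b else if x = 3 then c else x)" for x :: nat
  have e: "{1..3} = {1, 2, 3::nat}" by auto
  have "bij_betw \<pi> {1, 2, 3} {a, b, c}"
    using assms(1) by (auto simp: \<pi>_def bij_betw_def inj_on_def)
  then have "\<pi> permutes {1..3}"
    by (intro bij_imp_permutes) (simp only: assms(2) e, auto simp: \<pi>_def)
  then show thesis by (rule that) (auto simp: \<pi>_def)
qed

text \<open>Three leaves split at the root as 2 + 1 or 1 + 2, giving a left or a right comb.\<close>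

lemma trees_3_cases:
  fixes V :: "('k, 'v) S2_module"
  assumes "t \<in> trees V 3"
  obtains a b c u v where "distinct [a, b, c]" "{a, b, c} = {1..3}" "u \<in> mod_carrier V" "v \<in> mod_carrier V"
    "t = comb3 a b c u v \<or> t = Vertex v (Leaf c) (Vertex u (Leaf a) (Leaf b))"
proof -
  have len: "length (leaves t) = 3"
    using assms distinct_card[of "leaves t"] by (simp add: trees_def)
  have pos: "leaves s \<noteq> []" for s :: "'v btree" by (induction s) auto
  then have pos': "length (leaves s) \<ge> 1" for s :: "'v btree" by (simp add: Suc_le_eq)
  have one: "\<exists>a. s = Leaf a" if "length (leaves s) = 1" for s :: "'v btree"
    using that by (cases s) (auto, metis pos length_greater_0_conv add_is_1 less_numeral_extra(3))
  have two: "\<exists>u a b. s = Vertex u (Leaf a) (Leaf b)" if l: "length (leaves s) = 2" for s :: "'v btree"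
  proof (cases s)
    case (Vertex u s1 s2)
    then have "length (leaves s1) = 1" "length (leaves s2) = 1" using l pos'[of s1] pos'[of s2] by auto
    then show ?thesis using Vertex one by blast
  qed (use l in simp)
  obtain v s1 s2 where t: "t = Vertex v s1 s2" using len by (cases t) auto
  consider "length (leaves s1) = 2" "length (leaves s2) = 1" | "length (leaves s1) = 1" "length (leaves s2) = 2"
    using len t pos'[of s1] pos'[of s2] by fastforce
  then show thesis
  proof cases
    case 1
    then obtain u a b c where "s1 = Vertex u (Leaf a) (Leaf b)" "s2 = Leaf c" using one two by blast
    then show thesis using assms t by (intro that[of a b c u v]) (auto simp: trees_def comb3_def)
  next
    case 2
    then obtain u a b c where "s2 = Vertex u (Leaf a) (Leaf b)" "s1 = Leaf c" using one two by blast
    then show thesis using assms t by (intro that[of a b c u v]) (auto simp: trees_def comb3_def)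
  qed
qed

context closed_S2_module
begin

text \<open>The relation p sits at the root, with the corolla of u grafted into its first input; the
  next lemma puts p at the inner vertex instead.\<close>

lemma root_vertex_ideal:
  assumes "p \<in> tree_ideal V 2" "u \<in> mod_carrier V" "\<pi> permutes {1..3}"
  shows "lin_ext (\<lambda>s. monom (relabel \<pi> (tree_comp 2 1 s (Vertex u (Leaf 1) (Leaf 2))))) p \<in> tree_ideal V 3"
proof -
  have "monom (Vertex u (Leaf 1) (Leaf 2)) \<in> op_carrier (tree_operad V) 2"
    using assms by (auto simp: tree_operad_carrier trees_def)
  from trees.I_comp_left[of 1 2 2 p, OF _ _ _ assms(1) this]
  have "lin_ext (\<lambda>s. monom (tree_comp 2 1 s (Vertex u (Leaf 1) (Leaf 2)))) p \<in> tree_ideal V 3"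
    by (simp add: tree_operad_ops numeral_3_eq_3)
  \<comment> \<open>\<open>op_act\<close> relabels by the inverse permutation, hence the action of
    the inverse of \<pi>.\<close>
  from trees.I_act[OF _ this permutes_inv[OF assms(3)]]
  show ?thesis by (simp add: tree_operad_ops lin_ext_lin_ext permutes_inv_inv[OF assms(3)])
qed

lemma inner_vertex_ideal:
  assumes "p \<in> tree_ideal V 2" "v \<in> mod_carrier V" "\<pi> permutes {1..3}"
  shows "lin_ext (\<lambda>t. monom (relabel \<pi> (tree_comp 2 1 (Vertex v (Leaf 1) (Leaf 2)) t))) p \<in> tree_ideal V 3"
proof -
  have "monom (Vertex v (Leaf 1) (Leaf 2)) \<in> op_carrier (tree_operad V) 2"
    using assms by (auto simp: tree_operad_carrier trees_def)
  from trees.I_comp_right[of 1 2 2, OF _ _ _ this assms(1)]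
  have "lin_ext (\<lambda>t. monom (tree_comp 2 1 (Vertex v (Leaf 1) (Leaf 2)) t)) p \<in> tree_ideal V 3"
    by (simp add: tree_operad_ops numeral_3_eq_3)
  from trees.I_act[OF _ this permutes_inv[OF assms(3)]]
  show ?thesis by (simp add: tree_operad_ops lin_ext_lin_ext permutes_inv_inv[OF assms(3)])
qed

lemma corolla_relations_ideal: "p \<in> corolla_relations V \<Longrightarrow> p \<in> tree_ideal V 2"
  unfolding tree_ideal_def by (rule generated_ideal_superset) (simp add: in_arity_def)

text \<open>The three kinds of corolla relation at each of the two vertices, moved to the labels a,
  b, c by a permutation. These are the rewriting rules used in arity 3.\<close>

lemma comb3_relations:
  assumes "distinct [a, b, c]" "{a, b, c} = {1..3}"
    and u: "u \<in> mod_carrier V" and u': "u' \<in> mod_carrier V"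
    and v: "v \<in> mod_carrier V" and v': "v' \<in> mod_carrier V"
  shows comb3_root_add: "monom (comb3 a b c u (mod_add V v v'))
      - (monom (comb3 a b c u v) + monom (comb3 a b c u v')) \<in> tree_ideal V 3"
    and comb3_root_scale: "monom (comb3 a b c u (mod_scale V k v)) - pscale k (monom (comb3 a b c u v)) \<in> tree_ideal V 3"
    and comb3_root_swap: "monom (comb3 a b c u (mod_swap V v))
      - monom (Vertex v (Leaf c) (Vertex u (Leaf a) (Leaf b))) \<in> tree_ideal V 3"
    and comb3_inner_add: "monom (comb3 a b c (mod_add V u u') v)
      - (monom (comb3 a b c u v) + monom (comb3 a b c u' v)) \<in> tree_ideal V 3"
    and comb3_inner_scale: "monom (comb3 a b c (mod_scale V k u) v) - pscale k (monom (comb3 a b c u v)) \<in> tree_ideal V 3"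
    and comb3_inner_swap: "monom (comb3 a b c (mod_swap V u) v) - monom (comb3 b a c u v) \<in> tree_ideal V 3"
proof -
  obtain \<pi> where \<pi>: "\<pi> permutes {1..3::nat}" "\<pi> 1 = a" "\<pi> 2 = b" "\<pi> 3 = c"
    using assms(1,2) by (rule obtain_perm3)
  have t: "relabel \<pi> (tree_comp 2 1 (Vertex v (Leaf 1) (Leaf 2)) (Vertex u (Leaf 1) (Leaf 2))) = comb3 a b c u v"
    "relabel \<pi> (tree_comp 2 1 (Vertex v (Leaf 2) (Leaf 1)) (Vertex u (Leaf 1) (Leaf 2)))
      = Vertex v (Leaf c) (Vertex u (Leaf a) (Leaf b))"
    "relabel \<pi> (tree_comp 2 1 (Vertex v (Leaf 1) (Leaf 2)) (Vertex u (Leaf 2) (Leaf 1))) = comb3 b a c u v"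
    for u v
    using \<pi>(2-4) by (simp_all add: tree_comp_def relabel_def comb3_def)
  note l = lin_ext_diff lin_ext_add lin_ext_scale lin_ext_monom t
  note r = root_vertex_ideal[OF corolla_relations_ideal[OF corolla_relationsI(1)[OF v v']] u \<pi>(1)]
    root_vertex_ideal[OF corolla_relations_ideal[OF corolla_relationsI(2)[OF v]] u \<pi>(1)]
    root_vertex_ideal[OF corolla_relations_ideal[OF corolla_relationsI(3)[OF v]] u \<pi>(1)]
    inner_vertex_ideal[OF corolla_relations_ideal[OF corolla_relationsI(1)[OF u u']] v \<pi>(1)]
    inner_vertex_ideal[OF corolla_relations_ideal[OF corolla_relationsI(2)[OF u]] v \<pi>(1)]
    inner_vertex_ideal[OF corolla_relations_ideal[OF corolla_relationsI(3)[OF u]] v \<pi>(1)]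
  show "monom (comb3 a b c u (mod_add V v v'))
      - (monom (comb3 a b c u v) + monom (comb3 a b c u v')) \<in> tree_ideal V 3"
    using r(1) unfolding l .
  show "monom (comb3 a b c u (mod_scale V k v)) - pscale k (monom (comb3 a b c u v)) \<in> tree_ideal V 3"
    using r(2)[of k] unfolding l .
  show "monom (comb3 a b c u (mod_swap V v))
      - monom (Vertex v (Leaf c) (Vertex u (Leaf a) (Leaf b))) \<in> tree_ideal V 3"
    using r(3) unfolding l .
  show "monom (comb3 a b c (mod_add V u u') v)
      - (monom (comb3 a b c u v) + monom (comb3 a b c u' v)) \<in> tree_ideal V 3"
    using r(4) unfolding l .
  show "monom (comb3 a b c (mod_scale V k u) v) - pscale k (monom (comb3 a b c u v)) \<in> tree_ideal V 3"
    using r(5)[of k] unfolding l .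
  show "monom (comb3 a b c (mod_swap V u) v) - monom (comb3 b a c u v) \<in> tree_ideal V 3"
    using r(6) unfolding l .
qed

end

lemma S2_module_of_simps [simp]:
  "mod_carrier (S2_module_of scale \<tau>) = UNIV" "mod_zero (S2_module_of scale \<tau>) = 0"
  "mod_add (S2_module_of scale \<tau>) = (+)" "mod_scale (S2_module_of scale \<tau>) = scale"
  "mod_swap (S2_module_of scale \<tau>) = \<tau>"
  by (simp_all add: S2_module_of_def)

lemma tree_comb_add: "tree_comb s e f (\<lambda>l i j. \<gamma> l i j + \<gamma>' l i j) = tree_comb s e f \<gamma> + tree_comb s e f \<gamma>'"
  by (simp add: tree_comb_def pv.scale_left_distrib sum.distrib)

lemma tree_comb_scale: "tree_comb s e f (\<lambda>l i j. c * \<gamma> l i j) = pscale c (tree_comb s e f \<gamma>)"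
  by (simp add: tree_comb_def pv.scale_sum_right)

lemma tree_comb_single:
  assumes "l0 \<in> {1..3}" "i0 \<in> {1..s}" "j0 \<in> {1..s}"
  shows "tree_comb s e f (\<lambda>l i j. if l = l0 then if i = i0 then if j = j0 then 1 else 0 else 0 else 0)
    = monom (tree3 l0 (e i0) (f j0))"
proof -
  let ?\<gamma> = "\<lambda>l i j. if l = l0 then if i = i0 then if j = j0 then 1 else 0 else 0 else 0"
  have "(\<Sum>j=1..s. pscale (?\<gamma> l i j) (monom (tree3 l (e i) (f j))))
      = (if l = l0 then if i = i0 then monom (tree3 l (e i) (f j0)) else 0 else 0)" for l i
    using assms(3) by (simp add: if_distrib[of "\<lambda>c. pscale c _"] cong: if_cong)
  note 1 = this
  have "(\<Sum>i=1..s. \<Sum>j=1..s. pscale (?\<gamma> l i j) (monom (tree3 l (e i) (f j))))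
      = (if l = l0 then monom (tree3 l (e i0) (f j0)) else 0)" for l
    by (simp only: 1) (use assms(2) in simp)
  note 2 = this
  show ?thesis unfolding tree_comb_def by (simp only: 2) (use assms(1) in simp)
qed

lemma keys_sum_subset:
  "(\<And>a. a \<in> A \<Longrightarrow> Poly_Mapping.keys (g a) \<subseteq> B) \<Longrightarrow> Poly_Mapping.keys (\<Sum>a\<in>A. g a) \<subseteq> B"
  by (rule order_trans[OF Poly_Mapping.keys_sum]) blast

lemma keys_tree_comb:
  assumes "\<And>i. e i \<in> mod_carrier V" "\<And>i. f i \<in> mod_carrier V"
  shows "Poly_Mapping.keys (tree_comb s e f \<gamma>) \<subseteq> trees V 3"
  unfolding tree_comb_def
  by (intro keys_sum_subset order_trans[OF keys_pscale]) (simp add: tree3_trees assms)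

lemma tree_map_tree_comb: "tree_map h (tree_comb s e f \<gamma>) = tree_comb s (h \<circ> e) (h \<circ> f) \<gamma>"
  by (simp add: tree_comb_def tree_map_linear)

section \<open>Spanning of the ternary part by the basis trees\<close>

lemma (in vector_space) linear_mod_subspace:
  assumes I: "pv.subspace I"
    and add: "\<And>u v. F (u + v) - (F u + F v) \<in> I"
    and scale: "\<And>c v. F (scale c v) - pscale c (F v) \<in> I"
  shows "F (\<Sum>i\<in>A. scale (c i) (x i)) - (\<Sum>i\<in>A. pscale (c i) (F (x i))) \<in> I"
proof -
  have "F 0 \<in> I" using scale[of 0 0] by simp
  moreover have "F (scale (c a) (x a) + (\<Sum>i\<in>A. scale (c i) (x i)))
      - (pscale (c a) (F (x a)) + (\<Sum>i\<in>A. pscale (c i) (F (x i)))) \<in> I"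
    if IH: "F (\<Sum>i\<in>A. scale (c i) (x i)) - (\<Sum>i\<in>A. pscale (c i) (F (x i))) \<in> I" for a A
    using pv.subspace_add[OF I pv.subspace_add[OF I add[of "scale (c a) (x a)" "\<Sum>i\<in>A. scale (c i) (x i)"]
          scale[of "c a" "x a"]] IH]
    by (simp add: algebra_simps)
  ultimately show ?thesis by (induction A rule: infinite_finite_induct) simp_all
qed

locale linear_S2_module = vector_space scale
  for scale :: "'k::field \<Rightarrow> 'v::ab_group_add \<Rightarrow> 'v" +
  fixes \<tau> :: "'v \<Rightarrow> 'v"
  assumes \<tau>_add: "\<And>u v. \<tau> (u + v) = \<tau> u + \<tau> v"
    and \<tau>_scale: "\<And>c v. \<tau> (scale c v) = scale c (\<tau> v)"
begin

abbreviation V where "V \<equiv> S2_module_of scale \<tau>"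

sublocale closed_S2_module V
  by unfold_locales simp_all

text \<open>Straightening: a swap at the root makes every tree a left comb, a swap at the inner
  vertex makes its labels cyclic, and expanding both decorations in the basis leaves
  \<open>tree3\<close> terms. This provides the witness behind \<open>coeffs\<close>.\<close>

lemma free_class_3_tree_comb:
  assumes inj: "inj_on e {1..s}" and span: "span (e ` {1..s}) = UNIV"
    and x: "x \<in> op_carrier (free_operad V) 3"
  shows "\<exists>\<gamma>. x = free_class V 3 (tree_comb s e e \<gamma>)"
proof -
  let ?I = "tree_ideal V 3"
  have I: "pv.subspace ?I" by (rule subspace_tree_ideal) simp
  \<comment> \<open>Z collects what straightens to basis trees. It is a subspace stable under
    congruence modulo the tree ideal, so the rewriting rules can be applied one at a time.\<close>
  define Z where "Z = {p. \<exists>\<gamma>. p - tree_comb s e e \<gamma> \<in> ?I}"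
  have "p + q \<in> Z" if "p \<in> Z" "q \<in> Z" for p q
  proof -
    from that obtain \<gamma> \<gamma>' where "p - tree_comb s e e \<gamma> \<in> ?I" "q - tree_comb s e e \<gamma>' \<in> ?I"
      by (auto simp: Z_def)
    from pv.subspace_add[OF I this] have "p + q - tree_comb s e e (\<lambda>l i j. \<gamma> l i j + \<gamma>' l i j) \<in> ?I"
      by (simp add: tree_comb_add algebra_simps)
    then show ?thesis unfolding Z_def by blast
  qed
  moreover have "pscale c p \<in> Z" if "p \<in> Z" for c p
  proof -
    from that obtain \<gamma> where "p - tree_comb s e e \<gamma> \<in> ?I" by (auto simp: Z_def)
    from pv.subspace_scale[OF I this] have "pscale c p - tree_comb s e e (\<lambda>l i j. c * \<gamma> l i j) \<in> ?I"
      by (simp add: tree_comb_scale pv.scale_right_diff_distrib)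
    then show ?thesis unfolding Z_def by blast
  qed
  moreover have IZ: "p \<in> Z" if "p \<in> ?I" for p
    unfolding Z_def using that by (intro CollectI exI[of _ "\<lambda>_ _ _. 0"]) (simp add: tree_comb_def)
  ultimately have Z: "pv.subspace Z"
    using pv.subspace_0[OF I] by (auto simp: pv.subspace_def)
  have cong: "p \<in> Z" if "p - q \<in> ?I" "q \<in> Z" for p q
    using pv.subspace_add[OF Z IZ[OF that(1)] that(2)] by simp
  have "\<exists>c. v = (\<Sum>i=1..s. scale (c i) (e i))" for v
  proof -
    have "v \<in> range (\<lambda>u. \<Sum>w\<in>e ` {1..s}. scale (u w) w)"
      using span span_finite[of "e ` {1..s}"] by simp
    then obtain u where "v = (\<Sum>w\<in>e ` {1..s}. scale (u w) w)" by blast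
    then show ?thesis by (intro exI[of _ "u \<circ> e"]) (simp add: sum.reindex[OF inj] del: One_nat_def)
  qed
  then obtain crd where crd: "v = (\<Sum>i=1..s. scale (crd v i) (e i))" for v by metis
  have basis: "monom (tree3 l (e i) (e j)) \<in> Z" if "l \<in> {1..3}" "i \<in> {1..s}" "j \<in> {1..s}" for l i j
  proof -
    have "monom (tree3 l (e i) (e j)) - tree_comb s e e
        (\<lambda>l' i' j'. if l' = l then if i' = i then if j' = j then 1 else 0 else 0 else 0) \<in> ?I"
      by (simp only: tree_comb_single[OF that] diff_self pv.subspace_0[OF I])
    then show ?thesis unfolding Z_def by blast
  qed
  have cyc: "monom (comb3 a b c u v) \<in> Z"
    if abc: "(a, b, c) \<in> {(1, 2, 3), (2, 3, 1), (3, 1, 2)}" for a b c u v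
  proof -
    have d: "distinct [a, b, c]" "{a, b, c} = {1..3}" using abc by auto
    have l: "a \<in> {1..3}" "comb3 a b c u v = tree3 a u v" for u v :: 'v
      using abc by (auto simp: tree3_eq_comb3)
    have 1: "monom (comb3 a b c (e i) v) \<in> Z" if i: "i \<in> {1..s}" for i
    proof -
      have "monom (comb3 a b c (e i) (\<Sum>j=1..s. scale (crd v j) (e j)))
          - (\<Sum>j=1..s. pscale (crd v j) (monom (comb3 a b c (e i) (e j)))) \<in> ?I"
        using comb3_root_add[OF d, of "e i"] comb3_root_scale[OF d, of "e i"]
        by (intro linear_mod_subspace[OF I]) simp_all
      moreover have "(\<Sum>j=1..s. pscale (crd v j) (monom (comb3 a b c (e i) (e j)))) \<in> Z"
        using basis i l by (intro pv.subspace_sum[OF Z] pv.subspace_scale[OF Z]) simp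
      ultimately show ?thesis unfolding crd[of v, symmetric] by (rule cong)
    qed
    have "monom (comb3 a b c (\<Sum>i=1..s. scale (crd u i) (e i)) v)
        - (\<Sum>i=1..s. pscale (crd u i) (monom (comb3 a b c (e i) v))) \<in> ?I"
      using comb3_inner_add[OF d, of _ _ v] comb3_inner_scale[OF d, of _ v]
      by (intro linear_mod_subspace[OF I, of "\<lambda>u. monom (comb3 a b c u v)"]) simp_all
    moreover have "(\<Sum>i=1..s. pscale (crd u i) (monom (comb3 a b c (e i) v))) \<in> Z"
      using 1 by (intro pv.subspace_sum[OF Z] pv.subspace_scale[OF Z]) simp
    ultimately show ?thesis unfolding crd[of u, symmetric] by (rule cong)
  qed
  have comb: "monom (comb3 a b c u v) \<in> Z" if d: "distinct [a, b, c]" "{a, b, c} = {1..3}" for a b c u v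
  proof -
    have "a \<in> {1..3}" "b \<in> {1..3}" "c \<in> {1..3}" using d(2) by auto
    then have "a \<in> {1,2,3}" "b \<in> {1,2,3}" "c \<in> {1,2,3}" by auto
    then consider "(a, b, c) \<in> {(1, 2, 3), (2, 3, 1), (3, 1, 2)}" | "(b, a, c) \<in> {(1, 2, 3), (2, 3, 1), (3, 1, 2)}"
      using d(1) by auto
    then show ?thesis
    proof cases
      case 2
      \<comment> \<open>One inner swap makes an anticyclic labelling cyclic, at the price of
        replacing u by \<tau> u.\<close>
      have "monom (comb3 b a c (\<tau> u) v) - monom (comb3 a b c u v) \<in> ?I"
        using comb3_inner_swap[of b a c u _ v] d by (simp add: insert_commute[of b a])
      from pv.subspace_neg[OF I this] show ?thesis using cong cyc[OF 2] by simp
    qed (rule cyc)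
  qed
  have "monom t \<in> Z" if "t \<in> trees V 3" for t
    using that
  proof (cases rule: trees_3_cases)
    case (1 a b c u v)
    have "monom (comb3 a b c u (\<tau> v)) - monom (Vertex v (Leaf c) (Vertex u (Leaf a) (Leaf b))) \<in> ?I"
      using comb3_root_swap[OF 1(1,2), of u v] by simp
    from cong[of "monom (Vertex v (Leaf c) (Vertex u (Leaf a) (Leaf b)))", OF _ comb[OF 1(1,2)]]
      pv.subspace_neg[OF I this]
    show ?thesis using 1(5) comb[OF 1(1,2)] by auto
  qed
  then have "lin_ext monom p \<in> Z" if "Poly_Mapping.keys p \<subseteq> trees V 3" for p
    unfolding lin_ext_def using that by (intro pv.subspace_sum[OF Z] pv.subspace_scale[OF Z]) blast
  moreover obtain p where p: "Poly_Mapping.keys p \<subseteq> trees V 3" "x = free_class V 3 p"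
    using x by (auto simp: free_carrier)
  ultimately obtain \<gamma> where "p - tree_comb s e e \<gamma> \<in> ?I" by (auto simp: lin_ext_id Z_def)
  then show ?thesis using p by (auto simp: free_class_eq_iff)
qed

end

section \<open>Independence of the ternary trees\<close>

text \<open>Trees act as operations of an algebra in which the relations of the free operad hold, so
  different actions separate classes. This is the source of linear independence.\<close>

primrec eval_tree :: "('v \<Rightarrow> 'a \<Rightarrow> 'a \<Rightarrow> 'a) \<Rightarrow> (nat \<Rightarrow> 'a) \<Rightarrow> 'v btree \<Rightarrow> 'a" where
  "eval_tree \<mu> a (Leaf i) = a i"
| "eval_tree \<mu> a (Vertex v s t) = \<mu> v (eval_tree \<mu> a s) (eval_tree \<mu> a t)"

lemma eval_tree_graft: "eval_tree \<mu> a (graft f t) = eval_tree \<mu> (\<lambda>i. eval_tree \<mu> a (f i)) t"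
  by (induction t) auto

lemma eval_tree_cong: "(\<And>i. i \<in> set (leaves t) \<Longrightarrow> a i = b i) \<Longrightarrow> eval_tree \<mu> a t = eval_tree \<mu> b t"
  by (induction t) auto

lemma eval_tree_comp:
  "eval_tree \<mu> a (tree_comp n i s t) =
    eval_tree \<mu> ((\<lambda>j. if j < i then a j else a (j + n - 1))
      (i := eval_tree \<mu> (\<lambda>b. a (b + i - 1)) t)) s"
  unfolding tree_comp_def eval_tree_graft
  by (rule eval_tree_cong) (simp add: relabel_def eval_tree_graft)

text \<open>Bilinearity is phrased as commutation with \<open>lin_ext\<close> over combinations of
  trees, because composites in the tree operad have exactly this shape.\<close>

locale tree_algebra = closed_S2_module V
  for V :: "('k::field, 'v) S2_module" +
  fixes \<mu> :: "'v \<Rightarrow> ('x \<Rightarrow>\<^sub>0 'k) \<Rightarrow> ('x \<Rightarrow>\<^sub>0 'k) \<Rightarrow> ('x \<Rightarrow>\<^sub>0 'k)"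
  assumes \<mu>_left: "\<And>v g q y. \<mu> v (lin_ext g q :: 'x \<Rightarrow>\<^sub>0 'k) y = lin_ext (\<lambda>t :: 'v btree. \<mu> v (g t) y) q"
    and \<mu>_right: "\<And>v g q x. \<mu> v x (lin_ext g q :: 'x \<Rightarrow>\<^sub>0 'k) = lin_ext (\<lambda>t :: 'v btree. \<mu> v x (g t)) q"
    and \<mu>_add: "\<And>u v x y. u \<in> mod_carrier V \<Longrightarrow> v \<in> mod_carrier V \<Longrightarrow> \<mu> (mod_add V u v) x y = \<mu> u x y + \<mu> v x y"
    and \<mu>_scale: "\<And>c v x y. v \<in> mod_carrier V \<Longrightarrow> \<mu> (mod_scale V c v) x y = pscale c (\<mu> v x y)"
    and \<mu>_swap: "\<And>v x y. v \<in> mod_carrier V \<Longrightarrow> \<mu> (mod_swap V v) x y = \<mu> v y x"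
begin

abbreviation ev where "ev \<equiv> eval_tree \<mu>"

text \<open>A label occurs only once in s, so the value depends linearly on the entry at i; a
  repeated label would make the dependence of higher degree.\<close>

lemma eval_tree_linear:
  fixes q :: "'v btree \<Rightarrow>\<^sub>0 'k"
  shows "distinct (leaves s) \<Longrightarrow> i \<in> set (leaves s) \<Longrightarrow>
    ev (a(i := lin_ext g q)) s = lin_ext (\<lambda>t. ev (a(i := g t)) s) q"
proof (induction s)
  case (Vertex v s t)
  have *: "ev (a(i := z)) t = ev a t" if "i \<notin> set (leaves t)" for z t
    by (rule eval_tree_cong) (use that in auto)
  from Vertex.prems consider "i \<in> set (leaves s)" "i \<notin> set (leaves t)" | "i \<in> set (leaves t)" "i \<notin> set (leaves s)"
    by auto
  then show ?case by cases (use Vertex in \<open>simp_all add: * \<mu>_left \<mu>_right del: fun_upd_apply\<close>)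
qed simp

text \<open>The kernel of the action: an operadic ideal containing the corolla relations, hence the
  tree ideal.\<close>

definition null :: "nat \<Rightarrow> ('v btree \<Rightarrow>\<^sub>0 'k) set" where
  "null n = {p. Poly_Mapping.keys p \<subseteq> trees V n \<and> (\<forall>a. lin_ext (ev a) p = 0)}"

lemma null_comp_left:
  assumes p: "p \<in> null m"
  shows "lin_ext (ev a) (lin_ext (\<lambda>s. lin_ext (\<lambda>t. monom (tree_comp n i s t)) q) p) = 0"
proof -
  have "lin_ext (ev a) (lin_ext (\<lambda>s. lin_ext (\<lambda>t. monom (tree_comp n i s t)) q) p)
    = lin_ext (\<lambda>t. lin_ext (\<lambda>s. ev a (tree_comp n i s t)) p) q"
    by (subst lin_ext_swap) (simp add: lin_ext_lin_ext)
  also have "\<dots> = lin_ext (\<lambda>t. 0) q"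
    using p by (simp add: eval_tree_comp null_def)
  finally show ?thesis by (simp add: lin_ext_def)
qed

lemma null_comp_right:
  assumes p: "Poly_Mapping.keys p \<subseteq> trees V m" and q: "q \<in> null n" and i: "1 \<le> i" "i \<le> m"
  shows "lin_ext (ev a) (lin_ext (\<lambda>s. lin_ext (\<lambda>t. monom (tree_comp n i s t)) q) p) = 0"
proof -
  have "lin_ext (\<lambda>t. ev a (tree_comp n i s t)) q = 0" if "s \<in> Poly_Mapping.keys p" for s
  proof -
    let ?a = "\<lambda>j. if j < i then a j else a (j + n - 1)" and ?b = "\<lambda>b. a (b + i - 1)"
    have s: "distinct (leaves s)" "i \<in> set (leaves s)" using that p i by (auto simp: trees_def)
    have "lin_ext (ev ?b) q = 0" using q by (simp add: null_def)
    \<comment> \<open>The instance with \<open>0\<close> says that the value vanishes when the entry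
      at i is 0.\<close>
    with eval_tree_linear[OF s, of ?a "ev ?b" q] eval_tree_linear[OF s, of ?a "ev ?b" 0]
    show ?thesis by (simp add: eval_tree_comp lin_ext_def)
  qed
  then have "lin_ext (\<lambda>s. lin_ext (\<lambda>t. ev a (tree_comp n i s t)) q) p = lin_ext (\<lambda>s. 0) p"
    by (rule lin_ext_cong)
  then show ?thesis by (simp add: lin_ext_lin_ext) (simp add: lin_ext_def)
qed

lemma operadic_ideal_null: "operadic_ideal (tree_operad V) null"
proof -
  note c = trees.zero_closed trees.add_closed trees.scale_closed trees.act_closed trees.comp_closed
  note c = c[unfolded tree_operad_ops tree_operad_carrier mem_Collect_eq]
  have k: "p \<in> null n \<Longrightarrow> Poly_Mapping.keys p \<subseteq> trees V n" for p n by (simp add: null_def)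
  show ?thesis
    unfolding operadic_ideal_def sub_S_module_def tree_operad_ops tree_operad_carrier mem_Collect_eq
  proof (intro conjI allI impI ballI, goal_cases)
    case (6 m n i p q)
    then have "1 \<le> i" "i \<le> m" by auto
    with 6 show ?case
      using null_comp_left[of p m] null_comp_right[of p m q n i] c(5)[of i m n p q] k[of p m] k[of q n]
      by (auto simp: null_def simp del: One_nat_def)
  next
    case (5 n p \<sigma>)
    have "lin_ext (ev a) (lin_ext (\<lambda>t. monom (relabel (inv \<sigma>) t)) p) = lin_ext (ev (\<lambda>i. a (inv \<sigma> i))) p" for a
      by (simp add: lin_ext_lin_ext relabel_def eval_tree_graft)
    then show ?case using 5 c(4)[of n p \<sigma>] by (simp add: null_def)
  qed (use c in \<open>auto simp: null_def lin_ext_add lin_ext_scale, simp_all add: lin_ext_def\<close>)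
qed

lemma lin_ext_eval_tree_ideal:
  assumes "p \<in> tree_ideal V n"
  shows "lin_ext (ev a) p = 0"
proof -
  have "in_arity 2 (corolla_relations V) n \<subseteq> null n" for n
  proof
    fix q assume q: "q \<in> in_arity 2 (corolla_relations V) n"
    then have "q \<in> corolla_relations V" by (simp add: in_arity_def split: if_splits)
    then have "lin_ext (ev a) q = 0" for a
      by (cases rule: corolla_relationsE)
        (simp_all add: lin_ext_diff lin_ext_add lin_ext_scale \<mu>_add \<mu>_scale \<mu>_swap)
    then show "q \<in> null n"
      using q corolla_relations_carrier[of n] by (auto simp: null_def tree_operad_carrier)
  qed
  from generated_ideal_least[OF operadic_ideal_null this] assms
  show ?thesis by (auto simp: tree_ideal_def null_def)
qed

end

text \<open>Basis elements \<open>0\<close>, \<open>1\<close>, \<open>2\<close> are inputs,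
  \<open>3\<close> is the value at the inner vertex and \<open>4\<close> the output; \<alpha> and
  \<beta> read the inner and the root decoration separately. Skew symmetry fits decorations on which
  the swap acts by -1, as for \<open>Lie\<close> and \<open>Lie2\<close>.\<close>

definition bracket :: "'k::field \<Rightarrow> 'k \<Rightarrow> (nat \<Rightarrow>\<^sub>0 'k) \<Rightarrow> (nat \<Rightarrow>\<^sub>0 'k) \<Rightarrow> (nat \<Rightarrow>\<^sub>0 'k)" where
  "bracket \<alpha> \<beta> x y = (let X = Poly_Mapping.lookup x; Y = Poly_Mapping.lookup y in
     pscale (\<alpha> * (X 0 * Y 1 - X 1 * Y 0)) (monom 3) + pscale (\<beta> * (X 3 * Y 2 - X 2 * Y 3)) (monom 4))"

lemma lookup_monom: "Poly_Mapping.lookup (monom x) y = (if x = y then 1 else 0)"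
  by (simp add: monom_def lookup_single when_def)

lemma lookup_lin_ext:
  "Poly_Mapping.lookup (lin_ext f p) x = (\<Sum>t\<in>Poly_Mapping.keys p. Poly_Mapping.lookup p t * Poly_Mapping.lookup (f t) x)"
  by (simp add: lin_ext_def lookup_sum)

lemma bracket_lin_ext:
  "bracket \<alpha> \<beta> (lin_ext g q) y = lin_ext (\<lambda>t. bracket \<alpha> \<beta> (g t) y) q"
  "bracket \<alpha> \<beta> x (lin_ext g q) = lin_ext (\<lambda>t. bracket \<alpha> \<beta> x (g t)) q"
  by (rule poly_mapping_eqI, simp add: bracket_def Let_def lookup_lin_ext lookup_add
      sum_distrib_left sum_distrib_right sum.distrib[symmetric] sum_subtractf[symmetric], rule sum.cong, simp, simp add: algebra_simps)+

lemma bracket_linear: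
  "bracket (\<alpha> + \<alpha>') (\<beta> + \<beta>') x y = bracket \<alpha> \<beta> x y + bracket \<alpha>' \<beta>' x y"
  "bracket (c * \<alpha>) (c * \<beta>) x y = pscale c (bracket \<alpha> \<beta> x y)"
  "bracket (- \<alpha>) (- \<beta>) x y = bracket \<alpha> \<beta> y x"
  by (rule poly_mapping_eqI, simp add: bracket_def Let_def lookup_add algebra_simps)+

lemma lookup_bracket:
  "Poly_Mapping.lookup (bracket \<alpha> \<beta> x y) i =
    (if i = 3 then \<alpha> * (Poly_Mapping.lookup x 0 * Poly_Mapping.lookup y 1 - Poly_Mapping.lookup x 1 * Poly_Mapping.lookup y 0)
     else if i = 4 then \<beta> * (Poly_Mapping.lookup x 3 * Poly_Mapping.lookup y 2 - Poly_Mapping.lookup x 2 * Poly_Mapping.lookup y 3)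
     else 0)"
  by (simp add: bracket_def Let_def lookup_add lookup_monom)

text \<open>The leaf l and its cyclic successor receive \<open>0\<close> and \<open>1\<close>. If k
  differs from l, the inner vertex of \<open>tree3 k\<close> has a leaf with input \<open>2\<close>,
  which has zero bracket with the other inputs; so only the shape l reaches
  \<open>4\<close>.\<close>

lemma eval_bracket_tree3:
  assumes "k \<in> {1..3}" "l \<in> {1..3}"
  shows "Poly_Mapping.lookup (eval_tree (\<lambda>v. bracket (\<alpha> v) (\<beta> v))
      (\<lambda>i. monom (if i = l then 0 else if i = (if l = 3 then 1 else l + 1) then 1 else 2)) (tree3 k u v)) 4
    = (if k = l then \<alpha> u * \<beta> v else 0)"
proof -
  have "k = 1 \<or> k = 2 \<or> k = 3" "l = 1 \<or> l = 2 \<or> l = 3" using assms by auto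
  then show ?thesis
    by (elim disjE; simp add: tree3_def lookup_bracket lookup_monom)
qed
context closed_S2_module
begin

text \<open>
  The coefficients of an element of arity 3 can be read off in the algebra spanned by
  \<open>x\<^sub>0, \<dots>, x\<^sub>4\<close> with \<open>[x\<^sub>0, x\<^sub>1] = \<alpha> x\<^sub>3\<close> and \<open>[x\<^sub>3, x\<^sub>2] = \<beta> x\<^sub>4\<close>.
\<close>

lemma tree_comb_coeffs_unique:
  fixes \<alpha> \<beta> :: "'v \<Rightarrow> 'k"
  assumes \<alpha>: "\<And>u v. \<alpha> (mod_add V u v) = \<alpha> u + \<alpha> v" "\<And>c v. \<alpha> (mod_scale V c v) = c * \<alpha> v"
      "\<And>v. \<alpha> (mod_swap V v) = - \<alpha> v"
    and \<beta>: "\<And>u v. \<beta> (mod_add V u v) = \<beta> u + \<beta> v" "\<And>c v. \<beta> (mod_scale V c v) = c * \<beta> v"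
      "\<And>v. \<beta> (mod_swap V v) = - \<beta> v"
    and eq: "free_class V 3 (tree_comb s e f \<gamma>) = free_class V 3 (tree_comb s e f \<gamma>')"
    and l: "l \<in> {1..3}"
  shows "(\<Sum>i=1..s. \<Sum>j=1..s. \<gamma> l i j * (\<alpha> (e i) * \<beta> (f j))) = (\<Sum>i=1..s. \<Sum>j=1..s. \<gamma>' l i j * (\<alpha> (e i) * \<beta> (f j)))"
proof -
  interpret A: tree_algebra V "\<lambda>v. bracket (\<alpha> v) (\<beta> v)"
    by unfold_locales
      (simp_all only: bracket_lin_ext \<alpha> \<beta> bracket_linear)
  define a :: "nat \<Rightarrow> (nat \<Rightarrow>\<^sub>0 'k)" where
    "a i = monom (if i = l then 0 else if i = (if l = 3 then 1 else l + 1) then 1 else 2)" for i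
  have t: "Poly_Mapping.lookup (A.ev a (tree3 k u v)) 4 = (if k = l then \<alpha> u * \<beta> v else 0)"
    if "k \<in> {1..3}" for k u v
    unfolding a_def by (rule eval_bracket_tree3[OF that l])
  have "Poly_Mapping.lookup (lin_ext (A.ev a) (tree_comb s e f \<gamma>)) 4
      = (\<Sum>i=1..s. \<Sum>j=1..s. \<gamma> l i j * (\<alpha> (e i) * \<beta> (f j)))" for \<gamma>
  proof -
    have "Poly_Mapping.lookup (lin_ext (A.ev a) (tree_comb s e f \<gamma>)) 4
      = (\<Sum>k=1..3. \<Sum>i=1..s. \<Sum>j=1..s. if k = l then \<gamma> k i j * (\<alpha> (e i) * \<beta> (f j)) else 0)"
      unfolding tree_comb_def lin_ext_sum lin_ext_scale lin_ext_monom lookup_sum lookup_pscale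
      by (intro sum.cong refl) (simp add: t del: One_nat_def)
    also have "\<dots> = (\<Sum>k=1..3. if k = l then \<Sum>i=1..s. \<Sum>j=1..s. \<gamma> k i j * (\<alpha> (e i) * \<beta> (f j)) else 0)"
      by (intro sum.cong refl) simp
    finally show ?thesis using l by simp
  qed
  moreover have "lin_ext (A.ev a) (tree_comb s e f \<gamma>) = lin_ext (A.ev a) (tree_comb s e f \<gamma>')"
    using A.lin_ext_eval_tree_ideal[of "tree_comb s e f \<gamma> - tree_comb s e f \<gamma>'" 3 a] eq
    by (simp add: free_class_eq_iff lin_ext_diff)
  ultimately show ?thesis by metis
qed

end

section \<open>The generators of the black product\<close>

lemma S2_hom_inverse:
  assumes "S2_hom V W h" "bij_betw h (mod_carrier V) (mod_carrier W)"
  shows "S2_hom W V (inv_into (mod_carrier V) h)"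
proof -
  interpret S2_hom V W h by fact
  let ?g = "inv_into (mod_carrier V) h"
  have g: "?g w \<in> mod_carrier V" "h (?g w) = w" if "w \<in> mod_carrier W" for w
    using assms(2) that by (auto simp: bij_betw_def inv_into_into f_inv_into_f)
  have inj: "?g (h v) = v" if "v \<in> mod_carrier V" for v
    using assms(2) that by (simp add: bij_betw_def)
  show ?thesis
  proof unfold_locales
    fix u w assume *: "u \<in> mod_carrier W" "w \<in> mod_carrier W"
    have "?g (mod_add W u w) = ?g (h (mod_add V (?g u) (?g w)))" using * by (simp add: h_add g)
    then show "?g (mod_add W u w) = mod_add V (?g u) (?g w)" using * by (simp add: inj g V.add_in)
  next
    fix c w assume *: "w \<in> mod_carrier W"
    have "?g (mod_scale W c w) = ?g (h (mod_scale V c (?g w)))" using * by (simp add: h_scale g)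
    then show "?g (mod_scale W c w) = mod_scale V c (?g w)" using * by (simp add: inj g V.scale_in)
  next
    fix w assume *: "w \<in> mod_carrier W"
    have "?g (mod_swap W w) = ?g (h (mod_swap V (?g w)))" using * by (simp add: h_swap g)
    then show "?g (mod_swap W w) = mod_swap V (?g w)" using * by (simp add: inj g V.swap_in)
  qed (simp add: g)
qed

section \<open>Tensor products computed on representatives\<close>

definition tensor_swap :: "('k::field, 'v) S2_module \<Rightarrow> ('k, 'w) S2_module \<Rightarrow> ('v \<times> 'w \<Rightarrow>\<^sub>0 'k) \<Rightarrow> ('v \<times> 'w \<Rightarrow>\<^sub>0 'k)" where
  "tensor_swap V W = lin_ext (\<lambda>(v, w). - monom (mod_swap V v, mod_swap W w))"

lemma tensor_swap_linear:
  "tensor_swap V W (p + q) = tensor_swap V W p + tensor_swap V W q"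
  "tensor_swap V W (p - q) = tensor_swap V W p - tensor_swap V W q"
  "tensor_swap V W (pscale c p) = pscale c (tensor_swap V W p)"
  "tensor_swap V W (monom (v, w)) = - monom (mod_swap V v, mod_swap W w)"
  by (simp_all add: tensor_swap_def lin_ext_add lin_ext_scale lin_ext_diff)

abbreviation tensor_null where
  "tensor_null V W \<equiv> pv.span (bilinear_relations V W)"

lemma tensor_class_eq_iff: "tensor_class V W p = tensor_class V W q \<longleftrightarrow> p - q \<in> tensor_null V W"
  unfolding tensor_class_def by (rule coset_eq_iff) (rule pv.subspace_span)

lemma tensor_class_self: "p \<in> tensor_class V W p"
  using pv.span_zero[of "bilinear_relations V W"] by (force simp: tensor_class_def)

lemma in_tensor_class: "p' \<in> tensor_class V W p \<Longrightarrow> p' - p \<in> tensor_null V W"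
  by (auto simp: tensor_class_def)

lemma UN_eq_const: "x \<in> A \<Longrightarrow> (\<And>y. y \<in> A \<Longrightarrow> f y = c) \<Longrightarrow> (\<Union>y\<in>A. f y) = c"
  by auto

lemma tensor_sgn_ops:
  "mod_carrier (tensor_sgn V W) = tensor_class V W ` {p. Poly_Mapping.keys p \<subseteq> mod_carrier V \<times> mod_carrier W}"
  "mod_add (tensor_sgn V W) (tensor_class V W p) (tensor_class V W q) = tensor_class V W (p + q)"
  "mod_scale (tensor_sgn V W) c (tensor_class V W p) = tensor_class V W (pscale c p)"
proof -
  show "mod_add (tensor_sgn V W) (tensor_class V W p) (tensor_class V W q) = tensor_class V W (p + q)"
    unfolding tensor_sgn_def S2_module.simps
  proof (intro UN_eq_const[OF tensor_class_self])
    fix p' q' assume "p' \<in> tensor_class V W p" "q' \<in> tensor_class V W q"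
    from pv.span_add[OF in_tensor_class[OF this(1)] in_tensor_class[OF this(2)]]
    show "tensor_class V W (p' + q') = tensor_class V W (p + q)"
      by (simp add: tensor_class_eq_iff algebra_simps)
  qed
  show "mod_scale (tensor_sgn V W) c (tensor_class V W p) = tensor_class V W (pscale c p)"
    unfolding tensor_sgn_def S2_module.simps
  proof (intro UN_eq_const[OF tensor_class_self])
    fix p' assume "p' \<in> tensor_class V W p"
    from pv.span_scale[OF in_tensor_class[OF this], of c]
    show "tensor_class V W (pscale c p') = tensor_class V W (pscale c p)"
      by (simp add: tensor_class_eq_iff pv.scale_right_diff_distrib)
  qed
qed (simp add: tensor_sgn_def)

text \<open>A linear map that respects the bilinear relations preserves their span, so the class of
  the swapped element is independent of the representative.\<close>

lemma tensor_sgn_swap: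
  assumes "\<And>p. p \<in> bilinear_relations V W \<Longrightarrow> tensor_swap V W p \<in> tensor_null V W"
  shows "mod_swap (tensor_sgn V W) (tensor_class V W p) = tensor_class V W (tensor_swap V W p)"
  unfolding tensor_sgn_def S2_module.simps tensor_swap_def[symmetric]
proof (intro UN_eq_const[OF tensor_class_self])
  fix p' assume p': "p' \<in> tensor_class V W p"
  have "pv.subspace {q. tensor_swap V W q \<in> tensor_null V W}"
    by (auto simp: pv.subspace_def tensor_swap_linear pv.span_add pv.span_scale)
      (simp add: tensor_swap_def lin_ext_def pv.span_zero)
  then have "tensor_null V W \<subseteq> {q. tensor_swap V W q \<in> tensor_null V W}"
    by (intro pv.span_minimal) (use assms in auto)
  with in_tensor_class[OF p'] show "tensor_class V W (tensor_swap V W p') = tensor_class V W (tensor_swap V W p)"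
    by (auto simp: tensor_class_eq_iff tensor_swap_linear)
qed

lemma bilinear_relations_null:
  "u \<in> mod_carrier V \<Longrightarrow> v \<in> mod_carrier V \<Longrightarrow> w \<in> mod_carrier W \<Longrightarrow>
    monom (mod_add V u v, w) - (monom (u, w) + monom (v, w)) \<in> tensor_null V W"
  "v \<in> mod_carrier V \<Longrightarrow> w \<in> mod_carrier W \<Longrightarrow> z \<in> mod_carrier W \<Longrightarrow>
    monom (v, mod_add W w z) - (monom (v, w) + monom (v, z)) \<in> tensor_null V W"
  "v \<in> mod_carrier V \<Longrightarrow> w \<in> mod_carrier W \<Longrightarrow>
    monom (mod_scale V c v, w) - pscale c (monom (v, w)) \<in> tensor_null V W"
  "v \<in> mod_carrier V \<Longrightarrow> w \<in> mod_carrier W \<Longrightarrow>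
    monom (v, mod_scale W c w) - pscale c (monom (v, w)) \<in> tensor_null V W"
  unfolding bilinear_relations_def by (rule pv.span_base, blast)+

abbreviation sgn_module :: "('k::field, 'k) S2_module" where
  "sgn_module \<equiv> S2_module_of (*) uminus"

abbreviation sgn2_module :: "('k::field, 'k \<times> 'k) S2_module" where
  "sgn2_module \<equiv> sum_S2_module sgn_module sgn_module"

lemma sum_S2_module_simps [simp]:
  "mod_carrier (sum_S2_module V W) = mod_carrier V \<times> mod_carrier W"
  "mod_zero (sum_S2_module V W) = (mod_zero V, mod_zero W)"
  "mod_add (sum_S2_module V W) x y = (mod_add V (fst x) (fst y), mod_add W (snd x) (snd y))"
  "mod_scale (sum_S2_module V W) c x = (mod_scale V c (fst x), mod_scale W c (snd x))"
  "mod_swap (sum_S2_module V W) x = (mod_swap V (fst x), mod_swap W (snd x))"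
  by (simp_all add: sum_S2_module_def split: prod.splits)

lemma (in vector_space) sum_keys_superset:
  assumes "finite A" "Poly_Mapping.keys p \<subseteq> A"
  shows "(\<Sum>x\<in>Poly_Mapping.keys p. scale (Poly_Mapping.lookup p x) (g x)) = (\<Sum>x\<in>A. scale (Poly_Mapping.lookup p x) (g x))"
  by (rule sum.mono_neutral_left) (use assms in \<open>auto simp: in_keys_iff\<close>)

text \<open>The counterpart of \<open>lin_ext\<close> with values in an arbitrary vector space; it
  serves to contract tensors to vectors.\<close>

definition (in vector_space) lin_val :: "('x \<Rightarrow> 'b) \<Rightarrow> ('x \<Rightarrow>\<^sub>0 'a) \<Rightarrow> 'b" where
  "lin_val g p = (\<Sum>x\<in>Poly_Mapping.keys p. scale (Poly_Mapping.lookup p x) (g x))"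

lemma (in vector_space) lin_val_linear:
  "lin_val g (p + q) = lin_val g p + lin_val g q"
  "lin_val g (pscale c p) = scale c (lin_val g p)"
  "lin_val g (p - q) = lin_val g p - lin_val g q"
  "lin_val g (monom x) = g x"
proof -
  show add: "lin_val g (p + q) = lin_val g p + lin_val g q" for p q
  proof -
    let ?A = "Poly_Mapping.keys p \<union> Poly_Mapping.keys q"
    have "lin_val g r = (\<Sum>x\<in>?A. scale (Poly_Mapping.lookup r x) (g x))"
      if "Poly_Mapping.keys r \<subseteq> ?A" for r
      unfolding lin_val_def by (rule sum_keys_superset) (use that in simp_all)
    then show ?thesis
      by (simp add: Poly_Mapping.keys_add lookup_add scale_left_distrib sum.distrib)
  qed
  show "lin_val g (pscale c p) = scale c (lin_val g p)"
    unfolding lin_val_def by (subst sum_keys_superset[OF _ keys_pscale]) (simp_all add: scale_sum_right)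
  show "lin_val g (p - q) = lin_val g p - lin_val g q"
    using add[of "p - q" q] by simp
  show "lin_val g (monom x) = g x"
    by (simp add: lin_val_def monom_def)
qed

context linear_S2_module
begin

abbreviation VV where "VV \<equiv> sum_S2_module V V"
abbreviation T where "T \<equiv> tensor_sgn V (sgn2_module :: ('k, 'k \<times> 'k) S2_module)"

sublocale VV: closed_S2_module VV
  by unfold_locales simp_all

abbreviation null where "null \<equiv> tensor_null V (sgn2_module :: ('k, 'k \<times> 'k) S2_module)"

lemma T_swap: "mod_swap T (tensor_class V sgn2_module p) = tensor_class V sgn2_module (tensor_swap V sgn2_module p)"
proof (rule tensor_sgn_swap)
  note r = bilinear_relations_null[where V=V and W=sgn2_module, THEN pv.span_neg]
  fix p :: "'v \<times> 'k \<times> 'k \<Rightarrow>\<^sub>0 'k" assume p: "p \<in> bilinear_relations V sgn2_module"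
  from p[unfolded bilinear_relations_def] show "tensor_swap V sgn2_module p \<in> null"
  proof (elim UnE CollectE exE conjE)
    fix u v w assume p: "p = monom (mod_add V u v, w) - (monom (u, w) + monom (v, w))"
    show ?thesis unfolding p using r(1)[of "\<tau> u" "\<tau> v" "mod_swap sgn2_module w"]
      by (simp add: tensor_swap_linear \<tau>_add algebra_simps)
  next
    fix v w z assume p: "p = monom (v, mod_add sgn2_module w z) - (monom (v, w) + monom (v, z))"
    show ?thesis unfolding p using r(2)[of "\<tau> v" "mod_swap sgn2_module w" "mod_swap sgn2_module z"]
      by (simp add: tensor_swap_linear algebra_simps)
  next
    fix c v w assume p: "p = monom (mod_scale V c v, w) - pscale c (monom (v, w))"
    show ?thesis unfolding p using r(3)[of "\<tau> v" "mod_swap sgn2_module w" c]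
      by (simp add: tensor_swap_linear \<tau>_scale algebra_simps)
  next
    fix c v w assume p: "p = monom (v, mod_scale sgn2_module c w) - pscale c (monom (v, w))"
    show ?thesis unfolding p using r(4)[of "\<tau> v" "mod_swap sgn2_module w" c]
      by (simp add: tensor_swap_linear algebra_simps)
  qed
qed

definition \<phi> :: "'v \<times> 'v \<Rightarrow> ('v \<times> 'k \<times> 'k \<Rightarrow>\<^sub>0 'k) set" where
  "\<phi> x = tensor_class V sgn2_module (monom (fst x, (1, 0)) + monom (snd x, (0, 1)))"

lemma closed_T: "closed_S2_module T"
  by unfold_locales (auto simp: tensor_sgn_ops T_swap)

sublocale T: closed_S2_module T by (rule closed_T)

lemma tensor_null:
  "monom (u + v, w) - (monom (u, w) + monom (v, w)) \<in> null"
  "monom (v, (a + a', b + b')) - (monom (v, (a, b)) + monom (v, (a', b'))) \<in> null"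
  "monom (scale c v, w) - pscale c (monom (v, w)) \<in> null"
  "monom (v, (c * a, c * b)) - pscale c (monom (v, (a, b))) \<in> null"
  using bilinear_relations_null(1)[of u V v w sgn2_module] bilinear_relations_null(2)[of v V "(a, b)" sgn2_module "(a', b')"]
   bilinear_relations_null(3)[of v V w sgn2_module c] bilinear_relations_null(4)[of v V "(a, b)" sgn2_module c]
  by simp_all

lemma S2_hom_\<phi>: "S2_hom VV T \<phi>"
proof unfold_locales
  fix x y
  show "\<phi> (mod_add VV x y) = mod_add T (\<phi> x) (\<phi> y)"
    using pv.span_add[OF tensor_null(1)[of "fst x" "fst y" "(1, 0)"] tensor_null(1)[of "snd x" "snd y" "(0, 1)"]]
    by (simp add: \<phi>_def tensor_sgn_ops tensor_class_eq_iff algebra_simps)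
next
  fix c x
  show "\<phi> (mod_scale VV c x) = mod_scale T c (\<phi> x)"
    using pv.span_add[OF tensor_null(3)[of c "fst x" "(1, 0)"] tensor_null(3)[of c "snd x" "(0, 1)"]]
    by (simp add: \<phi>_def tensor_sgn_ops tensor_class_eq_iff algebra_simps pv.scale_right_distrib)
next
  fix x
  \<comment> \<open>The swap negates both brackets and \<open>sgn\<^sub>2\<close> contributes
    another sign; they cancel, by homogeneity in the second factor with scalar -1.\<close>
  show "\<phi> (mod_swap VV x) = mod_swap T (\<phi> x)"
    using pv.span_add[OF tensor_null(4)[of "\<tau> (fst x)" "-1" 1 0] tensor_null(4)[of "\<tau> (snd x)" "-1" 0 1]]
    by (simp add: \<phi>_def T_swap tensor_swap_linear tensor_class_eq_iff algebra_simps)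
qed (simp add: \<phi>_def tensor_sgn_ops)

sublocale \<phi>: S2_hom VV T \<phi> by (rule S2_hom_\<phi>)

lemma bij_\<phi>: "bij_betw \<phi> (mod_carrier VV) (mod_carrier T)"
proof (rule bij_betw_imageI)
  show "inj_on \<phi> (mod_carrier VV)"
  proof (rule inj_onI)
    fix x y assume "\<phi> x = \<phi> y"
    then have d: "monom (fst x, (1, 0)) + monom (snd x, (0, 1)) - (monom (fst y, (1, 0)) + monom (snd y, (0, 1))) \<in> null"
      by (simp add: \<phi>_def tensor_class_eq_iff)
    \<comment> \<open>The contractions sending v \<otimes> (a, b) to a v and to b v kill the
      bilinear relations and recover the two components of x.\<close>
    have *: "lin_val g p = 0" if "p \<in> null" and g: "g = (\<lambda>(v, z). scale (fst z) v) \<or> g = (\<lambda>(v, z). scale (snd z) v)" for p g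
    proof -
      have "pv.subspace {p. lin_val g p = 0}"
        by (auto simp: pv.subspace_def lin_val_linear) (simp add: lin_val_def)
      moreover have "bilinear_relations V sgn2_module \<subseteq> {p. lin_val g p = 0}"
        using g by (auto simp: bilinear_relations_def lin_val_linear scale_left_distrib scale_right_distrib mult.commute)
      ultimately show ?thesis using that(1) pv.span_minimal by blast
    qed
    show "x = y"
      using *[OF d disjI1[OF refl]] *[OF d disjI2[OF refl]] by (intro prod_eqI) (simp_all add: lin_val_linear)
  qed
  have "\<exists>x. tensor_class V sgn2_module p = \<phi> x" for p
  proof -
    define Z where "Z = {p. \<exists>x. tensor_class V sgn2_module p = \<phi> x}"
    have "p + q \<in> Z" if "p \<in> Z" "q \<in> Z" for p q
    proof -
      from that obtain x y where "tensor_class V sgn2_module p = \<phi> x" "tensor_class V sgn2_module q = \<phi> y"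
        by (auto simp: Z_def)
      then have "tensor_class V sgn2_module (p + q) = \<phi> (mod_add VV x y)"
        by (simp only: tensor_sgn_ops(2)[symmetric]) (rule \<phi>.h_add[symmetric], simp_all)
      then show ?thesis unfolding Z_def by blast
    qed
    moreover have scaled: "pscale c p \<in> Z" if "p \<in> Z" for p c
    proof -
      from that obtain x where "tensor_class V sgn2_module p = \<phi> x" by (auto simp: Z_def)
      then have "tensor_class V sgn2_module (pscale c p) = \<phi> (mod_scale VV c x)"
        by (simp only: tensor_sgn_ops(3)[symmetric]) (rule \<phi>.h_scale[symmetric], simp)
      then show ?thesis unfolding Z_def by blast
    qed
    moreover have m: "monom (v, (a, b)) \<in> Z" for v a b
    proof -
      \<comment> \<open>Split (a, b) as a (1, 0) + b (0, 1) and move the scalars to v.\<close>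
      have "tensor_class V sgn2_module (monom (v, (a, b))) = \<phi> (scale a v, scale b v)"
        using pv.span_diff[OF pv.span_add[OF tensor_null(2)[of v a 0 0 b]
            pv.span_add[OF tensor_null(4)[of v a 1 0] tensor_null(4)[of v b 0 1]]]
            pv.span_add[OF tensor_null(3)[of a v "(1, 0)"] tensor_null(3)[of b v "(0, 1)"]]]
        by (simp add: \<phi>_def tensor_class_eq_iff algebra_simps)
      then show ?thesis unfolding Z_def by blast
    qed
    moreover have "0 \<in> Z" using scaled[OF m, of 0] by simp
    ultimately have "pv.subspace Z" by (auto simp: pv.subspace_def)
    then have "lin_ext monom p \<in> Z"
      unfolding lin_ext_def using m by (intro pv.subspace_sum pv.subspace_scale) auto
    then show ?thesis by (simp add: lin_ext_id Z_def)
  qed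
  then show "\<phi> ` mod_carrier VV = mod_carrier T"
    using \<phi>.h_in by (fastforce simp: tensor_sgn_ops)
qed

lemma operad_iso_free_\<phi>: "operad_iso \<phi>.free_map (free_operad VV) (free_operad T)"
  using S2_hom_inverse[OF S2_hom_\<phi> bij_\<phi>] bij_\<phi>
  by (intro free_iso_of_S2_iso[OF S2_hom_\<phi>]) (auto simp: bij_betw_def f_inv_into_f)

end

section \<open>Isomorphisms of quotients and the Jacobi relation\<close>

text \<open>Closure under composition with arbitrary elements of Q rests on surjectivity of f, which
  makes the other operand an image too.\<close>

lemma operadic_ideal_image:
  assumes f: "operad_iso f P Q" and I: "operadic_ideal P I"
  shows "operadic_ideal Q (\<lambda>n. f n ` I n)"
proof -
  interpret operad_hom P Q f using f by (simp add: operad_iso_iff_hom)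
  have surj: "\<exists>x\<in>op_carrier P n. y = f n x" if "1 \<le> n" "y \<in> op_carrier Q n" for n y
    using f that by (auto simp: operad_iso_iff_hom bij_betw_def simp del: One_nat_def)
  note J = operadic_idealD[OF I]
  show ?thesis
    unfolding operadic_ideal_def sub_S_module_def
  proof (intro conjI allI impI ballI, goal_cases)
    case (2 n) then show ?case using J(2)[of n] hom_zero[of n] by force
  next
    case (3 n x y) then show ?case by (auto simp: J hom_add[symmetric])
  next
    case (4 n c x) then show ?case by (auto simp: J hom_scale[symmetric])
  next
    case (5 n x \<sigma>) then show ?case by (auto simp: J hom_act[symmetric])
  next
    case (6 m n i x y)
    then have i: "1 \<le> i" "i \<le> m" by auto
    from 6(4) show ?case
    proof (elim disjE conjE)
      assume "x \<in> f m ` I m" "y \<in> op_carrier Q n"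
      then show ?thesis using surj[of n y] 6 i by (auto simp: J hom_comp[symmetric] simp del: One_nat_def)
    next
      assume "x \<in> op_carrier Q m" "y \<in> f n ` I n"
      then show ?thesis using surj[of m x] 6 i by (auto simp: J hom_comp[symmetric] simp del: One_nat_def)
    qed
  qed (use J(1) hom_closed in blast)
qed

text \<open>\<open>XY\<close> pushes the ideal of X into that of Y, while \<open>YX\<close> and
  \<open>operadic_ideal_image\<close> confine the ideal of Y to the image of that of X; injectivity
  of f then yields the reflection of ideals. The second conclusion keeps track of
  generators.\<close>

lemma operad_iso_quotient_generated:
  assumes f: "operad_iso f P Q"
    and X: "\<And>n. X n \<subseteq> op_carrier P n" and Y: "\<And>n. Y n \<subseteq> op_carrier Q n"
    and XY: "\<And>n x. x \<in> X n \<Longrightarrow> f n x \<in> generated_ideal Q Y n"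
    and YX: "\<And>n y. y \<in> Y n \<Longrightarrow> y \<in> f n ` generated_ideal P X n"
  shows "operad_iso (quotient_map Q (generated_ideal Q Y) f)
    (quotient_operad P (generated_ideal P X)) (quotient_operad Q (generated_ideal Q Y))"
    and "\<And>n x. 1 \<le> n \<Longrightarrow> x \<in> op_carrier P n \<Longrightarrow>
      quotient_map Q (generated_ideal Q Y) f n (op_coset P (generated_ideal P X) n x)
        = op_coset Q (generated_ideal Q Y) n (f n x)"
proof -
  let ?I = "generated_ideal P X" and ?J = "generated_ideal Q Y"
  interpret f: operad_hom P Q f using f by (simp add: operad_iso_iff_hom)
  have I: "operadic_ideal P ?I" and J: "operadic_ideal Q ?J"
    by (rule operadic_ideal_generated[OF f.P.is_operad_axioms X]) 
      (rule operadic_ideal_generated[OF f.Q.is_operad_axioms Y])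
  have IJ: "f n x \<in> ?J n" if "x \<in> ?I n" for n x
    by (rule f.hom_generated_ideal[OF J X _ that]) (rule XY)
  interpret quotient_hom P ?I Q ?J f
    by unfold_locales (fact I J | erule IJ)+
  have bij: "bij_betw (f n) (op_carrier P n) (op_carrier Q n)" if "1 \<le> n" for n
    using f that by (simp add: operad_iso_iff_hom)
  show "operad_iso (quotient_map Q ?J f) (quotient_operad P ?I) (quotient_operad Q ?J)"
  proof (rule operad_iso_quotient)
    fix n :: nat and x assume n: "1 \<le> n" and x: "x \<in> op_carrier P n" "f n x \<in> ?J n"
    have "Y n \<subseteq> f n ` ?I n" for n using YX by blast
    from generated_ideal_least[OF operadic_ideal_image[OF f I] this x(2)]
    obtain x' where x': "x' \<in> ?I n" "f n x = f n x'" by auto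
    then have "x = x'"
      using bij[OF n] x(1) operadic_idealD(1)[OF I n x'(1)] by (auto simp: bij_betw_def dest: inj_onD)
    with x' show "x \<in> ?I n" by simp
  qed (use bij in \<open>auto simp: bij_betw_def\<close>)
  show "quotient_map Q ?J f n (op_coset P ?I n x) = op_coset Q ?J n (f n x)"
    if "1 \<le> n" "x \<in> op_carrier P n" for n x
    by (rule quotient_map_coset[OF that])
qed

section \<open>The Jacobi relation and its symmetry\<close>

definition jacobiator :: "'v \<Rightarrow> 'v \<Rightarrow> ('v btree \<Rightarrow>\<^sub>0 'k::field)" where
  "jacobiator u v = (\<Sum>l=1..3. monom (tree3 l u v))"

lemma sum_1_3: "(\<Sum>l=1..3. f l) = f 1 + f 2 + (f (3::nat) :: 'c::comm_monoid_add)"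
  by (simp add: numeral_3_eq_3 numeral_2_eq_2)

lemma sum_1_2: "(\<Sum>l=1..2. f l) = f 1 + (f (2::nat) :: 'c::comm_monoid_add)"
  by (simp add: numeral_2_eq_2)

lemma jacobiator_eq:
  "jacobiator u v = monom (comb3 1 2 3 u v) + monom (comb3 2 3 1 u v) + monom (comb3 3 1 2 u v)"
  by (simp only: jacobiator_def sum_1_3) (simp add: tree3_eq_comb3)

lemma keys_jacobiator:
  "u \<in> mod_carrier V \<Longrightarrow> v \<in> mod_carrier V \<Longrightarrow> Poly_Mapping.keys (jacobiator u v) \<subseteq> trees V 3"
  unfolding jacobiator_def by (intro keys_sum_subset) (simp add: tree3_trees)

lemma keys_add_subset:
  "Poly_Mapping.keys p \<subseteq> A \<Longrightarrow> Poly_Mapping.keys q \<subseteq> A \<Longrightarrow> Poly_Mapping.keys (p + q) \<subseteq> A"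
  using Poly_Mapping.keys_add[of p q] by blast

lemma keys_pscale_subset: "Poly_Mapping.keys p \<subseteq> A \<Longrightarrow> Poly_Mapping.keys (pscale c p) \<subseteq> A"
  using keys_pscale[of c p] by blast

lemma tree3_comb3:
  obtains a b c where "distinct [a, b, c]" "{a, b, c} = {1..3}"
    "\<And>u v. tree3 l u v = (comb3 a b c u v :: 'v btree)"
proof -
  consider "l = 1" | "l = 2" | "l \<noteq> 1" "l \<noteq> 2" by blast
  then show thesis
    by cases (rule that[of 1 2 3] that[of 2 3 1] that[of 3 1 2]; auto simp: tree3_eq_comb3; fail)+
qed

context closed_S2_module
begin

text \<open>Lifts an ideal of the free operad to combinations of trees, where membership is handled
  by linear algebra instead of cosets.\<close>

lemma subspace_free_ideal:
  assumes J: "operadic_ideal (free_operad V) J" and n: "1 \<le> n"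
  shows "pv.subspace {p. Poly_Mapping.keys p \<subseteq> trees V n \<and> free_class V n p \<in> J n}"
proof -
  have "free_class V n 0 \<in> J n"
    using operadic_idealD(2)[OF J n]
    by (simp add: free_operad_def trees.q_zero free_class_def tree_operad_ops)
  moreover have "free_class V n (p + q) \<in> J n"
    if "Poly_Mapping.keys p \<subseteq> trees V n" "Poly_Mapping.keys q \<subseteq> trees V n"
      "free_class V n p \<in> J n" "free_class V n q \<in> J n" for p q
    using operadic_idealD(3)[OF J n that(3,4)] that n by (simp add: free_ops)
  moreover have "free_class V n (pscale c p) \<in> J n"
    if "Poly_Mapping.keys p \<subseteq> trees V n" "free_class V n p \<in> J n" for c p
    using operadic_idealD(4)[OF J n that(2), of c] that n by (simp add: free_ops)
  ultimately show ?thesis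
    by (auto simp: pv.subspace_def keys_add_subset keys_pscale_subset
        dest: subsetD[OF keys_add_subset] subsetD[OF keys_pscale_subset])
qed

text \<open>Additivity at both vertices; the two mixed terms are what polarisation extracts.\<close>

lemma tree3_add:
  assumes "u \<in> mod_carrier V" "u' \<in> mod_carrier V" "v \<in> mod_carrier V" "v' \<in> mod_carrier V"
  shows "monom (tree3 l (mod_add V u u') (mod_add V v v'))
    - (monom (tree3 l u v) + monom (tree3 l u' v') + (monom (tree3 l u v') + monom (tree3 l u' v)))
    \<in> tree_ideal V 3"
proof -
  obtain a b c where d: "distinct [a, b, c]" "{a, b, c} = {1..3}"
    and t: "\<And>u v. tree3 l u v = (comb3 a b c u v :: 'v btree)"
    by (rule tree3_comb3[of l]) (rule that)
  have I: "pv.subspace (tree_ideal V 3)" by (rule subspace_tree_ideal) simp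
  have "monom (comb3 a b c (mod_add V u u') (mod_add V v v'))
     - (monom (comb3 a b c u (mod_add V v v')) + monom (comb3 a b c u' (mod_add V v v'))) \<in> tree_ideal V 3"
    using assms by (intro comb3_inner_add[OF d]) (auto simp: add_in)
  from pv.subspace_add[OF I pv.subspace_add[OF I this comb3_root_add[OF d, of u u v v']] comb3_root_add[OF d, of u' u' v v']]
  show ?thesis using assms by (simp add: t algebra_simps)
qed

text \<open>\<epsilon> is the sign of \<pi>. It is fixed before u and v because the relations of
  \<open>Lie2\<close> involve several pairs of decorations.\<close>

lemma jacobiator_relabel:
  assumes skew: "\<And>v. v \<in> mod_carrier V \<Longrightarrow> mod_swap V v = mod_scale V (- 1) v"
    and \<pi>: "\<pi> permutes {1..3}"
  obtains \<epsilon> where "\<And>u v. u \<in> mod_carrier V \<Longrightarrow> v \<in> mod_carrier V \<Longrightarrow>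
      lin_ext (\<lambda>t. monom (relabel \<pi> t)) (jacobiator u v) - pscale \<epsilon> (jacobiator u v) \<in> tree_ideal V 3"
proof -
  define a b c where abc: "a = \<pi> 1" "b = \<pi> 2" "c = \<pi> 3"
  have e: "{1..3} = {1, 2, 3::nat}" by auto
  have "distinct [a, b, c]" unfolding abc using permutes_inj[OF \<pi>] by (simp add: inj_eq)
  moreover have "{a, b, c} = {1, 2, 3}" unfolding abc using permutes_image[OF \<pi>] unfolding e by simp
  moreover from this have "a \<in> {1, 2, 3}" "b \<in> {1, 2, 3}" "c \<in> {1, 2, 3}" by auto
  ultimately have cases: "(a, b, c) \<in> {(1, 2, 3), (2, 3, 1), (3, 1, 2)} \<or> (b, a, c) \<in> {(1, 2, 3), (2, 3, 1), (3, 1, 2)}"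
    by auto
  have r: "lin_ext (\<lambda>t. monom (relabel \<pi> t)) (jacobiator u v)
      = (monom (comb3 a b c u v) + monom (comb3 b c a u v) + monom (comb3 c a b u v) :: _ \<Rightarrow>\<^sub>0 'k)"
    for u v :: 'v
    by (simp only: jacobiator_eq lin_ext_add lin_ext_monom) (simp add: comb3_def relabel_def abc)
  have I: "pv.subspace (tree_ideal V 3)" by (rule subspace_tree_ideal) simp
  have swap: "monom (comb3 i j k u v) + monom (comb3 j i k u v) \<in> tree_ideal V 3"
    if "distinct [i, j, k]" "{i, j, k} = {1..3}" "u \<in> mod_carrier V" "v \<in> mod_carrier V" for i j k u v
    using pv.subspace_diff[OF I comb3_inner_scale[OF that(1,2,3,3,4,4), of "- 1"] comb3_inner_swap[OF that(1,2,3,3,4,4)]]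
      skew[OF that(3)] by (simp add: algebra_simps)
  from cases show thesis
  proof
    \<comment> \<open>An even permutation only rotates the three terms.\<close>
    assume "(a, b, c) \<in> {(1, 2, 3), (2, 3, 1), (3, 1, 2)}"
    then have "lin_ext (\<lambda>t. monom (relabel \<pi> t)) (jacobiator u v) = (jacobiator u v :: _ \<Rightarrow>\<^sub>0 'k)" for u v :: 'v
      unfolding r unfolding jacobiator_eq by (auto simp: algebra_simps)
    then show thesis
      using pv.subspace_0[OF I] by (intro that[of 1]) simp
  next
    assume *: "(b, a, c) \<in> {(1, 2, 3), (2, 3, 1), (3, 1, 2)}"
    show thesis
    proof (rule that[of "- 1"])
      fix u v assume uv: "u \<in> mod_carrier V" "v \<in> mod_carrier V"
      have "distinct [a, b, c]" "{a, b, c} = {1..3}" "distinct [b, c, a]" "{b, c, a} = {1..3}"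
        "distinct [c, a, b]" "{c, a, b} = {1..3}" using * by auto
      note s = swap[OF this(1,2) uv] swap[OF this(3,4) uv] swap[OF this(5,6) uv]
      \<comment> \<open>For odd \<pi> the relabelled terms are those of the Jacobi sum with inner
        leaves exchanged, and each exchange costs a sign.\<close>
      have j: "jacobiator u v = monom (comb3 b a c u v) + monom (comb3 c b a u v) + monom (comb3 a c b u v)"
        using * by (auto simp: jacobiator_eq algebra_simps)
      show "lin_ext (\<lambda>t. monom (relabel \<pi> t)) (jacobiator u v) - pscale (- 1) (jacobiator u v) \<in> tree_ideal V 3"
        unfolding r unfolding j
        using pv.subspace_add[OF I pv.subspace_add[OF I s(1,2)] s(3)] by (simp add: algebra_simps)
    qed
  qed
qed

end

section \<open>The relations of two compatible Lie brackets\<close>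

interpretation sgn: closed_S2_module sgn_module
  by unfold_locales simp_all

interpretation sgn2: closed_S2_module sgn2_module
  by unfold_locales simp_all

lemma tree_comb_1: "tree_comb 1 e f \<gamma> = (\<Sum>l=1..3. pscale (\<gamma> l 1 1) (monom (tree3 l (e 1) (f 1))))"
  by (simp add: tree_comb_def)

lemma relations_Lie: "relations Lie = {free_class sgn_module 3 (jacobiator 1 1)}"
  by (simp only: jacobiator_def sum_1_3) (simp add: Lie_def)

lemma Lie_simps [simp]: "gens Lie = sgn_module" "gen_dim Lie = 1" "gen_basis Lie = (\<lambda>_. 1)"
  "white Lie i = (1, 0)" "black Lie i = (0, 1)"
  by (simp_all add: Lie_def white_def black_def)

lemma coeffs_spec:
  assumes "r = free_class (gens D) 3 (tree_comb (gen_dim D) (gen_basis D) (gen_basis D) \<gamma>)"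
  shows "r = free_class (gens D) 3 (tree_comb (gen_dim D) (gen_basis D) (gen_basis D) (coeffs D r))"
  unfolding coeffs_def
  by (rule someI[where P="\<lambda>\<gamma>. r = free_class (gens D) 3 (tree_comb (gen_dim D) (gen_basis D) (gen_basis D) \<gamma>)"])
    (rule assms)

text \<open>A chosen family has known values only by uniqueness; the identity is an admissible
  functional because the swap on the sign module is negation.\<close>

lemma coeffs_Lie:
  assumes l: "l \<in> {1..3}"
  shows "coeffs Lie (free_class sgn_module 3 (jacobiator 1 1)) l 1 1 = (1 :: 'k::field)"
proof -
  let ?r = "free_class sgn_module 3 (jacobiator 1 1) :: ('k, 'k) free_element"
  have r: "?r = free_class sgn_module 3 (tree_comb 1 (\<lambda>_. 1) (\<lambda>_. 1) (\<lambda>_ _ _. 1))"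
    unfolding tree_comb_1 jacobiator_def by simp
  let ?L = "Lie :: ('k, 'k) quadratic_data"
  have "?r = free_class (gens ?L) 3 (tree_comb (gen_dim ?L) (gen_basis ?L) (gen_basis ?L) (coeffs ?L ?r))"
    by (rule coeffs_spec[where \<gamma>="\<lambda>_ _ _. 1"]) (unfold Lie_simps, rule r)
  then have "free_class sgn_module 3 (tree_comb 1 (\<lambda>_. 1) (\<lambda>_. 1) (coeffs Lie ?r))
    = free_class sgn_module 3 (tree_comb 1 (\<lambda>_. 1 :: 'k) (\<lambda>_. 1) (\<lambda>_ _ _. 1 :: 'k))"
    unfolding Lie_simps using r by simp
  from sgn.tree_comb_coeffs_unique[where \<alpha>="\<lambda>x. x" and \<beta>="\<lambda>x. x", OF _ _ _ _ _ _ this l]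
  show ?thesis by simp
qed

text \<open>Over the two brackets the coefficients form the symmetric matrix with diagonal a, b and
  off-diagonal c, the same for all three shapes.\<close>

definition Lie2_comb :: "'k::field \<Rightarrow> 'k \<Rightarrow> 'k \<Rightarrow> (('k \<times> 'k) btree \<Rightarrow>\<^sub>0 'k)" where
  "Lie2_comb a b c = pscale a (jacobiator (1, 0) (1, 0)) + pscale b (jacobiator (0, 1) (0, 1))
    + pscale c (jacobiator (1, 0) (0, 1) + jacobiator (0, 1) (1, 0))"

lemma Lie2_comb_linear:
  "Lie2_comb 0 0 0 = 0"
  "Lie2_comb (a + a') (b + b') (c + c') = Lie2_comb a b c + Lie2_comb a' b' c'"
  "Lie2_comb (k * a) (k * b) (k * c) = pscale k (Lie2_comb a b c)"
  by (simp_all add: Lie2_comb_def pv.scale_left_distrib pv.scale_right_distrib)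

lemma keys_Lie2_comb: "Poly_Mapping.keys (Lie2_comb a b c) \<subseteq> trees sgn2_module 3"
  unfolding Lie2_comb_def by (intro keys_add_subset keys_pscale_subset keys_jacobiator) simp_all

lemma Lie2_simps [simp]: "gens Lie2 = sgn2_module" "gen_dim Lie2 = 2"
  "gen_basis Lie2 1 = (1, 0)" "gen_basis Lie2 2 = (0, 1)"
  by (simp_all add: Lie2_def linear_square_def)

lemma relations_Lie2:
  "(relations Lie2 :: ('k::field, 'k \<times> 'k) free_element set) = {free_class sgn2_module 3 (Lie2_comb 1 0 0), free_class sgn2_module 3 (Lie2_comb 0 1 0),
    free_class sgn2_module 3 (Lie2_comb 0 0 1)}"
proof -
  have "tree_comb 1 f g (coeffs Lie (free_class sgn_module 3 (jacobiator 1 1))) = (jacobiator (f 1) (g 1) :: _ \<Rightarrow>\<^sub>0 'k)"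
    for f g :: "nat \<Rightarrow> 'k \<times> 'k"
    unfolding tree_comb_1 jacobiator_def[of "f 1"] by (intro sum.cong refl) (simp add: coeffs_Lie del: One_nat_def)
  then show ?thesis
    by (simp add: Lie2_def linear_square_def compatible_relations_def relations_Lie Lie2_comb_def Let_def insert_commute del: One_nat_def)
qed

lemma S_module_span_Lie2:
  fixes y :: "('k::field, 'k \<times> 'k) free_element"
  assumes "y \<in> S_module_span (free_operad sgn2_module) (in_arity 3 (relations Lie2)) 3"
  obtains a b c where "y = free_class sgn2_module 3 (Lie2_comb a b c)"
proof -
  let ?cl = "free_class sgn2_module 3 :: _ \<Rightarrow> ('k, 'k \<times> 'k) free_element"
  \<comment> \<open>Away from arity 3 the candidate is the full carrier, so that arity 3 carries the
    whole argument.\<close>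
  define N where "N n = (if n = 3 then {?cl (Lie2_comb a b c) |a b c. True} else op_carrier (free_operad sgn2_module) n)" for n
  have act: "op_act (free_operad sgn2_module) 3 (?cl (Lie2_comb a b c)) \<sigma> \<in> N 3" if \<sigma>: "\<sigma> permutes {1..3}" for a b c \<sigma>
  proof -
    let ?\<pi> = "\<lambda>p :: ('k \<times> 'k) btree \<Rightarrow>\<^sub>0 'k. lin_ext (\<lambda>t. monom (relabel (inv \<sigma>) t)) p"
    have I: "pv.subspace (tree_ideal sgn2_module 3)" by (rule sgn2.subspace_tree_ideal) simp
    obtain \<epsilon> where j: "?\<pi> (jacobiator u v) - pscale \<epsilon> (jacobiator u v) \<in> tree_ideal sgn2_module 3" for u v
      by (rule sgn2.jacobiator_relabel[OF _ permutes_inv[OF \<sigma>]]) (simp, rule that, simp)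
    let ?d = "\<lambda>u v. ?\<pi> (jacobiator u v) - pscale \<epsilon> (jacobiator u v)"
    let ?w = "(1, 0) :: 'k \<times> 'k" and ?b = "(0, 1) :: 'k \<times> 'k"
    \<comment> \<open>All four jacobiators share one \<epsilon>, so every combination goes to
      \<epsilon> times itself modulo the tree ideal.\<close>
    have "pscale a (?d ?w ?w) + pscale b (?d ?b ?b) + pscale c (?d ?w ?b + ?d ?b ?w) \<in> tree_ideal sgn2_module 3"
      by (intro pv.subspace_add[OF I] pv.subspace_scale[OF I] j)
    moreover have "pscale a (?d ?w ?w) + pscale b (?d ?b ?b) + pscale c (?d ?w ?b + ?d ?b ?w)
      = ?\<pi> (Lie2_comb a b c) - Lie2_comb (\<epsilon> * a) (\<epsilon> * b) (\<epsilon> * c)"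
      by (simp add: Lie2_comb_def lin_ext_add lin_ext_scale pv.scale_right_distrib pv.scale_right_diff_distrib
          algebra_simps)
    ultimately have "?cl (?\<pi> (Lie2_comb a b c)) = ?cl (Lie2_comb (\<epsilon> * a) (\<epsilon> * b) (\<epsilon> * c))"
      by (simp add: sgn2.free_class_eq_iff)
    then show ?thesis
      using \<sigma> by (auto simp: N_def sgn2.free_ops keys_Lie2_comb)
  qed
  have "sub_S_module (free_operad sgn2_module) N"
    unfolding sub_S_module_def
  proof (intro allI impI)
    fix n :: nat assume n: "1 \<le> n"
    show "N n \<subseteq> op_carrier (free_operad sgn2_module) n \<and> op_zero (free_operad sgn2_module) n \<in> N n \<and>
      (\<forall>x\<in>N n. \<forall>y\<in>N n. op_add (free_operad sgn2_module) n x y \<in> N n) \<and>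
      (\<forall>c. \<forall>x\<in>N n. op_scale (free_operad sgn2_module) n c x \<in> N n) \<and>
      (\<forall>x\<in>N n. \<forall>\<sigma>. \<sigma> permutes {1..n} \<longrightarrow> op_act (free_operad sgn2_module) n x \<sigma> \<in> N n)"
    proof (cases "n = 3")
      case True
      have mem: "?cl (Lie2_comb a b c) \<in> N 3" for a b c by (auto simp: N_def)
      have el: "\<exists>a b c. x = ?cl (Lie2_comb a b c)" if "x \<in> N 3" for x using that by (auto simp: N_def)
      have "op_zero (free_operad sgn2_module) 3 = ?cl (Lie2_comb 0 0 0)"
        by (simp add: free_operad_def sgn2.trees.q_zero free_class_def tree_operad_ops Lie2_comb_linear)
      moreover have "op_add (free_operad sgn2_module) 3 x y \<in> N 3" if "x \<in> N 3" "y \<in> N 3" for x y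
        using el[OF that(1)] el[OF that(2)] mem
        by (auto simp: sgn2.free_ops keys_Lie2_comb simp flip: Lie2_comb_linear(2))
      moreover have "op_scale (free_operad sgn2_module) 3 k x \<in> N 3" if "x \<in> N 3" for k x
        using el[OF that] mem
        by (auto simp: sgn2.free_ops keys_Lie2_comb simp flip: Lie2_comb_linear(3))
      moreover have "N 3 \<subseteq> op_carrier (free_operad sgn2_module) 3"
        using keys_Lie2_comb by (fastforce simp: N_def sgn2.free_carrier)
      moreover have "op_act (free_operad sgn2_module) 3 x \<sigma> \<in> N 3" if "x \<in> N 3" "\<sigma> permutes {1..3}" for x \<sigma>
        using el[OF that(1)] act[OF that(2)] by auto
      ultimately show ?thesis using True mem by simp
    next
      case False
      then show ?thesis
        using n by (auto simp: N_def sgn2.free.zero_closed sgn2.free.add_closed sgn2.free.scale_closed sgn2.free.act_closed)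
    qed
  qed
  moreover have "in_arity 3 (relations Lie2) n \<subseteq> N n" for n
    by (auto simp: in_arity_def N_def relations_Lie2)
  ultimately have "y \<in> N 3" using assms by (rule S_module_span_least)
  then show thesis using that by (auto simp: N_def)
qed

text \<open>With \<alpha> and \<beta> among the two coordinate functionals,
  \<open>tree_comb_coeffs_unique\<close> isolates a single matrix entry.\<close>

lemma coeffs_Lie2:
  fixes a b c :: "'k::field"
  assumes l: "l \<in> {1..3}" and y: "y = free_class sgn2_module 3 (Lie2_comb a b c)"
  shows "coeffs Lie2 y l 1 1 = a" "coeffs Lie2 y l 2 2 = b" "coeffs Lie2 y l 1 2 = c" "coeffs Lie2 y l 2 1 = c"
proof -
  let ?L = "Lie2 :: ('k, 'k \<times> 'k) quadratic_data"
  let ?g = "gen_basis ?L"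
  \<comment> \<open>Only the indices 1 and 2 occur in the sums, so the default c is the off-diagonal
    value.\<close>
  define \<gamma> where "\<gamma> = (\<lambda>(l::nat) i j. if i = (1::nat) \<and> j = (1::nat) then a else if i = 2 \<and> j = 2 then b else c)"
  have "Lie2_comb a b c = tree_comb 2 ?g ?g \<gamma>"
    unfolding tree_comb_def sum_1_2 Lie2_simps Lie2_comb_def jacobiator_def
    by (simp add: \<gamma>_def sum.distrib pv.scale_sum_right pv.scale_right_distrib algebra_simps)
  then have "y = free_class (gens ?L) 3 (tree_comb (gen_dim ?L) ?g ?g \<gamma>)"
    unfolding y Lie2_simps by simp
  then have "y = free_class (gens ?L) 3 (tree_comb (gen_dim ?L) ?g ?g (coeffs Lie2 y))"
    by (rule coeffs_spec)
  with \<open>y = free_class (gens ?L) 3 (tree_comb (gen_dim ?L) ?g ?g \<gamma>)\<close>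
  have eq: "free_class sgn2_module 3 (tree_comb 2 ?g ?g (coeffs Lie2 y)) = free_class sgn2_module 3 (tree_comb 2 ?g ?g \<gamma>)"
    unfolding Lie2_simps by simp
  note u = sgn2.tree_comb_coeffs_unique[OF _ _ _ _ _ _ eq l, unfolded sum_1_2 Lie2_simps]
  show "coeffs Lie2 y l 1 1 = a" using u[where \<alpha>=fst and \<beta>=fst] by (simp add: \<gamma>_def)
  show "coeffs Lie2 y l 2 2 = b" using u[where \<alpha>=snd and \<beta>=snd] by (simp add: \<gamma>_def)
  show "coeffs Lie2 y l 1 2 = c" using u[where \<alpha>=fst and \<beta>=snd] by (simp add: \<gamma>_def)
  show "coeffs Lie2 y l 2 1 = c" using u[where \<alpha>=snd and \<beta>=fst] by (simp add: \<gamma>_def)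
qed

section \<open>The comparison\<close>

lemma sum3_mod_subspace:
  assumes "pv.subspace I" "\<And>l i j. F l i j - G l i j \<in> I"
  shows "(\<Sum>l\<in>A. \<Sum>i\<in>B. \<Sum>j\<in>C. pscale (\<gamma> l i j) (F l i j)) - (\<Sum>l\<in>A. \<Sum>i\<in>B. \<Sum>j\<in>C. pscale (\<gamma> l i j) (G l i j)) \<in> I"
  unfolding sum_subtractf[symmetric] pv.scale_right_diff_distrib[symmetric]
  by (intro pv.subspace_sum[OF assms(1)] pv.subspace_scale[OF assms(1)] assms(2))

locale binary_quadratic = linear_S2_module scale \<tau>
  for scale :: "'k::field \<Rightarrow> 'v::ab_group_add \<Rightarrow> 'v" and \<tau> +
  fixes e :: "nat \<Rightarrow> 'v" and s :: nat and R :: "('k, 'v) free_element set"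
  assumes basis_inj: "inj_on e {1..s}"
    and basis_span: "span (e ` {1..s}) = UNIV"
    and R_carrier: "R \<subseteq> op_carrier (free_operad V) 3"
begin

definition D :: "('k, 'v) quadratic_data" where
  "D = \<lparr>gens = V, gen_dim = s, gen_basis = e, relations = R\<rparr>"

lemma D_simps [simp]: "gens D = V" "gen_dim D = s" "gen_basis D = e" "relations D = R"
  "white D = (\<lambda>i. (e i, 0))" "black D = (\<lambda>i. (0, e i))"
  by (auto simp: D_def white_def black_def)

text \<open>Spanning supplies a witness for the choice in \<open>coeffs\<close>, so the chosen
  family does represent x.\<close>

lemma class_coeffs:
  "x \<in> op_carrier (free_operad V) 3 \<Longrightarrow> x = free_class V 3 (tree_comb s e e (coeffs D x))"
  using free_class_3_tree_comb[OF basis_inj basis_span] coeffs_spec[of x D] by fastforce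

abbreviation \<iota>\<^sub>1 :: "'v \<Rightarrow> 'v \<times> 'v" where "\<iota>\<^sub>1 v \<equiv> (v, 0)"
abbreviation \<iota>\<^sub>2 :: "'v \<Rightarrow> 'v \<times> 'v" where "\<iota>\<^sub>2 v \<equiv> (0, v)"
abbreviation \<delta> :: "'v \<Rightarrow> 'v \<times> 'v" where "\<delta> v \<equiv> (v, v)"

lemma \<tau>_zero: "\<tau> 0 = 0"
  using \<tau>_scale[of 0 0] by simp

sublocale \<iota>\<^sub>1: S2_hom V VV \<iota>\<^sub>1 by unfold_locales (simp_all add: \<tau>_zero)
sublocale \<iota>\<^sub>2: S2_hom V VV \<iota>\<^sub>2 by unfold_locales (simp_all add: \<tau>_zero)
sublocale \<delta>: S2_hom V VV \<delta> by unfold_locales simp_all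

abbreviation "WW \<gamma> \<equiv> tree_comb s (white D) (white D) \<gamma> :: _ \<Rightarrow>\<^sub>0 'k"
abbreviation "BB \<gamma> \<equiv> tree_comb s (black D) (black D) \<gamma> :: _ \<Rightarrow>\<^sub>0 'k"
abbreviation "WB \<gamma> \<equiv> tree_comb s (white D) (black D) \<gamma> + tree_comb s (black D) (white D) \<gamma> :: _ \<Rightarrow>\<^sub>0 'k"
abbreviation "pencil a b c \<gamma> \<equiv> pscale a (WW \<gamma>) + pscale b (BB \<gamma>) + pscale c (WB \<gamma>)"
abbreviation "\<Delta> \<gamma> \<equiv> tree_comb s (\<lambda>i. \<delta> (e i)) (\<lambda>i. \<delta> (e i)) \<gamma> :: _ \<Rightarrow>\<^sub>0 'k"

lemma keys_combs:
  "Poly_Mapping.keys (WW \<gamma>) \<subseteq> trees VV 3" "Poly_Mapping.keys (BB \<gamma>) \<subseteq> trees VV 3"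
  "Poly_Mapping.keys (WB \<gamma>) \<subseteq> trees VV 3" "Poly_Mapping.keys (\<Delta> \<gamma>) \<subseteq> trees VV 3"
  "Poly_Mapping.keys (tree_comb s e e \<gamma>) \<subseteq> trees V 3"
  by (intro keys_add_subset keys_tree_comb; simp)+

lemma keys_pencil: "Poly_Mapping.keys (pencil a b c \<gamma>) \<subseteq> trees VV 3"
  by (intro keys_add_subset[OF keys_add_subset] keys_pscale_subset keys_combs)

text \<open>The left-hand sides mention no coefficients: hence the copies of x depend only on x, and
  equivariantly.\<close>

lemma free_map_combs:
  assumes "x \<in> op_carrier (free_operad V) 3"
  shows "\<iota>\<^sub>1.free_map 3 x = free_class VV 3 (WW (coeffs D x))"
    "\<iota>\<^sub>2.free_map 3 x = free_class VV 3 (BB (coeffs D x))"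
    "\<delta>.free_map 3 x = free_class VV 3 (\<Delta> (coeffs D x))"
  using class_coeffs[OF assms] keys_combs(5)
    \<iota>\<^sub>1.free_map_class[of 3 "tree_comb s e e (coeffs D x)"]
    \<iota>\<^sub>2.free_map_class[of 3 "tree_comb s e e (coeffs D x)"]
    \<delta>.free_map_class[of 3 "tree_comb s e e (coeffs D x)"]
  by (simp_all add: tree_map_tree_comb comp_def)

text \<open>The mixed relation is the polarisation of the relation along the diagonal.\<close>

lemma diagonal_comb: "\<Delta> \<gamma> - (WW \<gamma> + BB \<gamma> + WB \<gamma>) \<in> tree_ideal VV 3"
proof -
  let ?I = "tree_ideal VV 3"
  have I: "pv.subspace ?I" by (rule VV.subspace_tree_ideal) simp
  let ?m = "\<lambda>l f g i j. monom (tree3 l (f (e i)) (g (e j)))"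
  have "?m l \<delta> \<delta> i j - (?m l \<iota>\<^sub>1 \<iota>\<^sub>1 i j + ?m l \<iota>\<^sub>2 \<iota>\<^sub>2 i j + (?m l \<iota>\<^sub>1 \<iota>\<^sub>2 i j + ?m l \<iota>\<^sub>2 \<iota>\<^sub>1 i j)) \<in> ?I" for l i j
    using VV.tree3_add[of "\<iota>\<^sub>1 (e i)" "\<iota>\<^sub>2 (e i)" "\<iota>\<^sub>1 (e j)" "\<iota>\<^sub>2 (e j)" l] by simp
  from sum3_mod_subspace[OF I this, where \<gamma>=\<gamma> and A="{1..3}" and B="{1..s}" and C="{1..s}"]
  show ?thesis
    by (simp add: tree_comb_def sum.distrib pv.scale_right_distrib)
qed

section \<open>The ideal of the compatible square, lifted to trees\<close>

abbreviation "J \<equiv> generated_ideal (free_operad VV) (in_arity 3 (compatible_relations D))"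

lemma compatible_relations_eq:
  "compatible_relations D = (\<Union>r\<in>R. {free_class VV 3 (WW (coeffs D r)),
     free_class VV 3 (BB (coeffs D r)), free_class VV 3 (WB (coeffs D r))})"
  by (auto simp: compatible_relations_def Let_def)

lemma compatible_relations_carrier:
  "in_arity 3 (compatible_relations D) n \<subseteq> op_carrier (free_operad VV) n"
  using keys_combs by (auto simp: in_arity_def compatible_relations_eq VV.free_carrier)

lemma ideal_J: "operadic_ideal (free_operad VV) J"
  by (rule operadic_ideal_generated[OF VV.free.is_operad_axioms compatible_relations_carrier])

definition "K = {p. Poly_Mapping.keys p \<subseteq> trees VV 3 \<and> free_class VV 3 p \<in> J 3}"

lemma subspace_K: "pv.subspace K"
  unfolding K_def by (rule VV.subspace_free_ideal[OF ideal_J]) simp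

lemma K_cong:
  assumes "p - q \<in> tree_ideal VV 3" "q \<in> K" "Poly_Mapping.keys p \<subseteq> trees VV 3"
  shows "p \<in> K"
  using assms VV.free_class_eq_iff[of 3 p q] by (simp add: K_def)

lemma relation_in_K:
  assumes "r \<in> R"
  shows "WW (coeffs D r) \<in> K" "BB (coeffs D r) \<in> K" "WB (coeffs D r) \<in> K"
  unfolding K_def using assms keys_combs
  by (auto intro!: generated_ideal_superset simp: in_arity_def compatible_relations_eq)

text \<open>For an operad map f the elements sent into J form an ideal, in particular an
  S-submodule, so checking f on R covers the span. This handles the two monochrome copies and the
  diagonal one, from which the mixed copy is recovered.\<close>

lemma S_module_span_in_K:
  assumes x: "x \<in> S_module_span (free_operad V) (in_arity 3 R) 3"
  shows "x \<in> op_carrier (free_operad V) 3"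
    and "WW (coeffs D x) \<in> K" "BB (coeffs D x) \<in> K" "WB (coeffs D x) \<in> K"
proof -
  have span: "x \<in> op_carrier (free_operad V) 3 \<and> f 3 x \<in> J 3"
    if f: "operad_hom (free_operad V) (free_operad VV) f" and R: "\<And>r. r \<in> R \<Longrightarrow> f 3 r \<in> J 3" for f
  proof -
    have "sub_S_module (free_operad V) (\<lambda>n. {x \<in> op_carrier (free_operad V) n. f n x \<in> J n})"
      using operad_hom.operadic_ideal_vimage[OF f ideal_J] by (simp add: operadic_ideal_def)
    moreover have "in_arity 3 R n \<subseteq> {x \<in> op_carrier (free_operad V) n. f n x \<in> J n}" for n
      using R R_carrier by (auto simp: in_arity_def)
    ultimately have "x \<in> {x \<in> op_carrier (free_operad V) 3. f 3 x \<in> J 3}"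
      using x by (rule S_module_span_least)
    then show ?thesis by simp
  qed
  have r: "r \<in> op_carrier (free_operad V) 3" if "r \<in> R" for r using R_carrier that by blast
  \<comment> \<open>Modulo the tree ideal, the diagonal image of a relation is the sum of its three
    copies.\<close>
  have "\<Delta> (coeffs D r) \<in> K" if "r \<in> R" for r
    by (rule K_cong[OF diagonal_comb _ keys_combs(4)])
      (intro pv.subspace_add[OF subspace_K] relation_in_K that)
  then have 1: "\<iota>\<^sub>1.free_map 3 r \<in> J 3" "\<iota>\<^sub>2.free_map 3 r \<in> J 3" "\<delta>.free_map 3 r \<in> J 3" if "r \<in> R" for r
    using relation_in_K[OF that] that by (simp_all add: free_map_combs[OF r] K_def)
  show c: "x \<in> op_carrier (free_operad V) 3"
    using span[OF \<delta>.free.operad_hom_axioms 1(3)] by blast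
  show W: "WW (coeffs D x) \<in> K"
    using span[OF \<iota>\<^sub>1.free.operad_hom_axioms 1(1)] keys_combs by (simp add: free_map_combs[OF c] K_def)
  show B: "BB (coeffs D x) \<in> K"
    using span[OF \<iota>\<^sub>2.free.operad_hom_axioms 1(2)] keys_combs by (simp add: free_map_combs[OF c] K_def)
  have d: "\<Delta> (coeffs D x) \<in> K"
    using span[OF \<delta>.free.operad_hom_axioms 1(3)] keys_combs by (simp add: free_map_combs[OF c] K_def)
  have I: "pv.subspace (tree_ideal VV 3)" by (rule VV.subspace_tree_ideal) simp
  show "WB (coeffs D x) \<in> K"
  proof (rule K_cong[OF _ _ keys_combs(3)])
    show "WB (coeffs D x) - (\<Delta> (coeffs D x) - WW (coeffs D x) - BB (coeffs D x)) \<in> tree_ideal VV 3"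
      using pv.subspace_neg[OF I diagonal_comb[of "coeffs D x"]] by (simp add: algebra_simps)
    show "\<Delta> (coeffs D x) - WW (coeffs D x) - BB (coeffs D x) \<in> K"
      by (intro pv.subspace_diff[OF subspace_K] W B d)
  qed
qed

lemma tensor_eq_\<phi>:
  "tensor V sgn2_module v (1, 0) = \<phi> (v, 0)" "tensor V sgn2_module v (0, 1) = \<phi> (0, v)"
proof -
  \<comment> \<open>0 \<otimes> w vanishes by homogeneity with scalar 0, which removes the zero
    component in \<phi>.\<close>
  have "monom (0, w) \<in> null" for w using tensor_null(3)[of 0 0 w] by simp
  then show "tensor V sgn2_module v (1, 0) = \<phi> (v, 0)" "tensor V sgn2_module v (0, 1) = \<phi> (0, v)"
    by (simp_all add: tensor_def \<phi>_def tensor_class_eq_iff pv.span_neg)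
qed

text \<open>\<open>Psi\<close> multiplies coefficients shape by shape; those of y are constant in l,
  so each shape in x is coloured by the same symmetric matrix.\<close>

lemma Psi_Lie2:
  fixes x :: "('k, 'v) free_element"
  assumes y: "y = free_class sgn2_module 3 (Lie2_comb a b c)"
  shows "Psi D Lie2 x y = \<phi>.free_map 3 (free_class VV 3
    (pencil a b c (coeffs D x)))"
proof -
  define \<gamma> where "\<gamma> = coeffs D x"
  let ?m = "\<lambda>l i j u v. monom (tree3 l (\<phi> (u i)) (\<phi> (v j)))"
  let ?W = "white D" and ?B = "black D"
  let ?L = "Lie2 :: ('k, 'k \<times> 'k) quadratic_data"
  have "(\<Sum>k=1..2. \<Sum>m=1..2. pscale (\<gamma> l i j * coeffs ?L y l k m)
      (monom (tree3 l (tensor V sgn2_module (e i) (gen_basis ?L k)) (tensor V sgn2_module (e j) (gen_basis ?L m)))))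
    = pscale (\<gamma> l i j) (pscale a (?m l i j ?W ?W) + pscale b (?m l i j ?B ?B) + pscale c (?m l i j ?W ?B + ?m l i j ?B ?W))"
    if "l \<in> {1..3}" for l i j
    unfolding sum_1_2 Lie2_simps coeffs_Lie2[OF that y] tensor_eq_\<phi>
    by (simp add: pv.scale_right_distrib algebra_simps)
  then have "Psi D Lie2 x y = free_class T 3 (\<Sum>l=1..3. \<Sum>i=1..s. \<Sum>j=1..s. pscale (\<gamma> l i j)
      (pscale a (?m l i j ?W ?W) + pscale b (?m l i j ?B ?B) + pscale c (?m l i j ?W ?B + ?m l i j ?B ?W)))"
    unfolding Psi_def Let_def D_simps Lie2_simps \<gamma>_def[symmetric]
    by (intro arg_cong[where f="free_class T 3"] sum.cong refl) simp
  also have "(\<Sum>l=1..3. \<Sum>i=1..s. \<Sum>j=1..s. pscale (\<gamma> l i j)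
      (pscale a (?m l i j ?W ?W) + pscale b (?m l i j ?B ?B) + pscale c (?m l i j ?W ?B + ?m l i j ?B ?W)))
    = tree_map \<phi> (pencil a b c \<gamma>)"
    by (simp add: tree_map_linear tree_map_tree_comb tree_comb_def pv.scale_sum_right pv.scale_right_distrib
        sum.distrib mult.commute)
  also have "free_class T 3 \<dots> = \<phi>.free_map 3 (free_class VV 3 (pencil a b c \<gamma>))"
    by (rule \<phi>.free_map_class[symmetric]) (simp, rule keys_pencil)
  finally show ?thesis unfolding \<gamma>_def .
qed

text \<open>\<open>S_module_span_Lie2\<close> gives the form of y; keeping its membership as a side
  condition lets \<open>Psi_Lie2\<close> be read in both directions.\<close>

lemma black_product_relations_eq:
  "black_product_relations D Lie2 = {\<phi>.free_map 3 (free_class VV 3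
      (pencil a b c (coeffs D x))) |x a b c.
      x \<in> S_module_span (free_operad V) (in_arity 3 R) 3 \<and>
      free_class sgn2_module 3 (Lie2_comb a b c) \<in> S_module_span (free_operad sgn2_module) (in_arity 3 (relations Lie2)) 3}"
  (is "?A = ?B")
proof
  show "?A \<subseteq> ?B"
  proof
    fix z assume "z \<in> ?A"
    then obtain x y where z: "z = Psi D Lie2 x y" and x: "x \<in> S_module_span (free_operad V) (in_arity 3 R) 3"
      and y: "y \<in> S_module_span (free_operad sgn2_module) (in_arity 3 (relations Lie2)) 3"
      by (auto simp: black_product_relations_def)
    from y obtain a b c where "y = free_class sgn2_module 3 (Lie2_comb a b c)" by (rule S_module_span_Lie2)
    with x y z show "z \<in> ?B" using Psi_Lie2 by blast
  qed
  show "?B \<subseteq> ?A"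
    using Psi_Lie2[OF refl] unfolding black_product_relations_def D_simps Lie2_simps by blast
qed

lemma black_product_relations_carrier:
  "in_arity 3 (black_product_relations D Lie2) n \<subseteq> op_carrier (free_operad T) n"
proof -
  have "free_class VV 3 (pencil a b c \<gamma>) \<in> op_carrier (free_operad VV) 3" for a b c \<gamma>
    using keys_pencil unfolding VV.free_carrier by blast
  from \<phi>.free.hom_closed[OF _ this] show ?thesis
    by (simp add: in_arity_def black_product_relations_eq) blast
qed

abbreviation "J' \<equiv> generated_ideal (free_operad T) (in_arity 3 (black_product_relations D Lie2))"

text \<open>The three kinds of compatible relation are the pencil at the unit triples, that is,
  products with the three defining relations of \<open>Lie2\<close>.\<close>

lemma compatible_in_black:
  assumes "x \<in> compatible_relations D"
  shows "\<phi>.free_map 3 x \<in> black_product_relations D Lie2"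
proof -
  from assms obtain r a b c where r: "r \<in> R"
    and x: "x = free_class VV 3 (pencil a b c (coeffs D r))"
    and abc: "(a, b, c) \<in> {(1, 0, 0), (0, 1, 0), (0, 0, 1)}"
  proof -
    show thesis if "\<And>r a b c. r \<in> R \<Longrightarrow>
        x = free_class VV 3 (pencil a b c (coeffs D r)) \<Longrightarrow>
        (a, b, c) \<in> {(1, 0, 0), (0, 1, 0), (0, 0, 1)} \<Longrightarrow> thesis"
      using assms that[of _ 1 0 0] that[of _ 0 1 0] that[of _ 0 0 1] by (auto simp: compatible_relations_eq)
  qed
  have "r \<in> S_module_span (free_operad V) (in_arity 3 R) 3"
    using r by (intro S_module_span_superset) (simp add: in_arity_def)
  moreover have "free_class sgn2_module 3 (Lie2_comb a b c)
      \<in> S_module_span (free_operad sgn2_module) (in_arity 3 (relations Lie2)) 3"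
    using abc by (intro S_module_span_superset) (auto simp: in_arity_def relations_Lie2)
  ultimately show ?thesis unfolding x black_product_relations_eq by blast
qed

text \<open>Here x ranges over the whole span of R; its three copies still lie in the ideal by
  \<open>S_module_span_in_K\<close>, and so does any pencil of them.\<close>

lemma black_in_compatible:
  assumes "z \<in> black_product_relations D Lie2"
  shows "z \<in> \<phi>.free_map 3 ` J 3"
proof -
  from assms obtain x a b c where x: "x \<in> S_module_span (free_operad V) (in_arity 3 R) 3"
    and z: "z = \<phi>.free_map 3 (free_class VV 3
      (pencil a b c (coeffs D x)))"
    unfolding black_product_relations_eq by blast
  have "pencil a b c (coeffs D x) \<in> K"
    by (intro pv.subspace_add[OF subspace_K] pv.subspace_scale[OF subspace_K] S_module_span_in_K[OF x])
  then show ?thesis unfolding z K_def by blast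
qed

text \<open>Generators are matched for every v, since the isomorphism is induced by \<phi>, which is
  defined without coordinates.\<close>

lemma linear_square_iso_black_product:
  "\<exists>\<Phi>. operad_iso \<Phi> (quadratic_operad (linear_square D)) (quadratic_operad (black_product D Lie2)) \<and>
    (\<forall>v. \<Phi> 2 (generator (linear_square D) (v, 0)) =
        generator (black_product D Lie2) (tensor V sgn2_module v (1, 0)) \<and>
      \<Phi> 2 (generator (linear_square D) (0, v)) =
        generator (black_product D Lie2) (tensor V sgn2_module v (0, 1)))"
proof (intro exI conjI allI)
  have g: "gens (linear_square D) = VV" "relations (linear_square D) = compatible_relations D"
    "gens (black_product D Lie2) = T" "relations (black_product D Lie2) = black_product_relations D Lie2"
    by (simp_all add: linear_square_def black_product_def)
  let ?\<Phi> = "quotient_map (free_operad T) J' \<phi>.free_map"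
  have XY: "\<phi>.free_map n x \<in> J' n" if "x \<in> in_arity 3 (compatible_relations D) n" for n x
    using that compatible_in_black by (auto simp: in_arity_def split: if_splits intro!: generated_ideal_superset)
  have YX: "z \<in> \<phi>.free_map n ` J n" if "z \<in> in_arity 3 (black_product_relations D Lie2) n" for n z
    using that black_in_compatible by (auto simp: in_arity_def split: if_splits)
  note iso = operad_iso_quotient_generated[OF operad_iso_free_\<phi> compatible_relations_carrier
      black_product_relations_carrier XY YX]
  show "operad_iso ?\<Phi> (quadratic_operad (linear_square D)) (quadratic_operad (black_product D Lie2))"
    unfolding quadratic_operad_def g by (rule iso(1))
  have gen: "?\<Phi> 2 (generator (linear_square D) x) = generator (black_product D Lie2) (\<phi> x)" for x
  proof -
    have k: "Poly_Mapping.keys (corolla x :: _ \<Rightarrow>\<^sub>0 'k) \<subseteq> trees VV 2"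
      by (auto simp: corolla_def trees_def)
    have "free_class VV 2 (corolla x) \<in> op_carrier (free_operad VV) 2"
      using k by (auto simp: VV.free_carrier)
    moreover have "\<phi>.free_map 2 (free_class VV 2 (corolla x)) = free_class T 2 (corolla (\<phi> x))"
      using k by (subst \<phi>.free_map_class) (simp_all add: corolla_def tree_map_linear)
    ultimately show ?thesis
      unfolding generator_def g by (subst iso(2)) simp_all
  qed
  show "?\<Phi> 2 (generator (linear_square D) (v, 0)) = generator (black_product D Lie2) (tensor V sgn2_module v (1, 0))"
    "?\<Phi> 2 (generator (linear_square D) (0, v)) = generator (black_product D Lie2) (tensor V sgn2_module v (0, 1))" for v
    by (simp_all only: tensor_eq_\<phi> gen)
qed

end

theorem theorem1p21:
  fixes scale :: "'k::field \<Rightarrow> 'v::ab_group_add \<Rightarrow> 'v"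
    and \<tau> :: "'v \<Rightarrow> 'v"
    and e :: "nat \<Rightarrow> 'v"
    and s :: nat
    and R :: "('k, 'v) free_element set"
    and \<O> :: "('k, 'v) quadratic_data"
  assumes "vector_space scale"
    and "Vector_Spaces.linear scale scale \<tau>"
    and "\<And>v. \<tau> (\<tau> v) = v"
    and "inj_on e {1..s}"
    and "\<not> module.dependent scale (e ` {1..s})"
    and "module.span scale (e ` {1..s}) = UNIV"
    and "R \<subseteq> op_carrier (free_operad (S2_module_of scale \<tau>)) 3"
    and "\<O> = \<lparr>gens = S2_module_of scale \<tau>, gen_dim = s, gen_basis = e, relations = R\<rparr>"
  shows "\<exists>\<Phi>. operad_iso \<Phi> (quadratic_operad (linear_square \<O>))
                (quadratic_operad (black_product \<O> Lie2)) \<and>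
    (\<forall>i\<in>{1..s}.
      \<Phi> 2 (generator (linear_square \<O>) (white \<O> i)) =
        generator (black_product \<O> Lie2) (tensor (gens \<O>) (gens Lie2) (e i) (white Lie 1)) \<and>
      \<Phi> 2 (generator (linear_square \<O>) (black \<O> i)) =
        generator (black_product \<O> Lie2) (tensor (gens \<O>) (gens Lie2) (e i) (black Lie 1)))"
proof -
  interpret vector_space scale by fact
  interpret \<tau>: Vector_Spaces.linear scale scale \<tau> by fact
  interpret binary_quadratic scale \<tau> e s R
    by unfold_locales (use assms \<tau>.add \<tau>.scale in simp_all)
  have "\<O> = D" by (simp add: assms(8) D_def)
  \<comment> \<open>Take v = e i: \<open>white\<close> and \<open>black\<close> of \<O> are the two
    inclusions of e i, and those of \<open>Lie\<close> are (1, 0) and (0, 1).\<close>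
  then show ?thesis using linear_square_iso_black_product by auto
qed

end
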